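(* Let $u_0:[0,1]\to\mathbb{R}$ be piecewise Lipschitz, and let $u$ be the solution of the boundary value problem $$ \begin{aligned} &u_t(x,t)+u_{xxx}(x,t)=0, && x\in(0,1),\ t\in\mathbb{R},\\ &u(0,t)=0,\quad u(1,t)=0,\quad u_x(1,t)=u_x(0,t), && t\in\mathbb{R},\\ &u(x,0)=u_0(x), && x\in(0,1). \end{aligned} $$ Then, for all $t\in\mathbb{R}$, $u$ admits the representation $$u(x,t)=U_{\mathcal R}(x,t)+U_{\mathcal C}(x,t),$$ where $U_{\mathcal C}(\cdot,t)$ is continuous on $(0,1)$ and $$U_{\mathcal R}(x,t)=\sum_{n=1}^\infty 2\operatorname{Re}\left[\widetilde{u_0}(n)\,e^{i(2n-\frac13)^3\pi^3 t}\,e^{i(2n-\frac13)\pi x}\right],\qquad \widetilde{u_0}(n)=\int_0^1\left[u_0(y)+u_0(1)+u_0(0)\right]e^{-i(2n-\frac13)\pi y}\,dy.$$ Moreover, for all coprime $p,q\in\mathbb{N}$ there are scalar coefficients $d_k^{p,q}\in\mathbb{C}$, $k=0,\dots,q-1$, independent of $u_0$, such that $$U_{\mathcal R}\left(x,\frac{p}{q\pi^2}\right)=\operatorname{Re}\left\{e^{-i\frac{\pi}{27}\left(9x+\frac pq\right)}\left[L_1(x)+iL_2(x)-L_3\right]\right\},$$ where $$L_1(x)=\sum_{k=0}^{q-1}d_k^{p,q}\,G_{u_0}\left(x+\frac{p}{3q}-\frac kq\right),\qquad L_2(x)=\sum_{k=0}^{q-1}d_k^{p,q}\,[\mathcal{H}G_{u_0}]\left(x+\frac{p}{3q}-\frac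 kq\right),\qquad L_3=\int_0^1G_{u_0}(y)\,dy,$$ and $$G_{u_0}(x)=\left[u_0(x)+u_0(1)+u_0(0)\right]e^{i\frac{\pi x}{3}},$$ with $\mathcal{H}$ the $1$-periodic Hilbert transform.
   Context: $\mathbb{N}=\{1,2,3,\dots\}$. Piecewise Lipschitz: $u_0$ is piecewise Lipschitz on $[0,1]$ if there are points $0=x_0<x_1<\dots<x_k<x_{k+1}=1$ such that $u_0$ is Lipschitz on each open interval $(x_j,x_{j+1})$, $j=0,\dots,k$. The boundary values are the one-sided limits: $u_0(0)=u_0(0^+)$ and $u_0(1)=u_0(1^-)$. Solution: let $A\phi=i\phi_{xxx}$ with domain $\{\phi\in H^3(0,1):\phi(0)=0,\ \phi(1)=0,\ \phi_x(1)=\phi_x(0)\}$. $A$ is self-adjoint in $L^2(0,1)$ with compact resolvent, and the solution of the boundary value problem is $u(\cdot,t)=e^{iAt}u_0\in L^2(0,1)$. Periodic Hilbert transform on $(0,1)$: for $v\in L^2(0,1)$ with $\widehat v(n)=\int_0^1v(y)e^{-2\pi i ny}\,dy$, $$\mathcal{H}v(x)=i\sum_{n=1}^\infty\left[\widehat v(-n)e^{-2\pi i nx}-\widehat v(n)e^{2\pi i nx}\right].$$ In $L_1$ and $L_2$, the functions $G_{u_0}$ and $\mathcal{H}G_{u_0}$ are extended $1$-periodically from $[0,1)$ to $\mathbb{R}$. Series of functions of $x$ converge in $L^2(0,1)$, and identities between such functions are equalities in $L^2(0,1)$, i.e. for almost every $x\in(0,1)$. *)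

theory Defs
  imports "HOL-Analysis.Analysis"
begin

section \<open>The space \<open>L\<^sup>2(0,1)\<close>\<close>

text \<open>Elements of \<open>L\<^sup>2(0,1)\<close> are represented by functions on the reals, of which only the
  restriction to the open unit interval matters; equality in \<open>L\<^sup>2(0,1)\<close> is equality almost
  everywhere with respect to the following measure.\<close>

abbreviation unit_lebesgue :: "real measure" where
  "unit_lebesgue \<equiv> lebesgue_on {0<..<1}"

definition L2 :: "(real \<Rightarrow> 'a::real_normed_vector) \<Rightarrow> bool" where
  "L2 f \<longleftrightarrow> f \<in> borel_measurable unit_lebesgue \<and> integrable unit_lebesgue (\<lambda>x. (norm (f x))\<^sup>2)"

definition L2_inner :: "(real \<Rightarrow> complex) \<Rightarrow> (real \<Rightarrow> complex) \<Rightarrow> complex" where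
  "L2_inner f g = (LINT x|unit_lebesgue. f x * cnj (g x))"

definition L2_sums :: "(nat \<Rightarrow> real \<Rightarrow> 'a::real_normed_vector) \<Rightarrow> (real \<Rightarrow> 'a) \<Rightarrow> bool" where
  "L2_sums F s \<longleftrightarrow> (\<forall>n. L2 (F n)) \<and> L2 s \<and>
     (\<lambda>N. LINT x|unit_lebesgue. (norm ((\<Sum>n<N. F n x) - s x))\<^sup>2) \<longlonglongrightarrow> 0"

text \<open>A representative of the sum of a series that converges in \<open>L\<^sup>2(0,1)\<close>; it is determined
  almost everywhere on \<open>(0,1)\<close> only, and is meaningless if the series diverges.\<close>

definition L2_suminf :: "(nat \<Rightarrow> real \<Rightarrow> 'a::real_normed_vector) \<Rightarrow> real \<Rightarrow> 'a" where
  "L2_suminf F = (SOME s. L2_sums F s)"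


section \<open>Unitary groups\<close>

text \<open>An unbounded operator in \<open>L\<^sup>2(0,1)\<close> is given by its graph: \<open>A \<phi> \<psi>\<close> means that \<open>\<phi>\<close> belongs
  to the domain of \<open>A\<close> and that \<open>\<psi>\<close> is its image.\<close>

type_synonym L2_operator = "(real \<Rightarrow> complex) \<Rightarrow> (real \<Rightarrow> complex) \<Rightarrow> bool"

text \<open>A complete orthonormal system \<open>\<phi>\<close> of eigenfunctions, with real eigenvalues \<open>\<mu>\<close>. A
  self-adjoint operator with compact resolvent in \<open>L\<^sup>2(0,1)\<close> has such a system.\<close>

definition orthonormal_eigenbasis ::
  "L2_operator \<Rightarrow> (nat \<Rightarrow> real \<Rightarrow> complex) \<Rightarrow> (nat \<Rightarrow> real) \<Rightarrow> bool" where
  "orthonormal_eigenbasis A \<phi> \<mu> \<longleftrightarrow>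
     (\<forall>n. L2 (\<phi> n)) \<and>
     (\<forall>m n. L2_inner (\<phi> m) (\<phi> n) = (if m = n then 1 else 0)) \<and>
     (\<forall>f. L2 f \<longrightarrow> (\<forall>n. L2_inner f (\<phi> n) = 0) \<longrightarrow> (AE x in unit_lebesgue. f x = 0)) \<and>
     (\<forall>n. A (\<phi> n) (\<lambda>x. of_real (\<mu> n) * \<phi> n x))"

text \<open>\<open>exp_itA A t f g\<close> means \<open>g = e\<^sup>i\<^sup>A\<^sup>t f\<close>, for \<open>A\<close> self-adjoint with compact resolvent; the
  functional calculus of such an operator is given by eigenfunction expansion, and the result
  does not depend on the chosen eigenbasis.\<close>

definition exp_itA :: "L2_operator \<Rightarrow> real \<Rightarrow> (real \<Rightarrow> complex) \<Rightarrow> (real \<Rightarrow> complex) \<Rightarrow> bool" where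
  "exp_itA A t f g \<longleftrightarrow> (\<exists>\<phi> \<mu>. orthonormal_eigenbasis A \<phi> \<mu> \<and>
     L2_sums (\<lambda>n x. exp (\<i> * of_real (\<mu> n * t)) * L2_inner f (\<phi> n) * \<phi> n x) g)"


section \<open>The boundary value problem\<close>

text \<open>\<open>f\<close> is absolutely continuous on \<open>[0,1]\<close> with (weak) derivative \<open>g\<close>.\<close>

definition AC_deriv :: "(real \<Rightarrow> complex) \<Rightarrow> (real \<Rightarrow> complex) \<Rightarrow> bool" where
  "AC_deriv f g \<longleftrightarrow> integrable unit_lebesgue g \<and>
     (\<forall>x\<in>{0..1}. f x = f 0 + (LINT y|lebesgue_on {0<..<x}. g y))"

text \<open>The operator \<open>A\<phi> = i\<phi>\<^sub>x\<^sub>x\<^sub>x\<close>. A function is in \<open>H\<^sup>3(0,1)\<close> iff it agrees almost everywhere with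
  some \<open>f\<close> such that \<open>f\<close>, \<open>f'\<close>, \<open>f''\<close> are absolutely continuous on \<open>[0,1]\<close> and
  \<open>f'''\<close> is in \<open>L\<^sup>2(0,1)\<close>; the boundary conditions are those of this representative \<open>f\<close>.\<close>

definition airy_operator :: L2_operator where
  "airy_operator \<phi> \<psi> \<longleftrightarrow> (\<exists>f f1 f2 f3.
     AC_deriv f f1 \<and> AC_deriv f1 f2 \<and> AC_deriv f2 f3 \<and> L2 f3 \<and>
     f 0 = 0 \<and> f 1 = 0 \<and> f1 1 = f1 0 \<and>
     (AE x in unit_lebesgue. \<phi> x = f x) \<and> (AE x in unit_lebesgue. \<psi> x = \<i> * f3 x))"

definition airy_solution :: "(real \<Rightarrow> real) \<Rightarrow> (real \<Rightarrow> real \<Rightarrow> complex) \<Rightarrow> bool" where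
  "airy_solution u0 u \<longleftrightarrow>
     (\<forall>t. exp_itA airy_operator t (\<lambda>x. of_real (u0 x)) (\<lambda>x. u x t))"

text \<open>The boundary values \<open>u0 0\<close> and \<open>u0 1\<close> are required to be the one-sided limits.\<close>

definition piecewise_lipschitz :: "(real \<Rightarrow> real) \<Rightarrow> bool" where
  "piecewise_lipschitz u0 \<longleftrightarrow>
     (\<exists>(k::nat) (x::nat \<Rightarrow> real). x 0 = 0 \<and> x (Suc k) = 1 \<and>
        (\<forall>j\<le>k. x j < x (Suc j) \<and> (\<exists>C. C-lipschitz_on {x j<..<x (Suc j)} u0))) \<and>
     (u0 \<longlongrightarrow> u0 0) (at_right 0) \<and> (u0 \<longlongrightarrow> u0 1) (at_left 1)"


section \<open>The revival part\<close>

text \<open>In the following two series the summation index is shifted: the \<open>n\<close>-th term here is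
  the term with index \<open>Suc n\<close> of the series starting from 1.\<close>

definition airy_freq :: "nat \<Rightarrow> real" where
  "airy_freq n = (2 * real n - 1/3) * pi"

definition tilde_coeff :: "(real \<Rightarrow> real) \<Rightarrow> nat \<Rightarrow> complex" where
  "tilde_coeff u0 n =
     (LINT y|unit_lebesgue. of_real (u0 y + u0 1 + u0 0) * exp (- \<i> * of_real (airy_freq n * y)))"

definition UR_term :: "(real \<Rightarrow> real) \<Rightarrow> real \<Rightarrow> nat \<Rightarrow> real \<Rightarrow> real" where
  "UR_term u0 t n x =
     2 * Re (tilde_coeff u0 (Suc n) * exp (\<i> * of_real (airy_freq (Suc n) ^ 3 * t))
             * exp (\<i> * of_real (airy_freq (Suc n) * x)))"

definition UR :: "(real \<Rightarrow> real) \<Rightarrow> real \<Rightarrow> real \<Rightarrow> real" where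
  "UR u0 x t = L2_suminf (UR_term u0 t) x"

definition fourier_coeff :: "(real \<Rightarrow> complex) \<Rightarrow> int \<Rightarrow> complex" where
  "fourier_coeff v n = (LINT y|unit_lebesgue. v y * exp (- 2 * pi * \<i> * of_int n * of_real y))"

definition hilbert_transform :: "(real \<Rightarrow> complex) \<Rightarrow> real \<Rightarrow> complex" where
  "hilbert_transform v = L2_suminf (\<lambda>n x. \<i> *
     (fourier_coeff v (- int (Suc n)) * exp (- 2 * pi * \<i> * of_nat (Suc n) * of_real x)
      - fourier_coeff v (int (Suc n)) * exp (2 * pi * \<i> * of_nat (Suc n) * of_real x)))"

definition periodic_ext :: "(real \<Rightarrow> complex) \<Rightarrow> real \<Rightarrow> complex" where
  "periodic_ext v x = v (frac x)"

definition G :: "(real \<Rightarrow> real) \<Rightarrow> real \<Rightarrow> complex" where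
  "G u0 x = of_real (u0 x + u0 1 + u0 0) * exp (\<i> * of_real (pi * x / 3))"

definition L1_part :: "(nat \<Rightarrow> complex) \<Rightarrow> nat \<Rightarrow> nat \<Rightarrow> (real \<Rightarrow> real) \<Rightarrow> real \<Rightarrow> complex" where
  "L1_part d p q u0 x =
     (\<Sum>k<q. d k * periodic_ext (G u0) (x + real p / (3 * real q) - real k / real q))"

definition L2_part :: "(nat \<Rightarrow> complex) \<Rightarrow> nat \<Rightarrow> nat \<Rightarrow> (real \<Rightarrow> real) \<Rightarrow> real \<Rightarrow> complex" where
  "L2_part d p q u0 x =
     (\<Sum>k<q. d k * periodic_ext (hilbert_transform (G u0))
                    (x + real p / (3 * real q) - real k / real q))"

definition L3_part :: "(real \<Rightarrow> real) \<Rightarrow> complex" where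
  "L3_part u0 = (LINT y|unit_lebesgue. G u0 y)"

end

theory Submission
  imports Defs "HOL-Complex_Analysis.Conformal_Mappings"
begin

text \<open>
  The eigenvalues of the operator are the cubes of the real numbers \<open>\<kappa> \<noteq> 0\<close> for which an explicit
  function of \<open>\<kappa>\<close> vanishes, and they are simple. The large positive \<open>\<kappa>\<close> are exponentially close to
  \<open>(2n - 1/3)\<pi>\<close>, and their eigenfunctions are \<open>e\<^sup>i\<^sup>\<kappa>\<^sup>x\<close> up to two boundary layers of width \<open>1/\<kappa>\<close>. The
  coefficient of \<open>u\<^sub>0\<close> is its Fourier integral plus the contributions of the two layers, which to
  leading order see only \<open>u\<^sub>0(0)\<close> and \<open>u\<^sub>0(1)\<close>; together they amount to replacing \<open>u\<^sub>0\<close> by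
  \<open>u\<^sub>0 + u\<^sub>0(1) + u\<^sub>0(0)\<close> in the Fourier integral. So the series of the differences between the terms of the
  eigenfunction expansion and the terms of the revival part converges locally uniformly on \<open>(0,1)\<close>.

  At a rational time the phase \<open>(2n - 1/3)\<^sup>3\<pi>\<^sup>3t\<close> is, up to a part that is affine in \<open>n\<close>, periodic in \<open>n\<close>
  modulo \<open>2\<pi>\<close>. A finite Fourier transform turns the periodic factor into translations, and
  \<open>G - \<integral>G + \<i> \<H> G\<close> is twice the sum of the positive-frequency part of the Fourier series of \<open>G\<close>.
\<close>

section \<open>The space \<open>L\<^sup>2(0,1)\<close>\<close>

text \<open>No spectral theorem is invoked: an eigenbasis, in unknown order and with unknown phases,
  comes with the hypothesis that \<open>u\<close> solves the problem. Its completeness forces every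
  large root to occur in it. The squared error of a partial sum is monotone in the finite set of
  summed modes, so the sum may be taken in the order of the frequencies, with
  \<open>\<kappa>\<close> and \<open>- \<kappa>\<close> paired; for real data each pair gives a real
  part. Finitely many modes are left over, and they are continuous.

  The comparison must be summable in n. The time phase \<open>\<kappa> ^ 3 * t\<close> magnifies a
  frequency error by n^2, so the exponential accuracy of the roots matters. The squared norm of an
  eigenfunction is 1 only up to O(1/n), and the Fourier coefficients are only square summable; their
  product is summable by the arithmetic-geometric inequality. The bounds on the layers in x are not
  summable up to the end points, hence the restriction to the open interval.

  Since sums in L2 are determined up to null sets, the final identities come from identifying a
  limit in L2 with a pointwise one.\<close>

interpretation unit_lebesgue: finite_measure unit_lebesgue
  by (rule finite_measure_lebesgue_on) simp

lemma measure_unit_lebesgue [simp]: "measure unit_lebesgue {0<..<1} = 1"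
  by (simp add: measure_restrict_space)

lemma measurable_unit_lebesgue_continuous:
  "continuous_on {0..1} f \<Longrightarrow> f \<in> borel_measurable unit_lebesgue"
  by (rule continuous_imp_measurable_on_sets_lebesgue)
     (auto intro: continuous_on_subset)

text \<open>The squared norm. Leaving out the root keeps Bessel's identity additive and matches the
  convergence condition in \<open>L2_sums\<close>.\<close>

definition norm2 :: "(real \<Rightarrow> 'a::real_normed_vector) \<Rightarrow> real" where
  "norm2 f = (LINT x|unit_lebesgue. (norm (f x))\<^sup>2)"

lemma LIMSEQ_norm_le_0:
  fixes f :: "nat \<Rightarrow> 'a::real_normed_vector"
  assumes "\<And>n. norm (f n) \<le> g n" "g \<longlonglongrightarrow> 0"
  shows "f \<longlonglongrightarrow> 0"
  using assms by (intro Lim_null_comparison[of f g]) auto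

lemma norm2_nonneg [simp]: "0 \<le> norm2 f"
  by (simp add: norm2_def)

lemma L2_measurable: "L2 f \<Longrightarrow> f \<in> borel_measurable unit_lebesgue"
  and L2_integrable: "L2 f \<Longrightarrow> integrable unit_lebesgue (\<lambda>x. (norm (f x))\<^sup>2)"
  by (auto simp: L2_def)

lemma norm2_eq_0_AE:
  assumes "L2 f" "norm2 f = 0"
  shows "AE x in unit_lebesgue. f x = 0"
  using assms integral_nonneg_eq_0_iff_AE[OF L2_integrable[OF assms(1)]]
  by (auto simp: norm2_def)

lemma L2_bounded:
  fixes f :: "real \<Rightarrow> 'a::euclidean_space"
  assumes "f \<in> borel_measurable unit_lebesgue" "\<And>x. x \<in> {0<..<1} \<Longrightarrow> norm (f x) \<le> B"
  shows "L2 f"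
  unfolding L2_def
proof (intro conjI assms(1) unit_lebesgue.integrable_const_bound[where B = "B\<^sup>2"])
  show "AE x in unit_lebesgue. norm ((norm (f x))\<^sup>2) \<le> B\<^sup>2"
    using assms(2) by (intro AE_I2) (auto intro: power_mono)
qed (use assms(1) in measurable)

lemma L2_continuous:
  fixes f :: "real \<Rightarrow> 'a::euclidean_space"
  assumes "continuous_on {0..1} f"
  shows "L2 f"
proof -
  have "bounded (f ` {0..1})"
    using assms compact_continuous_image compact_imp_bounded by blast
  then obtain B where "\<And>x. x \<in> {0..1} \<Longrightarrow> norm (f x) \<le> B"
    unfolding bounded_iff by blast
  then show ?thesis
    by (intro L2_bounded[of _ B] measurable_unit_lebesgue_continuous assms) auto
qed

lemma L2_cong_AE:
  fixes f g :: "real \<Rightarrow> 'a::euclidean_space"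
  assumes "L2 f" "AE x in unit_lebesgue. f x = g x" "g \<in> borel_measurable unit_lebesgue"
  shows "L2 g"
  unfolding L2_def
proof (intro conjI assms(3))
  note [measurable] = L2_measurable[OF assms(1)] assms(3)
  show "integrable unit_lebesgue (\<lambda>x. (norm (g x))\<^sup>2)"
    by (rule iffD1[OF integrable_cong_AE L2_integrable[OF assms(1)]]) (use assms(2) in auto)
qed

lemma norm_add_square_le: "(norm (a + b))\<^sup>2 \<le> 2 * (norm a)\<^sup>2 + 2 * (norm (b::'a::real_normed_vector))\<^sup>2"
proof -
  have "(norm (a + b))\<^sup>2 \<le> (norm a + norm b)\<^sup>2"
    by (intro power_mono norm_triangle_ineq) auto
  also have "\<dots> \<le> 2 * (norm a)\<^sup>2 + 2 * (norm b)\<^sup>2"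
    using sum_squares_bound[of "norm a" "norm b"] by (simp add: power2_sum)
  finally show ?thesis .
qed

lemma L2_scale:
  fixes f :: "real \<Rightarrow> complex"
  shows "L2 f \<Longrightarrow> L2 (\<lambda>x. c * f x)"
  unfolding L2_def by (auto simp: norm_mult power_mult_distrib)

lemma norm2_scale: "norm2 (\<lambda>x. c * f x) = (norm (c::complex))\<^sup>2 * norm2 f"
  unfolding norm2_def by (simp add: norm_mult power_mult_distrib)

context
  fixes f g :: "real \<Rightarrow> 'a::euclidean_space"
  assumes f: "L2 f" and g: "L2 g"
begin

private lemma meas [measurable]:
  "f \<in> borel_measurable unit_lebesgue" "g \<in> borel_measurable unit_lebesgue"
  using f g by (auto simp: L2_def)

lemma L2_add: "L2 (\<lambda>x. f x + g x)"
  unfolding L2_def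
proof
  show "integrable unit_lebesgue (\<lambda>x. (norm (f x + g x))\<^sup>2)"
    by (rule Bochner_Integration.integrable_bound
          [where f = "\<lambda>x. 2 * (norm (f x))\<^sup>2 + 2 * (norm (g x))\<^sup>2"])
       (auto simp: L2_integrable f g norm_add_square_le intro!: AE_I2)
qed measurable

lemma norm2_add_le: "norm2 (\<lambda>x. f x + g x) \<le> 2 * norm2 f + 2 * norm2 g"
proof -
  have "norm2 (\<lambda>x. f x + g x) \<le> (LINT x|unit_lebesgue. 2 * (norm (f x))\<^sup>2 + 2 * (norm (g x))\<^sup>2)"
    unfolding norm2_def
    by (intro integral_mono L2_integrable L2_add norm_add_square_le
          Bochner_Integration.integrable_add integrable_mult_right f g)
  also have "\<dots> = 2 * norm2 f + 2 * norm2 g"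
    unfolding norm2_def by (subst Bochner_Integration.integral_add) (auto simp: L2_integrable f g)
  finally show ?thesis .
qed

lemma L2_mult_norm_integrable: "integrable unit_lebesgue (\<lambda>x. norm (f x) * norm (g x))"
proof (rule Bochner_Integration.integrable_bound
    [where f = "\<lambda>x. (norm (f x))\<^sup>2 + (norm (g x))\<^sup>2"])
  have "norm (f x) * norm (g x) \<le> (norm (f x))\<^sup>2 + (norm (g x))\<^sup>2" for x
  proof -
    have "2 * (norm (f x) * norm (g x)) \<le> (norm (f x))\<^sup>2 + (norm (g x))\<^sup>2"
      using sum_squares_bound[of "norm (f x)" "norm (g x)"] by (simp add: mult.assoc)
    moreover have "0 \<le> norm (f x) * norm (g x)" by simp
    ultimately show ?thesis by linarith
  qed
  then show "AE x in unit_lebesgue. norm (norm (f x) * norm (g x))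
      \<le> norm ((norm (f x))\<^sup>2 + (norm (g x))\<^sup>2)"
    by (intro AE_I2) auto
qed (auto simp: L2_integrable f g)

text \<open>The weight \<open>r\<close> is free so that Cauchy-Schwarz can be obtained from the
  arithmetic-geometric inequality by optimizing over it.\<close>

lemma L2_mult_norm_le:
  assumes "0 < r"
  shows "2 * (LINT x|unit_lebesgue. norm (f x) * norm (g x)) \<le> r * norm2 f + norm2 g / r"
proof -
  have "2 * (norm (f x) * norm (g x)) \<le> r * (norm (f x))\<^sup>2 + (norm (g x))\<^sup>2 / r" for x
    using sum_squares_bound[of "sqrt r * norm (f x)" "norm (g x) / sqrt r"] assms
    by (auto simp: power_mult_distrib power_divide)
  then have "(LINT x|unit_lebesgue. 2 * (norm (f x) * norm (g x)))
      \<le> (LINT x|unit_lebesgue. r * (norm (f x))\<^sup>2 + (norm (g x))\<^sup>2 / r)"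
    by (intro integral_mono integrable_mult_right Bochner_Integration.integrable_add
          integrable_divide L2_mult_norm_integrable L2_integrable f g)
  also have "\<dots> = r * norm2 f + norm2 g / r"
    unfolding norm2_def by (subst Bochner_Integration.integral_add) (auto simp: L2_integrable f g)
  finally show ?thesis by simp
qed

lemma L2_mult_norm_le_sqrt:
  "(LINT x|unit_lebesgue. norm (f x) * norm (g x)) \<le> sqrt (norm2 f * norm2 g)"
proof (cases "norm2 f = 0 \<or> norm2 g = 0")
  case True
  then have "AE x in unit_lebesgue. norm (f x) * norm (g x) = 0"
  proof
    assume "norm2 f = 0"
    from norm2_eq_0_AE[OF f this] show ?thesis by auto
  next
    assume "norm2 g = 0"
    from norm2_eq_0_AE[OF g this] show ?thesis by auto
  qed
  then have "(LINT x|unit_lebesgue. norm (f x) * norm (g x)) = 0"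
    by (rule integral_eq_zero_AE)
  then show ?thesis by simp
next
  case False
  then have pos: "norm2 f > 0" "norm2 g > 0"
    using norm2_nonneg[of f] norm2_nonneg[of g] by linarith+
  define a b where "a = sqrt (norm2 f)" and "b = sqrt (norm2 g)"
  have ab: "a > 0" "b > 0" "norm2 f = a\<^sup>2" "norm2 g = b\<^sup>2"
    using pos by (auto simp: a_def b_def)
  \<comment> \<open>The weight \<open>b / a\<close> is the minimizer: it makes both summands on the
    right equal to \<open>a * b\<close>.\<close>
  have "2 * (LINT x|unit_lebesgue. norm (f x) * norm (g x)) \<le> b / a * a\<^sup>2 + b\<^sup>2 / (b / a)"
    using L2_mult_norm_le[of "b / a"] ab by simp
  also have "\<dots> = 2 * (a * b)"
    using ab by (simp add: power2_eq_square)
  also have "a * b = sqrt (norm2 f * norm2 g)"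
    by (simp add: a_def b_def real_sqrt_mult)
  finally show ?thesis by simp
qed

end

lemma L2_minus: "L2 f \<Longrightarrow> L2 (\<lambda>x. - f x)" for f :: "real \<Rightarrow> 'a::euclidean_space"
  unfolding L2_def norm_minus_cancel using borel_measurable_uminus by blast

lemma L2_diff: "L2 f \<Longrightarrow> L2 g \<Longrightarrow> L2 (\<lambda>x. f x - g x)" for f g :: "real \<Rightarrow> 'a::euclidean_space"
  using L2_add[of f "\<lambda>x. - g x"] L2_minus[of g] by simp

lemma L2_sum: "(\<And>i. i \<in> I \<Longrightarrow> L2 (f i)) \<Longrightarrow> L2 (\<lambda>x. \<Sum>i\<in>I. f i x)"
  for f :: "'i \<Rightarrow> real \<Rightarrow> 'a::euclidean_space"
proof (induction I rule: infinite_finite_induct)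
  case (insert i I)
  then show ?case using L2_add[of "f i" "\<lambda>x. \<Sum>i\<in>I. f i x"] by simp
qed (auto intro!: L2_continuous continuous_intros)

lemma norm2_minus [simp]: "norm2 (\<lambda>x. - f x) = norm2 f"
  by (simp add: norm2_def)

lemma norm2_diff_le: "L2 f \<Longrightarrow> L2 g \<Longrightarrow> norm2 (\<lambda>x. f x - g x) \<le> 2 * norm2 f + 2 * norm2 g"
  for f g :: "real \<Rightarrow> 'a::euclidean_space"
  using norm2_add_le[of f "\<lambda>x. - g x"] L2_minus[of g] by simp

lemma norm2_cong_AE:
  fixes f g :: "real \<Rightarrow> 'a::euclidean_space"
  assumes "f \<in> borel_measurable unit_lebesgue" "g \<in> borel_measurable unit_lebesgue"
    and "AE x in unit_lebesgue. f x = g x"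
  shows "norm2 f = norm2 g"
proof -
  note [measurable] = assms(1,2)
  show ?thesis
    unfolding norm2_def by (rule integral_cong_AE) (use assms(3) in auto)
qed

lemma norm2_mono_norm:
  fixes f :: "real \<Rightarrow> 'a::euclidean_space" and g :: "real \<Rightarrow> 'b::euclidean_space"
  assumes "L2 f" "L2 g" "\<And>x. norm (f x) \<le> norm (g x)"
  shows "norm2 f \<le> norm2 g"
  unfolding norm2_def by (intro integral_mono L2_integrable assms power_mono) auto

lemma L2_integrable_mult_cnj:
  assumes "L2 f" "L2 g"
  shows "integrable unit_lebesgue (\<lambda>x. f x * cnj (g x))"
proof (rule Bochner_Integration.integrable_bound[OF L2_mult_norm_integrable[OF assms]])
  note [measurable] = assms[THEN L2_measurable]
  have "cnj \<in> borel_measurable borel"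
    by (intro borel_measurable_continuous_onI continuous_intros)
  note [measurable] = this
  show "(\<lambda>x. f x * cnj (g x)) \<in> borel_measurable unit_lebesgue" by measurable
qed (auto simp: norm_mult)

lemma L2_imp_integrable:
  fixes f :: "real \<Rightarrow> complex"
  assumes "L2 f"
  shows "integrable unit_lebesgue f"
  using L2_integrable_mult_cnj[OF assms L2_continuous[of "\<lambda>_. 1"]] by simp

lemma integrable_unit_lebesgue_continuous:
  fixes f :: "real \<Rightarrow> 'a::euclidean_space"
  assumes "continuous_on {0..1} f"
  shows "integrable unit_lebesgue f"
proof -
  have "bounded (f ` {0..1})"
    using assms compact_continuous_image compact_imp_bounded by blast
  then obtain B where "\<And>x. x \<in> {0..1} \<Longrightarrow> norm (f x) \<le> B"
    unfolding bounded_iff by blast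
  then show ?thesis
    by (intro unit_lebesgue.integrable_const_bound[where B = B] AE_I2
        measurable_unit_lebesgue_continuous assms) auto
qed

section \<open>Inner products\<close>

lemma L2_inner_Cauchy_Schwarz:
  assumes "L2 f" "L2 g"
  shows "norm (L2_inner f g) \<le> sqrt (norm2 f * norm2 g)"
proof -
  have "norm (L2_inner f g) \<le> (LINT x|unit_lebesgue. norm (f x * cnj (g x)))"
    unfolding L2_inner_def by (rule integral_norm_bound)
  then show ?thesis
    using L2_mult_norm_le_sqrt[OF assms] by (simp add: norm_mult)
qed

lemma L2_inner_add_left:
  "L2 f \<Longrightarrow> L2 g \<Longrightarrow> L2 h \<Longrightarrow> L2_inner (\<lambda>x. f x + g x) h = L2_inner f h + L2_inner g h"
  unfolding L2_inner_def by (simp add: distrib_right L2_integrable_mult_cnj)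

lemma L2_inner_diff_left:
  "L2 f \<Longrightarrow> L2 g \<Longrightarrow> L2 h \<Longrightarrow> L2_inner (\<lambda>x. f x - g x) h = L2_inner f h - L2_inner g h"
  unfolding L2_inner_def by (simp add: left_diff_distrib L2_integrable_mult_cnj)

lemma L2_inner_scale_left: "L2_inner (\<lambda>x. c * f x) h = c * L2_inner f h"
  unfolding L2_inner_def by (simp add: mult.assoc)

lemma L2_inner_commute: "L2_inner g f = cnj (L2_inner f g)"
  unfolding L2_inner_def
  by (subst Bochner_Integration.integral_cnj[symmetric]) (simp add: mult.commute)

lemma L2_inner_scale_right: "L2_inner f (\<lambda>x. c * h x) = cnj c * L2_inner f h"
  using L2_inner_scale_left[of c h f] L2_inner_commute[of f] L2_inner_commute[of "\<lambda>x. c * h x" f]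
  by (metis complex_cnj_mult)

lemma L2_inner_zero_left [simp]: "L2_inner (\<lambda>x. 0) h = 0"
  by (simp add: L2_inner_def)

lemma L2_inner_sum_left:
  "(\<And>i. i \<in> I \<Longrightarrow> L2 (f i)) \<Longrightarrow> L2 h \<Longrightarrow>
   L2_inner (\<lambda>x. \<Sum>i\<in>I. f i x) h = (\<Sum>i\<in>I. L2_inner (f i) h)"
proof (induction I rule: infinite_finite_induct)
  case (insert i I)
  then show ?case
    using L2_inner_add_left[of "f i" "\<lambda>x. \<Sum>i\<in>I. f i x" h] by (auto intro: L2_sum)
qed auto

lemma L2_inner_self: "L2_inner f f = of_real (norm2 f)"
  unfolding L2_inner_def norm2_def
  by (subst integral_complex_of_real[symmetric]) (simp only: complex_norm_square)

lemma L2_inner_cong_AE: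
  assumes "L2 f" "L2 g" "f' \<in> borel_measurable unit_lebesgue" "g' \<in> borel_measurable unit_lebesgue"
    and "AE x in unit_lebesgue. f x = f' x" "AE x in unit_lebesgue. g x = g' x"
  shows "L2_inner f g = L2_inner f' g'"
proof -
  note [measurable] = assms(1,2)[THEN L2_measurable] assms(3,4)
  have "cnj \<in> borel_measurable borel"
    by (intro borel_measurable_continuous_onI continuous_intros)
  note [measurable] = this
  show ?thesis
    unfolding L2_inner_def by (rule integral_cong_AE) (use assms(5,6) in auto)
qed

lemma norm2_diff_expand:
  assumes "L2 f" "L2 g"
  shows "norm2 (\<lambda>x. f x - g x) = norm2 f + norm2 g - 2 * Re (L2_inner f g)"
proof -
  have "(norm (a - b))\<^sup>2 = (norm a)\<^sup>2 + (norm b)\<^sup>2 - 2 * Re (a * cnj b)" for a b :: complex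
    unfolding cmod_power2 by (simp add: power2_eq_square algebra_simps)
  moreover define h where "h = (\<lambda>x. Re (f x * cnj (g x)))"
  ultimately have "(norm (f x - g x))\<^sup>2 = (norm (f x))\<^sup>2 + (norm (g x))\<^sup>2 - 2 * h x" for x
    by simp
  moreover have "integrable unit_lebesgue h"
    unfolding h_def by (intro integrable_Re L2_integrable_mult_cnj assms)
  moreover have "Re (L2_inner f g) = (LINT x|unit_lebesgue. h x)"
    unfolding L2_inner_def h_def
    by (rule integral_Re[symmetric]) (intro L2_integrable_mult_cnj assms)
  ultimately show ?thesis
    unfolding norm2_def using assms[THEN L2_integrable]
    by simp
qed

section \<open>Convergence in L2, pointwise limits and completeness\<close>

lemma L2_sums_iff:
  "L2_sums F s \<longleftrightarrow> (\<forall>n. L2 (F n)) \<and> L2 s \<and> (\<lambda>N. norm2 (\<lambda>x. (\<Sum>n<N. F n x) - s x)) \<longlonglongrightarrow> 0"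
  unfolding L2_sums_def norm2_def ..

lemma L2_norm: "L2 f \<Longrightarrow> L2 (\<lambda>x. norm (f x))"
  unfolding L2_def by (auto intro: borel_measurable_norm)

lemma L2_imp_integrable_norm:
  fixes f :: "real \<Rightarrow> 'a::euclidean_space"
  assumes "L2 f"
  shows "integrable unit_lebesgue (\<lambda>x. norm (f x))"
    and "(LINT x|unit_lebesgue. norm (f x)) \<le> sqrt (norm2 f)"
  using L2_mult_norm_integrable[OF L2_norm[OF assms] L2_continuous[of "\<lambda>_. 1::real"]]
    L2_mult_norm_le_sqrt[OF L2_norm[OF assms] L2_continuous[of "\<lambda>_. 1::real"]]
  by (simp_all add: norm2_def)

text \<open>Fatou's lemma for the squared distances: the lower limit of their integrals is 0, so
  their pointwise limit, the squared distance of \<open>c x\<close> and \<open>s x\<close>, vanishes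
  almost everywhere. This is the bridge from mean-square limits to pointwise ones.\<close>

lemma L2_limit_AE_eq:
  fixes S :: "nat \<Rightarrow> real \<Rightarrow> 'a::euclidean_space"
  assumes S: "\<And>N. L2 (S N)" and s: "L2 s" and lim: "(\<lambda>N. norm2 (\<lambda>x. S N x - s x)) \<longlonglongrightarrow> 0"
    and c: "AE x in unit_lebesgue. (\<lambda>N. S N x) \<longlonglongrightarrow> c x"
  shows "AE x in unit_lebesgue. s x = c x"
proof -
  note [measurable] = S[THEN L2_measurable] s[THEN L2_measurable]
  define u where "u N x = ennreal ((norm (S N x - s x))\<^sup>2)" for N x
  have [measurable]: "u N \<in> borel_measurable unit_lebesgue" for N
    unfolding u_def by measurable
  have "(\<integral>\<^sup>+x. u N x \<partial>unit_lebesgue) = ennreal (norm2 (\<lambda>x. S N x - s x))" for N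
    unfolding u_def norm2_def
    by (intro nn_integral_eq_integral L2_integrable L2_diff S s) auto
  moreover have "(\<lambda>N. ennreal (norm2 (\<lambda>x. S N x - s x))) \<longlonglongrightarrow> 0"
    using tendsto_ennrealI[OF lim] by simp
  ultimately have "liminf (\<lambda>N. \<integral>\<^sup>+x. u N x \<partial>unit_lebesgue) = 0"
    by (simp add: lim_imp_Liminf)
  then have "(\<integral>\<^sup>+x. liminf (\<lambda>N. u N x) \<partial>unit_lebesgue) = 0"
    using nn_integral_liminf[of u unit_lebesgue] by (metis \<open>\<And>N. u N \<in> _\<close> le_zero_eq)
  then have "AE x in unit_lebesgue. liminf (\<lambda>N. u N x) = 0"
    by (subst (asm) nn_integral_0_iff_AE) auto
  with c show ?thesis
  proof eventually_elim
    case (elim x)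
    have "(\<lambda>N. u N x) \<longlonglongrightarrow> ennreal ((norm (c x - s x))\<^sup>2)"
      unfolding u_def by (intro tendsto_ennrealI tendsto_intros elim)
    then have "liminf (\<lambda>N. u N x) = ennreal ((norm (c x - s x))\<^sup>2)"
      by (simp add: lim_imp_Liminf)
    with elim have "(norm (c x - s x))\<^sup>2 = 0"
      by (metis ennreal_eq_0_iff zero_le_power2 order_antisym)
    then show ?case by simp
  qed
qed

lemma L2_limit_unique:
  fixes S :: "nat \<Rightarrow> real \<Rightarrow> 'a::euclidean_space"
  assumes S: "\<And>N. L2 (S N)" and "L2 s" "L2 t"
    and "(\<lambda>N. norm2 (\<lambda>x. S N x - s x)) \<longlonglongrightarrow> 0" "(\<lambda>N. norm2 (\<lambda>x. S N x - t x)) \<longlonglongrightarrow> 0"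
  shows "AE x in unit_lebesgue. s x = t x"
proof -
  have "norm2 (\<lambda>x. s x - t x) \<le> 2 * norm2 (\<lambda>x. S N x - t x) + 2 * norm2 (\<lambda>x. S N x - s x)" for N
    using norm2_diff_le[OF L2_diff[OF S[of N] \<open>L2 t\<close>] L2_diff[OF S[of N] \<open>L2 s\<close>]] by simp
  moreover have "(\<lambda>N. 2 * norm2 (\<lambda>x. S N x - t x) + 2 * norm2 (\<lambda>x. S N x - s x)) \<longlonglongrightarrow> 2 * 0 + 2 * 0"
    by (intro tendsto_intros assms)
  then have "(\<lambda>N. 2 * norm2 (\<lambda>x. S N x - t x) + 2 * norm2 (\<lambda>x. S N x - s x)) \<longlonglongrightarrow> 0"
    by simp
  ultimately have "norm2 (\<lambda>x. s x - t x) \<le> 0"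
    by (intro LIMSEQ_le_const[of _ 0]) auto
  then have "norm2 (\<lambda>x. s x - t x) = 0"
    using norm2_nonneg order_antisym by blast
  from norm2_eq_0_AE[OF L2_diff[OF \<open>L2 s\<close> \<open>L2 t\<close>] this] show ?thesis by simp
qed

text \<open>A subsequence with squared gaps below 4^(-k) has gaps of L1 norm at most 2^(-k), so its
  telescoping series converges absolutely almost everywhere. By Fatou's lemma the pointwise limit is
  the mean-square limit of the whole sequence.\<close>

lemma L2_complete:
  fixes S :: "nat \<Rightarrow> real \<Rightarrow> 'a::euclidean_space"
  assumes S: "\<And>N. L2 (S N)"
    and Cauchy: "\<And>e. e > 0 \<Longrightarrow> \<exists>N. \<forall>m\<ge>N. \<forall>n\<ge>N. norm2 (\<lambda>x. S m x - S n x) < e"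
  shows "\<exists>s. L2 s \<and> (\<lambda>N. norm2 (\<lambda>x. S N x - s x)) \<longlonglongrightarrow> 0"
proof -
  note [measurable] = S[THEN L2_measurable]
  have "\<exists>N. \<forall>m\<ge>N. \<forall>n\<ge>N. norm2 (\<lambda>x. S m x - S n x) < (1/4) ^ k" for k :: nat
    by (intro Cauchy) auto
  then obtain r0 where r0: "\<And>k m n. m \<ge> r0 k \<Longrightarrow> n \<ge> r0 k \<Longrightarrow> norm2 (\<lambda>x. S m x - S n x) < (1/4) ^ k"
    by metis
  \<comment> \<open>The maximum gives \<open>r (Suc k) \<ge> r0 k\<close>, since the gap estimate
    needs both indices beyond \<open>r0 k\<close>; the summand \<open>k\<close> carries the indices
    past any given bound.\<close>
  define r where "r k = Max (r0 ` {..k}) + k" for k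
  have r_ge: "r k \<ge> r0 k" "r (Suc k) \<ge> r0 k" "r k \<ge> k" for k
    unfolding r_def by (auto intro!: Max_ge trans_le_add1 le_SucI)
  define D where "D k x = S (r (Suc k)) x - S (r k) x" for k x
  have D: "L2 (D k)" for k
    unfolding D_def by (intro L2_diff S)
  note [measurable] = D[THEN L2_measurable]
  have D_le: "(\<integral>\<^sup>+x. ennreal (norm (D k x)) \<partial>unit_lebesgue) \<le> ennreal ((1/2) ^ k)" for k
  proof -
    have "norm2 (D k) < (1/4) ^ k"
      unfolding D_def by (intro r0 r_ge)
    then have "sqrt (norm2 (D k)) \<le> sqrt (((1/2) ^ k)\<^sup>2)"
      by (intro real_sqrt_le_mono) (simp add: power_even_eq[symmetric] power_mult[symmetric] power2_eq_square power_mult_distrib[symmetric])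
    then have "(LINT x|unit_lebesgue. norm (D k x)) \<le> (1/2) ^ k"
      using L2_imp_integrable_norm(2)[OF D[of k]] by simp
    moreover have "(\<integral>\<^sup>+x. ennreal (norm (D k x)) \<partial>unit_lebesgue) = ennreal (LINT x|unit_lebesgue. norm (D k x))"
      by (intro nn_integral_eq_integral L2_imp_integrable_norm D) auto
    ultimately show ?thesis by (simp add: ennreal_leI)
  qed
  have "(\<integral>\<^sup>+x. (\<Sum>k. ennreal (norm (D k x))) \<partial>unit_lebesgue)
      = (\<Sum>k. \<integral>\<^sup>+x. ennreal (norm (D k x)) \<partial>unit_lebesgue)"
    by (intro nn_integral_suminf) auto
  also have "\<dots> \<le> (\<Sum>k. ennreal ((1/2) ^ k))"
    by (intro suminf_le D_le) auto
  also have "\<dots> = ennreal (\<Sum>k. (1/2) ^ k)"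
    by (intro suminf_ennreal2) auto
  finally have "(\<integral>\<^sup>+x. (\<Sum>k. ennreal (norm (D k x))) \<partial>unit_lebesgue) \<noteq> \<infinity>"
    by (auto simp: top_unique)
  then have "AE x in unit_lebesgue. (\<Sum>k. ennreal (norm (D k x))) \<noteq> \<infinity>"
    by (intro nn_integral_noteq_infinite) auto
  then have conv: "AE x in unit_lebesgue. convergent (\<lambda>k. S (r k) x)"
  proof eventually_elim
    case (elim x)
    then have "summable (\<lambda>k. norm (D k x))"
      by (intro summable_suminf_not_top) auto
    then have "summable (\<lambda>k. D k x)"
      by (rule summable_norm_cancel)
    then have "convergent (\<lambda>n. \<Sum>k<n. D k x)"
      by (simp add: summable_iff_convergent)
    moreover have "(\<Sum>k<n. D k x) = S (r n) x - S (r 0) x" for n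
      unfolding D_def by (rule sum_lessThan_telescope)
    ultimately have "convergent (\<lambda>n. (S (r n) x - S (r 0) x) + S (r 0) x)"
      by (intro convergent_add convergent_const) simp
    then show ?case by simp
  qed
  define s where "s x = lim (\<lambda>k. S (r k) x)" for x
  have s_meas [measurable]: "s \<in> borel_measurable unit_lebesgue"
    unfolding s_def by measurable
  have tail: "L2 (\<lambda>x. S N x - s x) \<and> norm2 (\<lambda>x. S N x - s x) \<le> e"
    if e: "e > 0" and N: "\<And>m n. m \<ge> N \<Longrightarrow> n \<ge> N \<Longrightarrow> norm2 (\<lambda>x. S m x - S n x) < e" for N e
  proof -
    define u where "u k x = ennreal ((norm (S N x - S (r k) x))\<^sup>2)" for k x
    have [measurable]: "u k \<in> borel_measurable unit_lebesgue" for k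
      unfolding u_def by measurable
    have "AE x in unit_lebesgue. ennreal ((norm (S N x - s x))\<^sup>2) = liminf (\<lambda>k. u k x)"
      using conv
    proof eventually_elim
      case (elim x)
      then have "(\<lambda>k. S (r k) x) \<longlonglongrightarrow> s x"
        unfolding s_def by (simp add: convergent_LIMSEQ_iff)
      then have "(\<lambda>k. u k x) \<longlonglongrightarrow> ennreal ((norm (S N x - s x))\<^sup>2)"
        unfolding u_def by (intro tendsto_ennrealI tendsto_intros)
      then show ?case by (simp add: lim_imp_Liminf)
    qed
    then have "(\<integral>\<^sup>+x. ennreal ((norm (S N x - s x))\<^sup>2) \<partial>unit_lebesgue)
        = (\<integral>\<^sup>+x. liminf (\<lambda>k. u k x) \<partial>unit_lebesgue)"
      by (rule nn_integral_cong_AE)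
    also have "\<dots> \<le> liminf (\<lambda>k. \<integral>\<^sup>+x. u k x \<partial>unit_lebesgue)"
      by (rule nn_integral_liminf) simp
    also have "\<dots> \<le> liminf (\<lambda>k. ennreal e)"
    proof (intro Liminf_mono eventually_sequentiallyI[of N])
      fix k assume "N \<le> k"
      then have "norm2 (\<lambda>x. S N x - S (r k) x) \<le> e"
        using N[of N "r k"] r_ge(3)[of k] by linarith
      moreover have "(\<integral>\<^sup>+x. u k x \<partial>unit_lebesgue) = ennreal (norm2 (\<lambda>x. S N x - S (r k) x))"
        unfolding u_def norm2_def
        by (intro nn_integral_eq_integral L2_integrable L2_diff S) auto
      ultimately show "(\<integral>\<^sup>+x. u k x \<partial>unit_lebesgue) \<le> ennreal e"
        by (simp add: ennreal_leI)
    qed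
    also have "\<dots> = ennreal e"
      by (simp add: Liminf_const)
    finally have le: "(\<integral>\<^sup>+x. ennreal ((norm (S N x - s x))\<^sup>2) \<partial>unit_lebesgue) \<le> ennreal e" .
    then have int: "integrable unit_lebesgue (\<lambda>x. (norm (S N x - s x))\<^sup>2)"
      by (intro integrableI_bounded) (auto intro: le_less_trans)
    then have "(\<integral>\<^sup>+x. ennreal ((norm (S N x - s x))\<^sup>2) \<partial>unit_lebesgue) = ennreal (norm2 (\<lambda>x. S N x - s x))"
      unfolding norm2_def by (intro nn_integral_eq_integral) auto
    with le e int show ?thesis
      unfolding L2_def by (auto simp: ennreal_le_iff)
  qed
  have "L2 s"
  proof -
    obtain N where "\<And>m n. m \<ge> N \<Longrightarrow> n \<ge> N \<Longrightarrow> norm2 (\<lambda>x. S m x - S n x) < 1"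
      using Cauchy[of 1] by auto
    then have "L2 (\<lambda>x. S N x - s x)"
      using tail[of 1 N] by simp
    from L2_diff[OF S[of N] this] show ?thesis by simp
  qed
  moreover have "(\<lambda>N. norm2 (\<lambda>x. S N x - s x)) \<longlonglongrightarrow> 0"
  proof (rule LIMSEQ_I)
    fix e :: real assume e: "0 < e"
    obtain N where N: "\<And>m n. m \<ge> N \<Longrightarrow> n \<ge> N \<Longrightarrow> norm2 (\<lambda>x. S m x - S n x) < e / 2"
      using Cauchy[of "e / 2"] e by auto
    have "norm2 (\<lambda>x. S n x - s x) < e" if "n \<ge> N" for n
      using tail[of "e / 2" n] N that e by fastforce
    then show "\<exists>N. \<forall>n\<ge>N. norm (norm2 (\<lambda>x. S n x - s x) - 0) < e"
      by auto
  qed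
  ultimately show ?thesis by blast
qed

section \<open>Orthonormal systems\<close>

definition orthonormal_L2 :: "('i \<Rightarrow> real \<Rightarrow> complex) \<Rightarrow> bool" where
  "orthonormal_L2 e \<longleftrightarrow> (\<forall>i. L2 (e i)) \<and> (\<forall>i j. L2_inner (e i) (e j) = (if i = j then 1 else 0))"

context
  fixes e :: "'i \<Rightarrow> real \<Rightarrow> complex"
  assumes e: "orthonormal_L2 e"
begin

lemma orthonormal_L2_L2: "L2 (e i)"
  using e by (simp add: orthonormal_L2_def)

lemma L2_orthonormal_sum: "L2 (\<lambda>x. \<Sum>i\<in>I. c i * e i x)"
  by (intro L2_sum L2_scale orthonormal_L2_L2)

lemma L2_inner_orthonormal_sum:
  "finite I \<Longrightarrow> L2_inner (\<lambda>x. \<Sum>i\<in>I. c i * e i x) (e j) = (if j \<in> I then c j else 0)"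
  using e by (subst L2_inner_sum_left)
    (auto simp: L2_scale orthonormal_L2_def L2_inner_scale_left if_distrib[of "\<lambda>x. _ * x"] sum.If_cases cong: if_cong)

lemma L2_inner_orthonormal_sum_right:
  assumes "finite I" "L2 f"
  shows "L2_inner f (\<lambda>x. \<Sum>i\<in>I. c i * e i x) = (\<Sum>i\<in>I. cnj (c i) * L2_inner f (e i))"
proof -
  have "L2_inner (\<lambda>x. \<Sum>i\<in>I. c i * e i x) f = (\<Sum>i\<in>I. c i * L2_inner (e i) f)"
    using assms(2) by (subst L2_inner_sum_left) (auto simp: L2_scale orthonormal_L2_L2 L2_inner_scale_left)
  then show ?thesis
    by (subst L2_inner_commute) (simp add: cnj_sum L2_inner_commute[of f])
qed

lemma norm2_orthonormal_sum:
  assumes "finite I"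
  shows "norm2 (\<lambda>x. \<Sum>i\<in>I. c i * e i x) = (\<Sum>i\<in>I. (norm (c i))\<^sup>2)"
proof -
  have "complex_of_real (norm2 (\<lambda>x. \<Sum>i\<in>I. c i * e i x)) = of_real (\<Sum>i\<in>I. (norm (c i))\<^sup>2)"
    unfolding L2_inner_self[symmetric] L2_inner_orthonormal_sum_right[OF assms L2_orthonormal_sum]
    using assms by (simp add: L2_inner_orthonormal_sum complex_norm_square[symmetric] mult.commute)
  then show ?thesis by (simp only: of_real_eq_iff)
qed

text \<open>For any finite index set, in no particular order: the squared error is lowered by
  exactly the squares of the coefficients. The rearrangement of the eigenfunction expansion rests on
  this.\<close>

lemma Bessel_identity:
  assumes "finite I" "L2 f"
  shows "norm2 (\<lambda>x. f x - (\<Sum>i\<in>I. L2_inner f (e i) * e i x))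
    = norm2 f - (\<Sum>i\<in>I. (norm (L2_inner f (e i)))\<^sup>2)"
proof -
  have "L2_inner f (\<lambda>x. \<Sum>i\<in>I. L2_inner f (e i) * e i x) = of_real (\<Sum>i\<in>I. (norm (L2_inner f (e i)))\<^sup>2)"
    using assms by (simp add: L2_inner_orthonormal_sum_right[OF assms]
        complex_norm_square[symmetric] mult.commute[of "cnj _"])
  then show ?thesis
    using assms by (simp add: norm2_diff_expand L2_orthonormal_sum norm2_orthonormal_sum)
qed

lemma Bessel_inequality:
  assumes "finite I" "L2 f"
  shows "(\<Sum>i\<in>I. (norm (L2_inner f (e i)))\<^sup>2) \<le> norm2 f"
  using Bessel_identity[OF assms] norm2_nonneg[of "\<lambda>x. f x - (\<Sum>i\<in>I. L2_inner f (e i) * e i x)"]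
  by simp

end

text \<open>The injection \<open>h\<close> picks a sequence out of a system with another index type,
  such as the positive or the negative frequencies of \<open>trig\<close>.\<close>

lemma Bessel_summable:
  assumes "orthonormal_L2 e" "inj h" "L2 f"
  shows "summable (\<lambda>n. (norm (L2_inner f (e (h n))))\<^sup>2)"
proof (rule bounded_imp_summable)
  fix n :: nat
  have "(\<Sum>i\<in>h ` {..n}. (norm (L2_inner f (e i)))\<^sup>2) \<le> norm2 f"
    by (intro Bessel_inequality assms) auto
  then show "(\<Sum>k\<le>n. (norm (L2_inner f (e (h k))))\<^sup>2) \<le> norm2 f"
    using assms(2) by (subst (asm) sum.reindex) (auto intro: inj_on_subset)
qed auto

lemma Riesz_Fischer:
  fixes e :: "nat \<Rightarrow> real \<Rightarrow> complex"
  assumes e: "orthonormal_L2 e" and a: "summable (\<lambda>n. (norm (a n))\<^sup>2)"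
  shows "\<exists>s. L2_sums (\<lambda>n x. a n * e n x) s"
proof -
  define S where "S N x = (\<Sum>n<N. a n * e n x)" for N x
  have "\<exists>s. L2 s \<and> (\<lambda>N. norm2 (\<lambda>x. S N x - s x)) \<longlonglongrightarrow> 0"
  proof (rule L2_complete)
    show "L2 (S N)" for N
      unfolding S_def by (intro L2_orthonormal_sum e)
    fix r :: real assume "r > 0"
    then obtain N where N: "\<And>m n. m \<ge> N \<Longrightarrow> norm (\<Sum>k\<in>{m..<n}. (norm (a k))\<^sup>2) < r"
      using a unfolding summable_Cauchy by blast
    have le: "norm2 (\<lambda>x. S m x - S n x) < r" if "n \<ge> N" "m \<ge> n" for m n
    proof -
      have "(\<lambda>x. S m x - S n x) = (\<lambda>x. \<Sum>k\<in>{n..<m}. a k * e k x)"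
        unfolding S_def using that by (simp add: sum_diff_nat_ivl lessThan_atLeast0)
      then have "norm2 (\<lambda>x. S m x - S n x) = (\<Sum>k\<in>{n..<m}. (norm (a k))\<^sup>2)"
        using norm2_orthonormal_sum[OF e] by simp
      then show ?thesis using N[of n m] that by simp
    qed
    have "norm2 (\<lambda>x. S m x - S n x) < r" if "n \<ge> N" "m \<ge> N" for m n
    proof (cases "m \<ge> n")
      case False
      then show ?thesis
        using le[of m n] that norm2_minus[of "\<lambda>x. S n x - S m x"] by simp
    qed (use le that in auto)
    then show "\<exists>N. \<forall>m\<ge>N. \<forall>n\<ge>N. norm2 (\<lambda>x. S m x - S n x) < r" by blast
  qed
  then show ?thesis
    unfolding L2_sums_iff S_def using e L2_scale[of "e _"] unfolding orthonormal_L2_def by blast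
qed

lemma L2_inner_tendsto:
  assumes "\<And>N. L2 (S N)" "L2 s" "L2 g" "(\<lambda>N. norm2 (\<lambda>x. S N x - s x)) \<longlonglongrightarrow> 0"
  shows "(\<lambda>N. L2_inner (S N) g) \<longlonglongrightarrow> L2_inner s g"
proof -
  have lim: "(\<lambda>N. sqrt (norm2 (\<lambda>x. S N x - s x) * norm2 g)) \<longlonglongrightarrow> sqrt (0 * norm2 g)"
    by (intro tendsto_intros assms)
  have "norm (L2_inner (S N) g - L2_inner s g) \<le> sqrt (norm2 (\<lambda>x. S N x - s x) * norm2 g)" for N
    using L2_inner_Cauchy_Schwarz[OF L2_diff[OF assms(1)[of N] assms(2)] assms(3)]
    by (simp add: L2_inner_diff_left assms)
  from LIMSEQ_norm_le_0[OF this] lim have "(\<lambda>N. L2_inner (S N) g - L2_inner s g) \<longlonglongrightarrow> 0"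
    by simp
  then show ?thesis
    by (simp add: LIM_zero_iff)
qed

lemma L2_sums_orthonormal_inner:
  fixes e :: "nat \<Rightarrow> real \<Rightarrow> complex"
  assumes e: "orthonormal_L2 e" and s: "L2_sums (\<lambda>n x. a n * e n x) s"
  shows "L2_inner s (e m) = a m"
proof (rule LIMSEQ_unique)
  show "(\<lambda>N. L2_inner (\<lambda>x. \<Sum>n<N. a n * e n x) (e m)) \<longlonglongrightarrow> L2_inner s (e m)"
    using s unfolding L2_sums_iff
    by (intro L2_inner_tendsto) (auto intro!: L2_orthonormal_sum[OF e] orthonormal_L2_L2[OF e])
  show "(\<lambda>N. L2_inner (\<lambda>x. \<Sum>n<N. a n * e n x) (e m)) \<longlonglongrightarrow> a m"
    by (rule tendsto_eventually, rule eventually_sequentiallyI[of "Suc m"])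
       (simp add: L2_inner_orthonormal_sum[OF e])
qed

lemma L2_sums_add:
  fixes F G :: "nat \<Rightarrow> real \<Rightarrow> 'a::euclidean_space"
  assumes "L2_sums F s" "L2_sums G t"
  shows "L2_sums (\<lambda>n x. F n x + G n x) (\<lambda>x. s x + t x)"
proof -
  have L: "L2 (\<lambda>x. (\<Sum>n<N. F n x) - s x)" "L2 (\<lambda>x. (\<Sum>n<N. G n x) - t x)" for N
    using assms by (auto simp: L2_sums_iff intro!: L2_sum L2_diff)
  have "norm (norm2 (\<lambda>x. (\<Sum>n<N. F n x + G n x) - (s x + t x)))
      \<le> 2 * norm2 (\<lambda>x. (\<Sum>n<N. F n x) - s x) + 2 * norm2 (\<lambda>x. (\<Sum>n<N. G n x) - t x)" for N
    using norm2_add_le[OF L[of N]] by (simp add: sum.distrib algebra_simps)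
  note le = LIMSEQ_norm_le_0[OF this]
  have "(\<lambda>N. 2 * norm2 (\<lambda>x. (\<Sum>n<N. F n x) - s x) + 2 * norm2 (\<lambda>x. (\<Sum>n<N. G n x) - t x)) \<longlonglongrightarrow> 2 * 0 + 2 * 0"
    using assms by (intro tendsto_intros) (auto simp: L2_sums_iff)
  then have "(\<lambda>N. norm2 (\<lambda>x. (\<Sum>n<N. F n x + G n x) - (s x + t x))) \<longlonglongrightarrow> 0"
    by (intro le) simp
  then show ?thesis
    using assms by (auto simp: L2_sums_iff intro: L2_add)
qed

lemma L2_sums_scale:
  assumes "L2_sums F s"
  shows "L2_sums (\<lambda>n x. c * F n x) (\<lambda>x. c * s x :: complex)"
proof -
  have "norm2 (\<lambda>x. (\<Sum>n<N. c * F n x) - c * s x) = (norm c)\<^sup>2 * norm2 (\<lambda>x. (\<Sum>n<N. F n x) - s x)" for N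
    by (subst norm2_scale[symmetric]) (simp add: sum_distrib_left right_diff_distrib)
  moreover have "(\<lambda>N. (norm c)\<^sup>2 * norm2 (\<lambda>x. (\<Sum>n<N. F n x) - s x)) \<longlonglongrightarrow> (norm c)\<^sup>2 * 0"
    using assms by (intro tendsto_intros) (auto simp: L2_sums_iff)
  ultimately show ?thesis
    using assms L2_scale[of "F _" c] L2_scale[of s c] unfolding L2_sums_iff by simp
qed

text \<open>The choice in \<open>L2_suminf\<close> becomes meaningful as soon as one sum has been
  exhibited.\<close>

lemma L2_sums_L2_suminf: "L2_sums F s \<Longrightarrow> L2_sums F (L2_suminf F)"
  unfolding L2_suminf_def by (rule someI[of "L2_sums F"])

lemma L2_suminf_AE_eq:
  fixes F :: "nat \<Rightarrow> real \<Rightarrow> 'a::euclidean_space"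
  assumes "L2_sums F s"
  shows "AE x in unit_lebesgue. L2_suminf F x = s x"
  using L2_sums_L2_suminf[OF assms] assms unfolding L2_sums_iff
  by (intro L2_limit_unique[of "\<lambda>N x. \<Sum>n<N. F n x"]) (auto intro: L2_sum)

lemma integral_unit_lebesgue_FTC:
  fixes F :: "real \<Rightarrow> 'a::euclidean_space"
  assumes F: "\<And>x. x \<in> {0..1} \<Longrightarrow> (F has_vector_derivative f x) (at x within {0..1})"
    and f: "continuous_on {0..1} f"
  shows "(LINT x|unit_lebesgue. f x) = F 1 - F 0"
proof -
  have "(LINT x|unit_lebesgue. f x) = integral {0<..<1} f"
    by (intro lebesgue_integral_eq_integral integrable_unit_lebesgue_continuous f) simp
  also have "\<dots> = integral {0..1} f"
    by (simp add: integral_open_interval_real)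
  also have "\<dots> = F 1 - F 0"
    by (intro integral_unique fundamental_theorem_of_calculus F) auto
  finally show ?thesis .
qed

section \<open>The trigonometric system\<close>

definition trig :: "int \<Rightarrow> real \<Rightarrow> complex" where
  "trig n x = exp (2 * pi * \<i> * of_int n * of_real x)"

lemma trig_0 [simp]: "trig 0 x = 1"
  by (simp add: trig_def)

lemma trig_add: "trig (m + n) x = trig m x * trig n x"
  by (simp add: trig_def exp_add[symmetric] algebra_simps)

lemma trig_add_right: "trig n (x + y) = trig n x * trig n y"
  by (simp add: trig_def exp_add[symmetric] algebra_simps)

lemma cnj_trig: "cnj (trig n x) = trig (- n) x"
  by (simp add: trig_def exp_cnj)

lemma norm_trig [simp]: "norm (trig n x) = 1"
  by (simp add: trig_def)

lemma trig_diff_right: "trig n (x - y) = trig n x * cnj (trig n y)"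
  by (simp add: trig_def exp_cnj exp_diff exp_minus divide_inverse algebra_simps)

lemma trig_of_int [simp]: "trig n (of_int m) = 1"
proof -
  have "trig n (of_int m) = exp (2 * of_int (n * m) * pi * \<i>)"
    by (simp add: trig_def algebra_simps)
  then show ?thesis by (simp only: exp_integer_2pi Ints_of_int)
qed

lemma continuous_on_trig [continuous_intros]: "continuous_on A (trig n)"
  unfolding trig_def by (intro continuous_intros)

lemma has_vector_derivative_trig:
  "(trig n has_vector_derivative 2 * pi * \<i> * of_int n * trig n x) (at x within A)"
  unfolding trig_def by (auto intro!: derivative_eq_intros has_vector_derivative_real_field)

lemma integral_trig: "(LINT x|unit_lebesgue. trig n x) = (if n = 0 then 1 else 0)"
proof (cases "n = 0")
  case False
  have "(LINT x|unit_lebesgue. trig n x) = trig n 1 / (2 * pi * \<i> * of_int n) - trig n 0 / (2 * pi * \<i> * of_int n)"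
    using False
    by (intro integral_unit_lebesgue_FTC continuous_intros)
       (auto intro!: derivative_eq_intros has_vector_derivative_trig)
  then show ?thesis
    using False trig_of_int[of n 1] trig_of_int[of n 0] by simp
qed simp

lemma L2_trig: "L2 (trig n)"
  by (intro L2_continuous continuous_intros)

lemma orthonormal_trig: "orthonormal_L2 trig"
  unfolding orthonormal_L2_def L2_inner_def
  by (auto simp: L2_trig cnj_trig trig_add[symmetric] integral_trig)

lemma fourier_coeff_eq_inner: "fourier_coeff v n = L2_inner v (trig n)"
  unfolding fourier_coeff_def L2_inner_def cnj_trig by (simp add: trig_def)

text \<open>Closed under sums by definition and under products by the addition law for frequencies,
  hence large enough to contain every polynomial in the real and imaginary parts of
  \<open>trig 1 x\<close>.\<close>

inductive trig_polynomial :: "(real \<Rightarrow> complex) \<Rightarrow> bool" where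
  monomial: "trig_polynomial (\<lambda>x. c * trig n x)"
| add: "trig_polynomial f \<Longrightarrow> trig_polynomial g \<Longrightarrow> trig_polynomial (\<lambda>x. f x + g x)"

lemma trig_polynomial_mult:
  assumes "trig_polynomial f" "trig_polynomial g"
  shows "trig_polynomial (\<lambda>x. f x * g x)"
  using assms(1)
proof induction
  case (monomial c n)
  from assms(2) show ?case
  proof induction
    case (monomial d m)
    have "trig_polynomial (\<lambda>x. (c * d) * trig (n + m) x)"
      by (rule trig_polynomial.monomial)
    then show ?case by (simp add: trig_add algebra_simps)
  next
    case (add f g)
    from trig_polynomial.add[OF add.IH] show ?case by (simp add: algebra_simps)
  qed
next
  case (add f1 f2)
  from trig_polynomial.add[OF add.IH] show ?case by (simp add: algebra_simps)
qed

text \<open>Makes Stone-Weierstrass on the plane available for trigonometric polynomials: on the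
  unit circle the conjugate of \<open>trig 1 x\<close> is \<open>trig (- 1) x\<close>, so a
  polynomial in the coordinates becomes a Laurent polynomial.\<close>

lemma trig_polynomial_real_polynomial_function:
  fixes p :: "complex \<Rightarrow> real"
  assumes "real_polynomial_function p"
  shows "trig_polynomial (\<lambda>x. of_real (p (trig 1 x)))"
  using assms
proof induction
  case (linear h)
  then interpret h: bounded_linear h .
  \<comment> \<open>A real-linear functional on the complex plane has the form
    \<open>a * z + b * cnj z\<close>; these are its Wirtinger coefficients.\<close>
  define a b where "a = Complex (h 1 / 2) (- h \<i> / 2)" and "b = Complex (h 1 / 2) (h \<i> / 2)"
  have h_eq: "h z = Re z * h 1 + Im z * h \<i>" for z
  proof -
    have "z = Re z *\<^sub>R 1 + Im z *\<^sub>R \<i>"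
      by (simp add: complex_eq_iff)
    from arg_cong[OF this, of h] show ?thesis
      by (simp only: h.add h.scaleR real_scaleR_def)
  qed
  have "of_real (h z) = a * z + b * cnj z" for z
    by (simp add: a_def b_def complex_eq_iff h_eq[of z])
  then have "of_real (h (trig 1 x)) = a * trig 1 x + b * trig (- 1) x" for x
    by (simp add: cnj_trig)
  then show ?case
    using trig_polynomial.add[OF trig_polynomial.monomial[of a 1] trig_polynomial.monomial[of b "-1"]]
    by simp
next
  case (const c)
  show ?case using trig_polynomial.monomial[of "of_real c" 0] by simp
next
  case (add f g)
  from trig_polynomial.add[OF add.IH] show ?case by simp
next
  case (mult f g)
  from trig_polynomial_mult[OF mult.IH] show ?case by simp
qed

section \<open>Completeness of the trigonometric system\<close>

context
  fixes f :: "real \<Rightarrow> complex"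
  assumes f: "L2 f" and ortho: "\<And>n. L2_inner f (trig n) = 0"
begin

private lemma f_meas [measurable]: "f \<in> borel_measurable unit_lebesgue"
  using f by (rule L2_measurable)

private lemma integral_trig_polynomial:
  assumes "trig_polynomial p"
  shows "continuous_on UNIV p \<and> (LINT x|unit_lebesgue. f x * p x) = 0"
  using assms
proof induction
  case (monomial c n)
  have "(LINT x|unit_lebesgue. f x * (c * trig n x)) = c * L2_inner f (trig (- n))"
    unfolding L2_inner_def by (simp add: cnj_trig mult.left_commute)
  then show ?case
    by (auto simp: ortho intro!: continuous_intros)
next
  case (add p q)
  have "integrable unit_lebesgue (\<lambda>x. f x * r x)" if "continuous_on UNIV r" for r
    using L2_integrable_mult_cnj[OF f, of "\<lambda>x. cnj (r x)"] that
    by (auto intro!: L2_continuous continuous_intros intro: continuous_on_subset)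
  with add show ?case
    by (auto simp: distrib_left intro!: continuous_intros)
qed

text \<open>On the circle the end points 0 and 1 are identified, so Stone-Weierstrass gives uniform
  approximation by trigonometric polynomials, against which \<open>f\<close> integrates to 0. The
  error is at most \<open>e\<close> times the L1 norm of \<open>f\<close>.\<close>

private lemma integral_circle:
  fixes H :: "complex \<Rightarrow> real"
  assumes H: "continuous_on (sphere 0 1) H"
  shows "(LINT x|unit_lebesgue. f x * of_real (H (trig 1 x))) = 0"
proof -
  let ?I = "LINT x|unit_lebesgue. norm (f x)"
  have le: "norm (LINT x|unit_lebesgue. f x * of_real (H (trig 1 x))) \<le> e * ?I" if e: "e > 0" for e
  proof -
    obtain p where p: "real_polynomial_function p"
      "\<And>z. z \<in> sphere 0 1 \<Longrightarrow> \<bar>H z - p z\<bar> < e"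
      using Stone_Weierstrass_real_polynomial_function[OF _ H e] compact_sphere by blast
    have cont: "continuous_on {0..1} (\<lambda>x. of_real (H (trig 1 x)) :: complex)"
      "continuous_on {0..1} (\<lambda>x. of_real (p (trig 1 x)) :: complex)"
      using integral_trig_polynomial[OF trig_polynomial_real_polynomial_function[OF p(1)]]
      by (auto intro!: continuous_intros continuous_on_compose2[OF H] intro: continuous_on_subset)
    have int: "integrable unit_lebesgue (\<lambda>x. f x * r x)" if "continuous_on {0..1} r" for r
      using L2_integrable_mult_cnj[OF f, of "\<lambda>x. cnj (r x)"] that
      by (auto intro!: L2_continuous continuous_intros)
    have "(LINT x|unit_lebesgue. f x * of_real (H (trig 1 x)))
        = (LINT x|unit_lebesgue. f x * of_real (H (trig 1 x))) - (LINT x|unit_lebesgue. f x * of_real (p (trig 1 x)))"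
      using integral_trig_polynomial[OF trig_polynomial_real_polynomial_function[OF p(1)]] by simp
    also have "\<dots> = (LINT x|unit_lebesgue. f x * (of_real (H (trig 1 x)) - of_real (p (trig 1 x))))"
      by (subst Bochner_Integration.integral_diff[symmetric]) (auto intro: int cont simp: right_diff_distrib)
    also have "norm \<dots> \<le> (LINT x|unit_lebesgue. e * norm (f x))"
    proof (rule Bochner_Integration.integral_norm_bound_integral)
      fix x
      have "norm (of_real (H (trig 1 x)) - of_real (p (trig 1 x)) :: complex) \<le> e"
        using p(2)[of "trig 1 x"] by (simp flip: of_real_diff)
      then show "norm (f x * (of_real (H (trig 1 x)) - of_real (p (trig 1 x)))) \<le> e * norm (f x)"
        by (simp add: norm_mult mult.commute[of e] mult_left_mono)
    qed (auto intro!: int continuous_intros cont L2_imp_integrable_norm f)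
    finally show ?thesis by simp
  qed
  have "0 \<le> ?I" by simp
  have "norm (LINT x|unit_lebesgue. f x * of_real (H (trig 1 x))) \<le> 0 + e" if "e > 0" for e
  proof -
    have "norm (LINT x|unit_lebesgue. f x * of_real (H (trig 1 x))) \<le> e / (?I + 1) * ?I"
      using that \<open>0 \<le> ?I\<close> by (intro le divide_pos_pos) linarith+
    also have "\<dots> \<le> e"
    proof -
      have "0 < ?I + 1" using \<open>0 \<le> ?I\<close> by linarith
      then show ?thesis using that by (simp add: field_simps)
    qed
    finally show ?thesis by simp
  qed
  then show ?thesis
    using field_le_epsilon norm_le_zero_iff by blast
qed

text \<open>The indicator of an interval is a pointwise limit of continuous functions on the circle
  with values in [0, 1], so dominated convergence applies with majorant
  \<open>norm (f x)\<close>.\<close>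

private lemma integral_interval:
  assumes "0 \<le> a" "a < b" "b \<le> 1"
  shows "(LINT x|unit_lebesgue. indicator {a<..<b} x *\<^sub>R f x) = 0"
proof -
  \<comment> \<open>\<open>z0\<close> is the midpoint of the arc. The arc is where the cosine of the
    angle to \<open>z0\<close> exceeds \<open>cos (pi * (b - a))\<close>, and \<open>H j\<close> is
    a ramp in this excess, cut off at 0 and 1, which steepens with \<open>j\<close>.\<close>
  define z0 where "z0 = trig 1 ((a + b) / 2)"
  define H where "H j z = min 1 (max 0 (real j * (Re (z * cnj z0) - cos (pi * (b - a)))))" for j z
  have Re: "Re (trig 1 x * cnj z0) = cos (2 * pi * \<bar>x - (a + b) / 2\<bar>)" for x
  proof -
    have "trig 1 x * cnj z0 = trig 1 (x - (a + b) / 2)"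
      by (simp add: z0_def trig_diff_right)
    also have "Re \<dots> = cos (2 * pi * (x - (a + b) / 2))"
      by (simp add: trig_def Re_exp)
    also have "\<dots> = cos (2 * pi * \<bar>x - (a + b) / 2\<bar>)"
      using cos_abs_real[of "2 * pi * (x - (a + b) / 2)"] by (simp only: abs_mult) simp
    finally show ?thesis .
  qed
  have lim: "(\<lambda>j. H j (trig 1 x)) \<longlonglongrightarrow> indicator {a<..<b} x" if x: "x \<in> {0<..<1}" for x
  proof (cases "x \<in> {a<..<b}")
    case True
    then have "\<bar>x - (a + b) / 2\<bar> < (b - a) / 2"
      by (auto simp: abs_if field_simps)
    then have "2 * pi * \<bar>x - (a + b) / 2\<bar> < pi * (b - a)"
      by simp
    moreover have "pi * (b - a) \<le> pi" using assms by simp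
    ultimately have "cos (pi * (b - a)) < cos (2 * pi * \<bar>x - (a + b) / 2\<bar>)"
      by (intro cos_monotone_0_pi) auto
    then have pos: "Re (trig 1 x * cnj z0) - cos (pi * (b - a)) > 0" (is "?d > 0")
      unfolding Re by simp
    have "H j (trig 1 x) = 1" if "j \<ge> nat \<lceil>1 / ?d\<rceil>" for j
    proof -
      have "real j \<ge> 1 / ?d" using that by linarith
      then have "real j * ?d \<ge> 1" using pos by (simp add: field_simps)
      then show ?thesis by (simp add: H_def)
    qed
    then have "(\<lambda>j. H j (trig 1 x)) \<longlonglongrightarrow> 1"
      by (intro tendsto_eventually eventually_sequentiallyI)
    then show ?thesis using True by simp
  next
    case False
    define y where "y = 2 * pi * \<bar>x - (a + b) / 2\<bar>"
    have y1: "y \<ge> pi * (b - a)"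
    proof -
      have "\<bar>x - (a + b) / 2\<bar> \<ge> (b - a) / 2" using False by (auto simp: abs_if field_simps)
      then show ?thesis by (simp add: y_def)
    qed
    have y2: "y \<le> 2 * pi - pi * (b - a)"
    proof -
      have "\<bar>x - (a + b) / 2\<bar> \<le> 1 - (b - a) / 2" using x assms by (auto simp: abs_if field_simps)
      then have "2 * pi * \<bar>x - (a + b) / 2\<bar> \<le> 2 * pi * (1 - (b - a) / 2)"
        by (intro mult_left_mono) auto
      also have "\<dots> = 2 * pi - pi * (b - a)"
        by (simp add: field_simps)
      finally show ?thesis by (simp add: y_def)
    qed
    \<comment> \<open>\<open>y\<close> may exceed \<open>pi\<close>, where the cosine increases
      again; the reflection \<open>2 * pi - y\<close> brings it back into the decreasing
      range.\<close>
    have "cos y \<le> cos (pi * (b - a))"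
    proof (cases "y \<le> pi")
      case True
      then show ?thesis using y1 assms by (intro cos_monotone_0_pi_le) auto
    next
      case False
      have "cos y = cos (2 * pi - y)" by (simp add: cos_diff)
      also have "\<dots> \<le> cos (pi * (b - a))"
        using False y2 assms by (intro cos_monotone_0_pi_le) auto
      finally show ?thesis .
    qed
    then have "Re (trig 1 x * cnj z0) - cos (pi * (b - a)) \<le> 0"
      unfolding Re y_def by simp
    then have "H j (trig 1 x) = 0" for j
      by (simp add: H_def mult_nonneg_nonpos)
    then show ?thesis using False by simp
  qed
  have "(\<lambda>j. LINT x|unit_lebesgue. f x * of_real (H j (trig 1 x))) \<longlonglongrightarrow> (LINT x|unit_lebesgue. indicator {a<..<b} x *\<^sub>R f x)"
  proof (rule integral_dominated_convergence[where w = "\<lambda>x. norm (f x)"])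
    show "AE x in unit_lebesgue. (\<lambda>j. f x * of_real (H j (trig 1 x))) \<longlonglongrightarrow> indicator {a<..<b} x *\<^sub>R f x"
    proof (rule AE_I2)
      fix x :: real assume "x \<in> space unit_lebesgue"
      then have "(\<lambda>j. f x * of_real (H j (trig 1 x))) \<longlonglongrightarrow> f x * of_real (indicator {a<..<b} x)"
        by (intro tendsto_intros lim) simp
      then show "(\<lambda>j. f x * of_real (H j (trig 1 x))) \<longlonglongrightarrow> indicator {a<..<b} x *\<^sub>R f x"
        by (simp add: scaleR_conv_of_real mult.commute)
    qed
    have "\<bar>H j z\<bar> \<le> 1" for j z by (simp add: H_def)
    then show "AE x in unit_lebesgue. norm (f x * of_real (H j (trig 1 x))) \<le> norm (f x)" for j
      by (intro AE_I2) (auto simp: norm_mult mult_left_le)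
    have "(\<lambda>x. complex_of_real (H j (trig 1 x))) \<in> borel_measurable unit_lebesgue" for j
      unfolding H_def by (intro measurable_unit_lebesgue_continuous continuous_intros)
    then show "(\<lambda>x. f x * of_real (H j (trig 1 x))) \<in> borel_measurable unit_lebesgue" for j
      by measurable
    have "{a<..<b} \<in> sets lebesgue" by simp
    then have "{0<..<1} \<inter> {a<..<b} \<in> sets unit_lebesgue"
      by (auto simp: sets_restrict_space)
    then show "(\<lambda>x. indicator {a<..<b} x *\<^sub>R f x) \<in> borel_measurable unit_lebesgue"
      using assms by (intro borel_measurable_scaleR borel_measurable_indicator f_meas) (simp add: Int_absorb1)
  qed (auto intro: L2_imp_integrable_norm f)
  moreover have "(LINT x|unit_lebesgue. f x * of_real (H j (trig 1 x))) = 0" for j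
    unfolding H_def by (intro integral_circle continuous_intros)
  ultimately show ?thesis
    by (simp add: LIMSEQ_const_iff)
qed

text \<open>Dynkin's argument: open intervals are stable under intersection and generate the Borel
  sets, and sets with vanishing integral are closed under complements and disjoint countable unions.
  The complement step uses that \<open>f\<close> has mean 0, by orthogonality to
  \<open>trig 0\<close>.\<close>

private lemma integral_borel:
  assumes "A \<in> sets borel"
  shows "(LINT x|unit_lebesgue. indicator A x *\<^sub>R f x) = 0"
proof -
  have meas: "{0<..<1} \<inter> A \<in> sets unit_lebesgue" if "A \<in> sets borel" for A :: "real set"
  proof -
    have "A \<in> sets lebesgue" using that by simp
    then show ?thesis by (auto simp: sets_restrict_space)
  qed
  have restrict: "(LINT x|unit_lebesgue. indicator A x *\<^sub>R f x) = (LINT x:({0<..<1} \<inter> A)|unit_lebesgue. f x)" for A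
    unfolding set_lebesgue_integral_def by (intro Bochner_Integration.integral_cong) (auto simp: indicator_def)
  have int: "set_integrable unit_lebesgue ({0<..<1} \<inter> A) f" if "A \<in> sets borel" for A
    unfolding set_integrable_def by (intro integrable_mult_indicator meas that L2_imp_integrable f)
  have all: "(LINT x|unit_lebesgue. f x) = 0"
    using ortho[of 0] by (simp add: L2_inner_def)
  define E where "E = range (\<lambda>(a, b). {a<..<b::real})"
  have borel_E: "sets borel = sigma_sets UNIV E"
    unfolding borel_eq_box E_def by (simp add: box_real case_prod_unfold)
  have "Int_stable E"
    unfolding E_def
  proof (rule Int_stableI)
    fix A B assume "A \<in> range (\<lambda>(a, b). {a<..<b::real})" "B \<in> range (\<lambda>(a, b). {a<..<b::real})"
    then obtain a b c d where "A = {a<..<b}" "B = {c<..<d}" by auto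
    then have "A \<inter> B = (\<lambda>(a, b). {a<..<b}) (max a c, min b d)" by auto
    then show "A \<inter> B \<in> range (\<lambda>(a, b). {a<..<b})" by blast
  qed
  moreover have "E \<subseteq> Pow UNIV" by simp
  moreover have "A \<in> sigma_sets UNIV E"
    using assms borel_E by simp
  ultimately show ?thesis
  proof (induction rule: sigma_sets_induct_disjoint)
    case (basic A)
    then obtain a b where A: "A = {a<..<b}" by (auto simp: E_def)
    show ?case
    proof (cases "max a 0 < min b 1")
      case True
      have "(LINT x|unit_lebesgue. indicator A x *\<^sub>R f x) = (LINT x|unit_lebesgue. indicator {max a 0<..<min b 1} x *\<^sub>R f x)"
        by (intro Bochner_Integration.integral_cong) (auto simp: A indicator_def)
      with True show ?thesis by (simp add: integral_interval)
    next
      case False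
      then have "(LINT x|unit_lebesgue. indicator A x *\<^sub>R f x) = (LINT x|unit_lebesgue. 0)"
        by (intro Bochner_Integration.integral_cong) (auto simp: A indicator_def)
      then show ?thesis by simp
    qed
  next
    case empty
    show ?case by simp
  next
    case (compl A)
    then have A: "A \<in> sets borel"
      by (simp add: borel_E)
    have "(LINT x|unit_lebesgue. indicator (UNIV - A) x *\<^sub>R f x)
        = (LINT x|unit_lebesgue. f x - indicator A x *\<^sub>R f x)"
      by (intro Bochner_Integration.integral_cong) (auto simp: indicator_def)
    also have "\<dots> = (LINT x|unit_lebesgue. f x) - (LINT x|unit_lebesgue. indicator A x *\<^sub>R f x)"
    proof (rule Bochner_Integration.integral_diff[OF L2_imp_integrable[OF f]])
      have "integrable unit_lebesgue (\<lambda>x. indicator ({0<..<1} \<inter> A) x *\<^sub>R f x)"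
        using int[OF A] by (simp add: set_integrable_def)
      then show "integrable unit_lebesgue (\<lambda>x. indicator A x *\<^sub>R f x)"
        by (rule iffD1[OF Bochner_Integration.integrable_cong, rotated 2]) (auto simp: indicator_def)
    qed
    finally show ?case using compl all by simp
  next
    case (union A)
    then have A: "A i \<in> sets borel" for i
      by (auto simp: borel_E)
    have "(LINT x|unit_lebesgue. indicator (\<Union>(range A)) x *\<^sub>R f x)
       = (LINT x:(\<Union>i. {0<..<1} \<inter> A i)|unit_lebesgue. f x)"
      unfolding restrict by simp
    also have "\<dots> = (\<Sum>i. LINT x:({0<..<1} \<inter> A i)|unit_lebesgue. f x)"
    proof (rule lebesgue_integral_countable_add)
      show "set_integrable unit_lebesgue (\<Union>i. {0<..<1} \<inter> A i) f"
        using int[of "\<Union>i. A i"] A by auto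
    qed (use union(1) meas[OF A] in \<open>auto simp: disjoint_family_on_def\<close>)
    also have "\<dots> = 0"
      using union(3) unfolding restrict by simp
    finally show ?case .
  qed
qed

text \<open>A Lebesgue set differs from a Borel set by a null set, so the integral of
  \<open>f\<close> over every measurable set vanishes.\<close>

theorem trig_complete: "AE x in unit_lebesgue. f x = 0"
proof (rule unit_lebesgue.density_zero)
  show "integrable unit_lebesgue f" by (intro L2_imp_integrable f)
  fix A assume "A \<in> sets unit_lebesgue"
  then obtain X where X: "X \<in> sets lebesgue" "A = {0<..<1} \<inter> X"
    by (auto simp: sets_restrict_space)
  obtain S N N' where S: "X = S \<union> N" "N \<subseteq> N'" "N' \<in> null_sets lborel" "S \<in> sets lborel"
    by (rule sets_completionE[OF X(1)])
  have "AE x in lborel. x \<notin> N'"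
    using S(3) by (rule AE_not_in)
  then have "AE x in lebesgue. x \<notin> N'"
    by (rule AE_completion)
  then have N': "AE x in unit_lebesgue. x \<notin> N'"
    by (subst AE_restrict_space_iff) auto
  have ind: "indicator B \<in> borel_measurable unit_lebesgue" if "B \<in> sets lebesgue" for B :: "real set"
    using that by (intro measurable_restrict_space1 borel_measurable_indicator)
  have [measurable]: "indicator S \<in> borel_measurable unit_lebesgue" "indicator X \<in> borel_measurable unit_lebesgue"
    using S(4) X(1) by (auto intro!: ind)
  have "(LINT x:A|unit_lebesgue. f x) = (LINT x|unit_lebesgue. indicator X x *\<^sub>R f x)"
    unfolding set_lebesgue_integral_def X(2)
    by (intro Bochner_Integration.integral_cong) (auto simp: indicator_def)
  also have "\<dots> = (LINT x|unit_lebesgue. indicator S x *\<^sub>R f x)"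
  proof (rule integral_cong_AE)
    show "AE x in unit_lebesgue. indicator X x *\<^sub>R f x = indicator S x *\<^sub>R f x"
      using N' by eventually_elim (use S in \<open>auto simp: indicator_def\<close>)
  qed measurable
  also have "\<dots> = 0"
    using S(4) by (intro integral_borel) simp
  finally show "(LINT x:A|unit_lebesgue. f x) = 0" .
qed

end

section \<open>Piecewise Lipschitz data\<close>

lemma increasing_partition_cover:
  fixes x :: "nat \<Rightarrow> real"
  assumes "x 0 < y" "y < x m" "y \<notin> x ` {..m}"
  shows "\<exists>j<m. x j < y \<and> y < x (Suc j)"
  using assms(2,3)
proof (induction m)
  case 0
  with assms(1) show ?case by simp
next
  case (Suc m)
  show ?case
  proof (cases "y < x m")
    case True
    with Suc show ?thesis by (auto simp: atMost_Suc intro: less_SucI)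
  next
    case False
    moreover have "y \<noteq> x m" using Suc.prems by auto
    ultimately show ?thesis using Suc.prems by (intro exI[of _ m]) auto
  qed
qed

text \<open>The function is continuous away from the finitely many break points, and changing values
  at finitely many points preserves measurability.\<close>

lemma piecewise_lipschitz_measurable:
  assumes "piecewise_lipschitz u0"
  shows "u0 \<in> borel_measurable unit_lebesgue"
proof -
  obtain k x where x: "x 0 = 0" "x (Suc k) = 1"
    and L: "\<And>j. j \<le> k \<Longrightarrow> x j < x (Suc j) \<and> (\<exists>C. C-lipschitz_on {x j<..<x (Suc j)} u0)"
    using assms unfolding piecewise_lipschitz_def by blast
  define X where "X = x ` {..Suc k}"
  define A where "A = {0<..<1} - X"
  have fin: "finite X" by (simp add: X_def)
  have "continuous_on A u0"
  proof (rule continuous_at_imp_continuous_on, rule ballI)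
    fix y assume "y \<in> A"
    then obtain j where j: "j < Suc k" "x j < y" "y < x (Suc j)"
      using increasing_partition_cover[of x y "Suc k"] x by (auto simp: A_def X_def)
    then obtain C where "C-lipschitz_on {x j<..<x (Suc j)} u0"
      using L[of j] by auto
    then have "continuous_on {x j<..<x (Suc j)} u0"
      by (rule lipschitz_on_continuous_on)
    then show "isCont u0 y"
      using j by (simp add: continuous_on_eq_continuous_at)
  qed
  moreover have "A \<in> sets borel"
    using fin unfolding A_def by (intro sets.Diff borel_closed[OF finite_imp_closed[OF fin]]) auto
  ultimately have "(\<lambda>y. indicator A y *\<^sub>R u0 y) \<in> borel_measurable borel"
    by (intro borel_measurable_continuous_on_indicator)
  then have "(\<lambda>y. indicator A y *\<^sub>R u0 y) \<in> borel_measurable unit_lebesgue"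
    by (intro measurable_restrict_space1 measurable_completion) simp
  then show ?thesis
  proof (rule measurable_discrete_difference[where X = "X \<inter> {0<..<1}"])
    show "\<And>y. y \<in> X \<inter> {0<..<1} \<Longrightarrow> {y} \<in> sets unit_lebesgue"
      by (auto simp: sets_restrict_space image_iff intro!: bexI[where x = "{_}"])
  qed (use fin in \<open>auto simp: A_def intro: countable_finite\<close>)
qed

text \<open>What the boundary layers see of the data. On the end piece the bound is the Lipschitz
  inequality in the limit; beyond it the distance to the end point is bounded below, and boundedness
  of \<open>u0\<close> is enough.\<close>

lemma piecewise_lipschitz_edge:
  assumes "piecewise_lipschitz u0"
  obtains C where "\<And>y. 0 < y \<Longrightarrow> y < 1 \<Longrightarrow> \<bar>u0 y - u0 0\<bar> \<le> C * y"
    "\<And>y. 0 < y \<Longrightarrow> y < 1 \<Longrightarrow> \<bar>u0 y - u0 1\<bar> \<le> C * (1 - y)"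
proof -
  obtain k x where x: "x 0 = 0" "x (Suc k) = 1"
    and L: "\<And>j. j \<le> k \<Longrightarrow> x j < x (Suc j) \<and> (\<exists>C. C-lipschitz_on {x j<..<x (Suc j)} u0)"
    and lim: "(u0 \<longlongrightarrow> u0 0) (at_right 0)" "(u0 \<longlongrightarrow> u0 1) (at_left 1)"
    using assms unfolding piecewise_lipschitz_def by blast
  have "bounded (u0 ` {x j<..<x (Suc j)})" if j: "j \<le> k" for j
  proof -
    obtain C where "C-lipschitz_on {x j<..<x (Suc j)} u0" using L[OF j] by blast
    moreover have "bounded {x j<..<x (Suc j)}"
      using bounded_box[of "x j" "x (Suc j)"] by (simp only: box_real)
    ultimately show ?thesis
      by (intro bounded_uniformly_continuous_image lipschitz_on_uniformly_continuous)
  qed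
  then have "bounded ((\<Union>j\<le>k. u0 ` {x j<..<x (Suc j)}) \<union> u0 ` x ` {..Suc k})"
    by (intro bounded_Un[THEN iffD2] conjI bounded_UN finite_imp_bounded) auto
  moreover have "u0 ` {0<..<1} \<subseteq> (\<Union>j\<le>k. u0 ` {x j<..<x (Suc j)}) \<union> u0 ` x ` {..Suc k}"
  proof (rule image_subsetI)
    fix y :: real assume y: "y \<in> {0<..<1}"
    show "u0 y \<in> (\<Union>j\<le>k. u0 ` {x j<..<x (Suc j)}) \<union> u0 ` x ` {..Suc k}"
    proof (cases "y \<in> x ` {..Suc k}")
      case False
      then obtain j where "j < Suc k" "x j < y" "y < x (Suc j)"
        using increasing_partition_cover[of x y "Suc k"] x y by auto
      then show ?thesis by (intro UnI1 UN_I[of j]) auto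
    qed auto
  qed
  ultimately obtain B where B: "\<And>y. 0 < y \<Longrightarrow> y < 1 \<Longrightarrow> \<bar>u0 y\<bar> \<le> B"
    unfolding bounded_iff by (metis (no_types, lifting) greaterThanLessThan_iff image_eqI real_norm_def subsetD)
  obtain C0 where C0: "C0-lipschitz_on {0<..<x 1} u0" "0 < x 1"
    using L[of 0] x by auto
  obtain C1 where C1: "C1-lipschitz_on {x k<..<1} u0" "x k < 1"
    using L[of k] x by auto
  have near0: "\<bar>u0 y - u0 0\<bar> \<le> C0 * y" if y: "0 < y" "y < x 1" for y
  proof (rule tendsto_le[of "at_right 0"])
    show "((\<lambda>z. C0 * (y - z)) \<longlongrightarrow> C0 * y) (at_right 0)"
      by (auto intro!: tendsto_eq_intros)
    show "((\<lambda>z. \<bar>u0 y - u0 z\<bar>) \<longlongrightarrow> \<bar>u0 y - u0 0\<bar>) (at_right 0)"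
      by (intro tendsto_intros lim)
    have "\<forall>\<^sub>F z in at_right 0. z \<in> {0<..<y}"
      using y by (intro eventually_at_right_real)
    then show "\<forall>\<^sub>F z in at_right 0. \<bar>u0 y - u0 z\<bar> \<le> C0 * (y - z)"
    proof eventually_elim
      case (elim z)
      then show ?case
        using lipschitz_onD[OF C0(1), of y z] y by (auto simp: dist_real_def)
    qed
  qed simp
  have near1: "\<bar>u0 y - u0 1\<bar> \<le> C1 * (1 - y)" if y: "x k < y" "y < 1" for y
  proof (rule tendsto_le[of "at_left 1"])
    show "((\<lambda>z. C1 * (z - y)) \<longlongrightarrow> C1 * (1 - y)) (at_left 1)"
      by (auto intro!: tendsto_eq_intros)
    show "((\<lambda>z. \<bar>u0 y - u0 z\<bar>) \<longlongrightarrow> \<bar>u0 y - u0 1\<bar>) (at_left 1)"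
      by (intro tendsto_intros lim)
    have "\<forall>\<^sub>F z in at_left 1. z \<in> {y<..<1}"
      using y by (intro eventually_at_left_real)
    then show "\<forall>\<^sub>F z in at_left 1. \<bar>u0 y - u0 z\<bar> \<le> C1 * (z - y)"
    proof eventually_elim
      case (elim z)
      then show ?case
        using lipschitz_onD[OF C1(1), of y z] y by (auto simp: dist_real_def)
    qed
  qed simp
  \<comment> \<open>Each summand is the constant of one of the four cases. The absolute values and
    the nonnegative quotients let the sum dominate each of them.\<close>
  define C where "C = \<bar>C0\<bar> + \<bar>C1\<bar> + (B + \<bar>u0 0\<bar>) / x 1 + (B + \<bar>u0 1\<bar>) / (1 - x k)"
  have "B \<ge> 0" using B[of "1/2"] by simp
  then have pos: "(B + \<bar>u0 0\<bar>) / x 1 \<ge> 0" "(B + \<bar>u0 1\<bar>) / (1 - x k) \<ge> 0"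
    using C0 C1 by simp_all
  show ?thesis
  proof (rule that[of C])
    fix y :: real assume y: "0 < y" "y < 1"
    have "\<bar>u0 y - u0 0\<bar> \<le> C0 * y \<or> \<bar>u0 y - u0 0\<bar> \<le> (B + \<bar>u0 0\<bar>) / x 1 * y"
    proof (cases "y < x 1")
      case False
      have "\<bar>u0 y - u0 0\<bar> \<le> (B + \<bar>u0 0\<bar>) * 1" using B[OF y] by simp
      also have "\<dots> \<le> (B + \<bar>u0 0\<bar>) * (y / x 1)"
        using \<open>B \<ge> 0\<close> C0 False by (intro mult_left_mono) auto
      finally show ?thesis by simp
    qed (use near0 y in auto)
    moreover have "C0 \<le> C" "(B + \<bar>u0 0\<bar>) / x 1 \<le> C"
      using pos unfolding C_def by linarith+
    then have "C0 * y \<le> C * y" "(B + \<bar>u0 0\<bar>) / x 1 * y \<le> C * y"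
      using y mult_right_mono less_imp_le by blast+
    ultimately show "\<bar>u0 y - u0 0\<bar> \<le> C * y" by linarith
    have "\<bar>u0 y - u0 1\<bar> \<le> C1 * (1 - y) \<or> \<bar>u0 y - u0 1\<bar> \<le> (B + \<bar>u0 1\<bar>) / (1 - x k) * (1 - y)"
    proof (cases "x k < y")
      case False
      have "\<bar>u0 y - u0 1\<bar> \<le> (B + \<bar>u0 1\<bar>) * 1" using B[OF y] by simp
      also have "\<dots> \<le> (B + \<bar>u0 1\<bar>) * ((1 - y) / (1 - x k))"
        using \<open>B \<ge> 0\<close> C1 False by (intro mult_left_mono) auto
      finally show ?thesis by simp
    qed (use near1 y in auto)
    moreover have "C1 \<le> C" "(B + \<bar>u0 1\<bar>) / (1 - x k) \<le> C"
      using pos unfolding C_def by linarith+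
    moreover have "0 \<le> 1 - y" using y by simp
    ultimately have "C1 * (1 - y) \<le> C * (1 - y)" "(B + \<bar>u0 1\<bar>) / (1 - x k) * (1 - y) \<le> C * (1 - y)"
      using mult_right_mono by blast+
    moreover note \<open>\<bar>u0 y - u0 1\<bar> \<le> C1 * (1 - y) \<or> _\<close>
    ultimately show "\<bar>u0 y - u0 1\<bar> \<le> C * (1 - y)" by linarith
  qed
qed

text \<open>The constant \<open>c\<close> is 0 for the data themselves and
  \<open>u0 1 + u0 0\<close> for the shifted data in the revival coefficients.\<close>

lemma piecewise_lipschitz_L2:
  assumes "piecewise_lipschitz u0"
  shows "L2 (\<lambda>x. complex_of_real (u0 x + c))"
proof -
  obtain C where C: "\<And>y. 0 < y \<Longrightarrow> y < 1 \<Longrightarrow> \<bar>u0 y - u0 0\<bar> \<le> C * y"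
    by (rule piecewise_lipschitz_edge[OF assms]) (rule that)
  note [measurable] = piecewise_lipschitz_measurable[OF assms]
  show ?thesis
  proof (rule L2_bounded[where B = "\<bar>C\<bar> + \<bar>u0 0\<bar> + \<bar>c\<bar>"])
    fix y :: real assume y: "y \<in> {0<..<1}"
    have "C * y \<le> \<bar>C\<bar> * 1"
      using y by (intro mult_mono) auto
    then show "norm (complex_of_real (u0 y + c)) \<le> \<bar>C\<bar> + \<bar>u0 0\<bar> + \<bar>c\<bar>"
      using C[of y] y unfolding norm_of_real by auto
  qed measurable
qed

lemma L2_mult_continuous:
  fixes f :: "real \<Rightarrow> complex"
  assumes "L2 f" "continuous_on {0..1} g"
  shows "L2 (\<lambda>x. f x * g x)"
proof -
  have [measurable]: "f \<in> borel_measurable unit_lebesgue" "g \<in> borel_measurable unit_lebesgue"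
    using L2_measurable[OF assms(1)] measurable_unit_lebesgue_continuous[OF assms(2)] .
  have "bounded (g ` {0..1})"
    using assms compact_continuous_image compact_imp_bounded by blast
  then obtain B where B: "\<And>x. x \<in> {0..1} \<Longrightarrow> norm (g x) \<le> B"
    unfolding bounded_iff by blast
  have "integrable unit_lebesgue (\<lambda>x. (norm (f x * g x))\<^sup>2)"
  proof (rule Bochner_Integration.integrable_bound[where f = "\<lambda>x. B\<^sup>2 * (norm (f x))\<^sup>2"])
    show "AE x in unit_lebesgue. norm ((norm (f x * g x))\<^sup>2) \<le> norm (B\<^sup>2 * (norm (f x))\<^sup>2)"
      using B by (intro AE_I2) (auto simp: norm_mult power_mult_distrib mult.commute[of "B\<^sup>2"] intro!: mult_left_mono power_mono)
  qed (use L2_integrable[OF assms(1)] in auto)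
  then show ?thesis unfolding L2_def by simp
qed

lemma L2_G:
  assumes "piecewise_lipschitz u0"
  shows "L2 (G u0)"
proof -
  have "L2 (\<lambda>x. complex_of_real (u0 x + (u0 1 + u0 0)) * exp (\<i> * of_real (pi * x / 3)))"
    by (intro L2_mult_continuous piecewise_lipschitz_L2 assms continuous_intros) simp_all
  then show ?thesis
    unfolding G_def by (simp add: add.assoc)
qed

section \<open>The revival part\<close>

lemma L2_sums_Re:
  assumes "L2_sums F s"
  shows "L2_sums (\<lambda>n x. Re (F n x)) (\<lambda>x. Re (s x))"
proof -
  have L2_Re: "L2 (\<lambda>x. Re (f x))" if "L2 f" for f
    unfolding L2_def
  proof
    show m: "(\<lambda>x. Re (f x)) \<in> borel_measurable unit_lebesgue"
      by (rule borel_measurable_continuous_on[OF _ L2_measurable[OF that]]) (intro continuous_intros)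
    show "integrable unit_lebesgue (\<lambda>x. (norm (Re (f x)))\<^sup>2)"
      by (rule Bochner_Integration.integrable_bound[OF L2_integrable[OF that]])
         (use m in \<open>auto intro!: AE_I2 borel_measurable_power simp: abs_le_square_iff[symmetric] abs_Re_le_cmod\<close>)
  qed
  have L: "L2 (\<lambda>x. (\<Sum>n<N. F n x) - s x)" for N
    using assms by (intro L2_diff L2_sum) (auto simp: L2_sums_iff)
  have "norm2 (\<lambda>x. Re ((\<Sum>n<N. F n x) - s x)) \<le> norm2 (\<lambda>x. (\<Sum>n<N. F n x) - s x)" for N
    by (intro norm2_mono_norm L2_Re L) (simp only: real_norm_def abs_Re_le_cmod)
  then have "norm (norm2 (\<lambda>x. (\<Sum>n<N. Re (F n x)) - Re (s x))) \<le> norm2 (\<lambda>x. (\<Sum>n<N. F n x) - s x)" for N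
    by (simp add: Re_sum)
  from LIMSEQ_norm_le_0[OF this] show ?thesis
    using assms L2_Re by (simp add: L2_sums_iff)
qed

lemma orthonormal_L2_subfamily:
  assumes "orthonormal_L2 e" "inj h"
  shows "orthonormal_L2 (\<lambda>i. e (h i))"
  using assms by (auto simp: orthonormal_L2_def inj_eq)

definition airy_exp :: "nat \<Rightarrow> real \<Rightarrow> complex" where
  "airy_exp n x = exp (\<i> * of_real (airy_freq n * x))"

text \<open>The offset in the frequencies is a common factor of modulus 1. It cancels in inner
  products, so orthonormality is inherited from \<open>trig\<close>, and its conjugate is the
  exponential factor in \<open>G\<close>.\<close>

lemma airy_exp_eq_trig: "airy_exp n x = exp (- \<i> * of_real (pi * x / 3)) * trig (int n) x"
  unfolding airy_exp_def trig_def airy_freq_def exp_add[symmetric]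
  by (rule arg_cong[where f = exp]) (simp add: field_simps)

lemma continuous_on_airy_exp [continuous_intros]: "continuous_on A (airy_exp n)"
  unfolding airy_exp_def by (intro continuous_intros)

lemma airy_exp_cnj_airy_exp: "airy_exp m x * cnj (airy_exp n x) = trig (int m - int n) x"
proof -
  have "exp (- \<i> * of_real (pi * x / 3)) * cnj (exp (- \<i> * of_real (pi * x / 3))) = 1"
    by (simp add: exp_cnj exp_add[symmetric])
  then show ?thesis
    unfolding airy_exp_eq_trig complex_cnj_mult cnj_trig
    using trig_add[of "int m" "- int n" x] by (simp add: algebra_simps)
qed

lemma orthonormal_airy_exp: "orthonormal_L2 airy_exp"
  unfolding orthonormal_L2_def L2_inner_def airy_exp_cnj_airy_exp
  by (auto intro!: L2_continuous continuous_intros simp: integral_trig)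

lemma tilde_coeff_eq_inner:
  "tilde_coeff u0 n = L2_inner (\<lambda>y. of_real (u0 y + (u0 1 + u0 0))) (airy_exp n)"
  unfolding tilde_coeff_def L2_inner_def airy_exp_def by (simp add: exp_cnj add.assoc)

lemma tilde_coeff_eq_fourier: "tilde_coeff u0 n = fourier_coeff (G u0) (int n)"
proof -
  have "cnj (airy_exp n x) = exp (\<i> * of_real (pi * x / 3)) * cnj (trig (int n) x)" for x
    by (simp add: airy_exp_eq_trig exp_cnj)
  then show ?thesis
    unfolding tilde_coeff_eq_inner fourier_coeff_eq_inner L2_inner_def G_def
    by (simp add: mult.assoc add.assoc)
qed

lemma tilde_coeff_summable:
  assumes "piecewise_lipschitz u0"
  shows "summable (\<lambda>n. (norm (tilde_coeff u0 (Suc n)))\<^sup>2)"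
  unfolding tilde_coeff_eq_inner
  by (intro Bessel_summable orthonormal_airy_exp piecewise_lipschitz_L2 assms) simp

lemma UR_L2_sums:
  assumes "piecewise_lipschitz u0"
  shows "L2_sums (UR_term u0 t) (\<lambda>x. UR u0 x t)"
proof -
  define a where "a n = 2 * (tilde_coeff u0 (Suc n) * exp (\<i> * of_real (airy_freq (Suc n) ^ 3 * t)))" for n
  have "norm (a n) = 2 * norm (tilde_coeff u0 (Suc n))" for n
    by (simp add: a_def norm_mult)
  then have "summable (\<lambda>n. (norm (a n))\<^sup>2)"
    using summable_mult[OF tilde_coeff_summable[OF assms], of 4] by (simp add: power_mult_distrib)
  moreover have "orthonormal_L2 (\<lambda>n. airy_exp (Suc n))"
    by (rule orthonormal_L2_subfamily[OF orthonormal_airy_exp]) simp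
  ultimately obtain s where "L2_sums (\<lambda>n x. a n * airy_exp (Suc n) x) s"
    using Riesz_Fischer by blast
  from L2_sums_Re[OF this] have "L2_sums (UR_term u0 t) (\<lambda>x. Re (s x))"
    unfolding UR_term_def a_def airy_exp_def by (simp add: mult.assoc)
  from L2_sums_L2_suminf[OF this] show ?thesis
    unfolding UR_def by simp
qed

section \<open>Revivals at rational times\<close>

text \<open>Pointwise convergence is wanted because the series will be evaluated at shifted
  arguments; it is available along a subsequence, via convergence in L1.\<close>

lemma L2_tendsto_AE_subseq:
  fixes S :: "nat \<Rightarrow> real \<Rightarrow> 'a::euclidean_space"
  assumes "\<And>N. L2 (S N)" "L2 s" "(\<lambda>N. norm2 (\<lambda>x. S N x - s x)) \<longlonglongrightarrow> 0"
  shows "\<exists>r. strict_mono r \<and> (AE x in unit_lebesgue. (\<lambda>k. S (r k) x) \<longlonglongrightarrow> s x)"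
proof -
  note L = L2_diff[OF assms(1) assms(2)]
  have int: "integrable unit_lebesgue (\<lambda>x. S N x - s x)" for N
    using L2_imp_integrable_norm(1)[OF L[of N]] L2_measurable[OF L[of N]] by (simp add: integrable_norm_iff)
  have "norm (LINT x|unit_lebesgue. norm (S N x - s x)) \<le> sqrt (norm2 (\<lambda>x. S N x - s x))" for N
    using L2_imp_integrable_norm(2)[OF L[of N]] by simp
  from LIMSEQ_norm_le_0[OF this] have "(\<lambda>N. LINT x|unit_lebesgue. norm (S N x - s x)) \<longlonglongrightarrow> 0"
    using tendsto_real_sqrt[OF assms(3)] by simp
  from tendsto_L1_AE_subseq[OF int this] show ?thesis
    by (simp add: LIM_zero_iff)
qed

text \<open>The preimage of a null set under a rotation of the circle lies in countably many
  translates of it.\<close>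

lemma AE_unit_shift:
  assumes "AE x in unit_lebesgue. Q x"
  shows "AE x in unit_lebesgue. Q (frac (x + c))"
proof -
  have "AE x in lebesgue. x \<in> {0<..<1} \<longrightarrow> Q x"
    using assms by (subst (asm) AE_restrict_space_iff) auto
  then obtain N where N: "N \<in> null_sets lebesgue" "\<And>x. x \<in> {0<..<1} \<Longrightarrow> \<not> Q x \<Longrightarrow> x \<in> N"
    unfolding eventually_ae_filter by auto
  \<comment> \<open>The point 0 is inserted because \<open>frac\<close> may return it, while the
    hypothesis concerns only the open interval.\<close>
  define B where "B = (\<Union>m::int. (+) (of_int m - c) ` insert 0 N)"
  have "negligible (insert 0 N)"
    using N(1) by (simp add: negligible_iff_null_sets)
  then have "negligible B"
    unfolding B_def by (intro negligible_countable_Union) (auto intro: negligible_translation)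
  then have "AE x in lebesgue. x \<notin> B"
    by (intro AE_not_in) (simp add: negligible_iff_null_sets)
  then have "AE x in unit_lebesgue. x \<notin> B"
    by (subst AE_restrict_space_iff) auto
  then show ?thesis
  proof eventually_elim
    case (elim x)
    have "x = of_int \<lfloor>x + c\<rfloor> - c + frac (x + c)"
      by (simp add: frac_def)
    then have "frac (x + c) \<notin> insert 0 N"
      using elim unfolding B_def by blast
    moreover have "0 \<le> frac (x + c)" "frac (x + c) < 1"
      by (simp_all add: frac_lt_1)
    ultimately show ?case using N(2)[of "frac (x + c)"] by force
  qed
qed

lemma trig_frac: "trig n (frac x) = trig n x"
proof -
  have "trig n x = trig n (frac x + of_int \<lfloor>x\<rfloor>)"
    by (simp add: frac_def)
  then show ?thesis by (simp only: trig_add_right trig_of_int) simp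
qed

lemma L2_trig_series_inner:
  assumes s: "L2_sums (\<lambda>n x. a n * trig (h n) x) s" and h: "inj h"
  shows "L2_inner s (trig (h n)) = a n"
    and "m \<notin> range h \<Longrightarrow> L2_inner s (trig m) = 0"
proof -
  show "L2_inner s (trig (h n)) = a n"
    by (rule L2_sums_orthonormal_inner[OF orthonormal_L2_subfamily[OF orthonormal_trig h] s])
  assume m: "m \<notin> range h"
  have "(\<lambda>N. L2_inner (\<lambda>x. \<Sum>n<N. a n * trig (h n) x) (trig m)) \<longlonglongrightarrow> L2_inner s (trig m)"
    using s unfolding L2_sums_iff by (intro L2_inner_tendsto L2_sum L2_trig) auto
  moreover have "L2_inner (\<lambda>x. \<Sum>n<N. a n * trig (h n) x) (trig m) = 0" for N
  proof -
    have "L2_inner (trig (h n)) (trig m) = 0" for n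
      using orthonormal_trig m by (auto simp: orthonormal_L2_def)
    then show ?thesis
      by (subst L2_inner_sum_left) (auto simp: L2_scale L2_trig L2_inner_scale_left)
  qed
  ultimately show "L2_inner s (trig m) = 0"
    by (simp add: LIMSEQ_const_iff)
qed

text \<open>With \<open>P\<close> and \<open>M\<close> the sums over the positive and the negative
  frequencies, \<open>v\<close> is its mean plus \<open>P + M\<close> by completeness of
  \<open>trig\<close>, and \<open>\<i>\<close> times the transform is \<open>P - M\<close>.\<close>

lemma hilbert_transform_analytic_part:
  assumes v: "L2 v"
    and P: "L2_sums (\<lambda>n x. fourier_coeff v (int (Suc n)) * trig (int (Suc n)) x) P"
  shows "AE x in unit_lebesgue. v x + \<i> * hilbert_transform v x - fourier_coeff v 0 = 2 * P x"
proof -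
  have inj: "inj (\<lambda>n. int (Suc n))" "inj (\<lambda>n. - int (Suc n))"
    by (auto simp: inj_def)
  have "summable (\<lambda>n. (norm (fourier_coeff v (- int (Suc n))))\<^sup>2)"
    unfolding fourier_coeff_eq_inner by (rule Bessel_summable[OF orthonormal_trig inj(2) v])
  from Riesz_Fischer[OF orthonormal_L2_subfamily[OF orthonormal_trig inj(2)] this]
  obtain M where M: "L2_sums (\<lambda>n x. fourier_coeff v (- int (Suc n)) * trig (- int (Suc n)) x) M"
    by blast
  have L2: "L2 P" "L2 M" using P M by (auto simp: L2_sums_iff)
  have hil: "L2_sums (\<lambda>n x. \<i> * (fourier_coeff v (- int (Suc n)) * trig (- int (Suc n)) x
      + - 1 * (fourier_coeff v (int (Suc n)) * trig (int (Suc n)) x))) (\<lambda>x. \<i> * (M x + - 1 * P x))"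
    by (intro L2_sums_scale L2_sums_add M P)
  have "AE x in unit_lebesgue. hilbert_transform v x = \<i> * (M x + - 1 * P x)"
  proof -
    have "exp (- 2 * pi * \<i> * of_nat (Suc n) * of_real x) = trig (- int (Suc n)) x"
      "exp (2 * pi * \<i> * of_nat (Suc n) * of_real x) = trig (int (Suc n)) x" for n x
      unfolding trig_def by (simp_all add: algebra_simps)
    with hil show ?thesis
      unfolding hilbert_transform_def by (intro L2_suminf_AE_eq) (simp only: diff_conv_add_uminus mult_minus1)
  qed
  moreover
  define w where "w x = v x - fourier_coeff v 0 * trig 0 x - P x - M x" for x
  have Lw: "L2 w"
    unfolding w_def by (intro L2_diff v L2 L2_scale L2_trig)
  have "L2_inner w (trig m) = 0" for m
  proof -
    have w: "L2_inner w (trig m) = fourier_coeff v m - fourier_coeff v 0 * (if m = 0 then 1 else 0)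
      - L2_inner P (trig m) - L2_inner M (trig m)"
      unfolding w_def fourier_coeff_eq_inner using orthonormal_trig
      by (subst L2_inner_diff_left, (intro L2_diff v L2 L2_scale L2_trig)+)+
         (simp add: L2_inner_scale_left orthonormal_L2_def del: trig_0)
    consider "m = 0" | n where "m = int (Suc n)" | n where "m = - int (Suc n)"
      by (metis int_cases2 of_nat_0 of_nat_Suc add.inverse_neutral not0_implies_Suc)
    then show ?thesis
    proof cases
      case 1
      then have "0 \<notin> range (\<lambda>n. int (Suc n))" "0 \<notin> range (\<lambda>n. - int (Suc n))"
        by (auto simp: image_iff)
      with 1 show ?thesis
        using L2_trig_series_inner(2)[OF P inj(1), of 0] L2_trig_series_inner(2)[OF M inj(2), of 0] w by auto
    next
      case (2 n)
      then have "m \<notin> range (\<lambda>n. - int (Suc n))" by (auto simp: image_iff)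
      with 2 show ?thesis
        using L2_trig_series_inner(1)[OF P inj(1), of n] L2_trig_series_inner(2)[OF M inj(2), of m] w by auto
    next
      case (3 n)
      then have "m \<notin> range (\<lambda>n. int (Suc n))" by (auto simp: image_iff)
      with 3 show ?thesis
        using L2_trig_series_inner(2)[OF P inj(1), of m] L2_trig_series_inner(1)[OF M inj(2), of n] w by auto
    qed
  qed
  from trig_complete[OF Lw this] have "AE x in unit_lebesgue. w x = 0" .
  ultimately show ?thesis
  proof eventually_elim
    case (elim x)
    have "\<i> * hilbert_transform v x = P x - M x"
      unfolding elim(1) by (simp flip: mult.assoc)
    moreover have "v x = fourier_coeff v 0 + P x + M x"
      using elim(2) by (simp add: w_def algebra_simps)
    ultimately show ?case by simp
  qed
qed

section \<open>Finite Fourier analysis of the phase at rational times\<close>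

lemma sum_roots_of_unity:
  assumes "0 < q"
  shows "(\<Sum>k<q. trig j (real k / real q)) = (if int q dvd j then of_nat q else 0)"
proof -
  define z where "z = trig j (1 / real q)"
  have z: "trig j (real k / real q) = z ^ k" for k
    unfolding z_def trig_def exp_of_nat_mult[symmetric] by (simp add: mult_ac)
  have z_eq_1: "z = 1 \<longleftrightarrow> int q dvd j"
  proof
    assume "z = 1"
    then obtain n :: int where "2 * pi * of_int j * (1 / real q) = of_int (2 * n) * pi"
      unfolding z_def trig_def exp_eq_1 by auto
    then have "real_of_int j = of_int (n * int q)"
      using assms by (simp add: field_simps)
    then have "j = n * int q" by (simp only: of_int_eq_iff)
    then show "int q dvd j" by simp
  next
    assume "int q dvd j"
    then obtain n where j: "j = int q * n" by auto
    have "z = trig 1 (of_int n)"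
      unfolding z_def trig_def j using assms by (simp add: mult_ac)
    then show "z = 1" by simp
  qed
  show ?thesis
  proof (cases "z = 1")
    case True
    then show ?thesis using z_eq_1 by (simp add: z)
  next
    case False
    have "z ^ q = trig j (of_int 1)" using z[of q] assms by simp
    then have "z ^ q = 1" by (simp only: trig_of_int)
    moreover have "(\<Sum>k<q. z ^ k) = (z ^ q - 1) / (z - 1)"
      by (rule geometric_sum) (rule False)
    ultimately show ?thesis using False z_eq_1 by (simp add: z)
  qed
qed

text \<open>\<open>d\<close> is the finite Fourier transform of the q-periodic sequence
  \<open>E\<close>; orthogonality of the characters modulo \<open>q\<close> leaves only the residue
  of \<open>n\<close>.\<close>

lemma discrete_fourier_inversion:
  assumes "0 < q" and periodic: "\<And>m. E (m mod q) = E m"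
  defines "d \<equiv> \<lambda>k. (\<Sum>m<q. E m * trig (int m) (real k / real q)) / of_nat q"
  shows "(\<Sum>k<q. d k * trig (- int n) (real k / real q)) = E n"
proof -
  have "(\<Sum>k<q. d k * trig (- int n) (real k / real q))
      = (\<Sum>k<q. \<Sum>m<q. E m / of_nat q * trig (int m - int n) (real k / real q))"
    unfolding d_def by (simp add: sum_distrib_right sum_divide_distrib mult.assoc trig_add[of "int _" "- int n", simplified])
  also have "\<dots> = (\<Sum>m<q. E m / of_nat q * (\<Sum>k<q. trig (int m - int n) (real k / real q)))"
    by (subst sum.swap) (simp add: sum_distrib_left)
  also have "\<dots> = (\<Sum>m<q. if m = n mod q then E m else 0)"
  proof (rule sum.cong[OF refl])
    fix m assume "m \<in> {..<q}"
    then have "int q dvd int m - int n \<longleftrightarrow> m = n mod q"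
      by (simp add: mod_eq_dvd_iff[symmetric] flip: of_nat_mod)
    then show "E m / of_nat q * (\<Sum>k<q. trig (int m - int n) (real k / real q)) = (if m = n mod q then E m else 0)"
      using assms(1) by (simp add: sum_roots_of_unity)
  qed
  also have "\<dots> = E n"
    using assms(1) periodic by simp
  finally show ?thesis .
qed

text \<open>Expand (2N - 1/3)^3 = 8N^3 - 4N^2 + (2/3)N - 1/27. The constant gives a fixed phase and
  the linear term a translation by p/(3q). The rest is twice an integer polynomial in N, so its
  phase depends only on N modulo q.\<close>

lemma airy_freq_cube:
  fixes p q N :: nat
  assumes "0 < q"
  shows "exp (\<i> * of_real (airy_freq N ^ 3 * (real p / (real q * pi\<^sup>2))))
    = exp (- \<i> * of_real (pi / 27 * (real p / real q)))
      * (trig (int N) (real p / (3 * real q)) * trig (int p * (4 * int N ^ 3 - 2 * int N ^ 2)) (1 / real q))"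
proof -
  have "airy_freq N ^ 3 * (real p / (real q * pi\<^sup>2))
      = pi * (real p / real q) * (8 * real N ^ 3 - 4 * real N ^ 2 + 2 / 3 * real N - 1 / 27)"
    using assms unfolding airy_freq_def
    by (simp add: field_simps power2_eq_square power3_eq_cube)
  also have "\<dots> = - (pi / 27 * (real p / real q)) + (2 * pi * real N * (real p / (3 * real q))
      + 2 * pi * (real p * (4 * real N ^ 3 - 2 * real N ^ 2)) * (1 / real q))"
    using assms by (simp add: field_simps power2_eq_square power3_eq_cube)
  finally have eq: "\<i> * of_real (airy_freq N ^ 3 * (real p / (real q * pi\<^sup>2)))
      = \<i> * of_real (- (pi / 27 * (real p / real q)) + (2 * pi * real N * (real p / (3 * real q))
      + 2 * pi * (real p * (4 * real N ^ 3 - 2 * real N ^ 2)) * (1 / real q)))"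
    by simp
  show ?thesis
    unfolding eq trig_def exp_add[symmetric]
    by (rule arg_cong[where f = exp]) (simp add: algebra_simps)
qed

lemma cubic_phase_periodic:
  assumes "0 < q"
  shows "trig (int p * (4 * int (m mod q) ^ 3 - 2 * int (m mod q) ^ 2)) (1 / real q)
    = trig (int p * (4 * int m ^ 3 - 2 * int m ^ 2)) (1 / real q)"
proof -
  have "int p * (4 * int m ^ 3 - 2 * int m ^ 2) mod int q
      = int p * (4 * int (m mod q) ^ 3 - 2 * int (m mod q) ^ 2) mod int q"
    unfolding zmod_int
    by (intro mod_mult_cong[OF refl] mod_diff_cong) (simp_all only: power_mod)
  then obtain j where "int p * (4 * int m ^ 3 - 2 * int m ^ 2)
      - int p * (4 * int (m mod q) ^ 3 - 2 * int (m mod q) ^ 2) = int q * j"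
    unfolding mod_eq_dvd_iff by (elim dvdE)
  then have j: "int p * (4 * int m ^ 3 - 2 * int m ^ 2)
      = int p * (4 * int (m mod q) ^ 3 - 2 * int (m mod q) ^ 2) + int q * j"
    by linarith
  have "trig (int q * j) (1 / real q) = trig 1 (of_int j)"
    using assms by (simp add: trig_def mult_ac)
  then have "trig (int q * j) (1 / real q) = 1"
    by simp
  then show ?thesis
    unfolding j trig_add by simp
qed

theorem UR_rational_time:
  fixes p q :: nat
  assumes q: "1 \<le> q"
  shows "\<exists>d. \<forall>u0. piecewise_lipschitz u0 \<longrightarrow>
    (AE x in unit_lebesgue. UR u0 x (real p / (real q * pi\<^sup>2)) =
      Re (exp (- \<i> * of_real (pi / 27 * (9 * x + real p / real q)))
        * (L1_part d p q u0 x + \<i> * L2_part d p q u0 x - L3_part u0)))"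
proof -
  define E where "E m = trig (int p * (4 * int m ^ 3 - 2 * int m ^ 2)) (1 / real q)" for m :: nat
  define d where "d k = (\<Sum>m<q. E m * trig (int m) (real k / real q)) / of_nat q" for k
  have dE: "(\<Sum>k<q. d k * trig (- int n) (real k / real q)) = E n" for n
    unfolding d_def using q by (intro discrete_fourier_inversion) (auto simp: E_def cubic_phase_periodic)
  \<comment> \<open>The mean of \<open>G\<close> has to be subtracted in each translate; since the
    weights add up to \<open>E 0 = 1\<close>, it appears exactly once in the formula.\<close>
  have d_sum: "(\<Sum>k<q. d k) = 1"
    using dE[of 0] by (simp add: E_def)
  define c where "c k = real p / (3 * real q) - real k / real q" for k
  show ?thesis
  proof (intro exI[of _ d] allI impI)
    fix u0 assume u0: "piecewise_lipschitz u0"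
    define t where "t = real p / (real q * pi\<^sup>2)"
    define w where "w x = exp (- \<i> * of_real (pi / 27 * (9 * x + real p / real q)))" for x
    define S where "S N x = (\<Sum>n<N. fourier_coeff (G u0) (int (Suc n)) * trig (int (Suc n)) x)" for N x
    have G: "L2 (G u0)" using u0 by (rule L2_G)
    have inj: "inj (\<lambda>n. int (Suc n))" by (auto simp: inj_def)
    have "summable (\<lambda>n. (norm (fourier_coeff (G u0) (int (Suc n))))\<^sup>2)"
      unfolding fourier_coeff_eq_inner by (rule Bessel_summable[OF orthonormal_trig inj G])
    from Riesz_Fischer[OF orthonormal_L2_subfamily[OF orthonormal_trig inj] this]
    obtain P where P: "L2_sums (\<lambda>n x. fourier_coeff (G u0) (int (Suc n)) * trig (int (Suc n)) x) P"
      by blast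
    have SL2: "L2 (S N)" for N
      unfolding S_def by (intro L2_sum L2_scale L2_trig)
    \<comment> \<open>One subsequence serves all \<open>q\<close> translates, since almost
      everywhere convergence survives each rotation.\<close>
    obtain r where r: "strict_mono r" "AE x in unit_lebesgue. (\<lambda>k. S (r k) x) \<longlonglongrightarrow> P x"
      using L2_tendsto_AE_subseq[of S P] SL2 P unfolding L2_sums_iff S_def by blast
    \<comment> \<open>Writing the periodic phase \<open>E\<close> through \<open>d\<close> turns
      each term into a weighted sum of its translates by \<open>c k\<close>, with weights that are
      the same for all \<open>n\<close>.\<close>
    have term_eq: "UR_term u0 t n x = Re (w x * (\<Sum>k<q. d k * (2 * (fourier_coeff (G u0) (int (Suc n)) * trig (int (Suc n)) (frac (x + c k))))))" for n x
    proof -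
      define N where "N = Suc n"
      have "(\<Sum>k<q. d k * (2 * (fourier_coeff (G u0) (int N) * trig (int N) (frac (x + c k)))))
          = 2 * fourier_coeff (G u0) (int N) * trig (int N) x * trig (int N) (real p / (3 * real q))
            * (\<Sum>k<q. d k * trig (- int N) (real k / real q))"
        unfolding sum_distrib_left trig_frac c_def trig_add_right trig_diff_right cnj_trig
        by (rule sum.cong) (simp_all add: mult_ac)
      also have "\<dots> = 2 * tilde_coeff u0 N * trig (int N) x * trig (int N) (real p / (3 * real q)) * E N"
        by (simp only: dE tilde_coeff_eq_fourier)
      finally have eq: "(\<Sum>k<q. d k * (2 * (fourier_coeff (G u0) (int N) * trig (int N) (frac (x + c k)))))
          = 2 * tilde_coeff u0 N * trig (int N) x * trig (int N) (real p / (3 * real q)) * E N" .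
      have w: "w x = exp (- \<i> * of_real (pi * x / 3)) * exp (- \<i> * of_real (pi / 27 * (real p / real q)))"
        unfolding w_def exp_add[symmetric] by (rule arg_cong[where f = exp]) (simp add: algebra_simps)
      have "UR_term u0 t n x = Re (2 * (tilde_coeff u0 N * exp (\<i> * of_real (airy_freq N ^ 3 * t)) * airy_exp N x))"
        unfolding UR_term_def N_def airy_exp_def by simp
      also have "2 * (tilde_coeff u0 N * exp (\<i> * of_real (airy_freq N ^ 3 * t)) * airy_exp N x)
          = w x * (2 * tilde_coeff u0 N * trig (int N) x * trig (int N) (real p / (3 * real q)) * E N)"
        unfolding t_def w airy_exp_eq_trig E_def airy_freq_cube[OF order_less_le_trans[OF zero_less_one q]]
        by (simp only: mult_ac)
      finally show ?thesis using eq unfolding N_def by simp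
    qed
    have sum_eq: "(\<Sum>n<N. UR_term u0 t n x) = Re (w x * (\<Sum>k<q. d k * (2 * S N (frac (x + c k)))))" for N x
    proof -
      have "(\<Sum>k<q. d k * (2 * S N (frac (x + c k))))
        = (\<Sum>n<N. \<Sum>k<q. d k * (2 * (fourier_coeff (G u0) (int (Suc n)) * trig (int (Suc n)) (frac (x + c k)))))"
        unfolding S_def by (subst sum.swap) (simp add: sum_distrib_left)
      then show ?thesis
        by (simp only: term_eq sum_distrib_left Re_sum)
    qed
    have "AE x in unit_lebesgue. \<forall>k\<in>{..<q}. (\<lambda>j. S (r j) (frac (x + c k))) \<longlonglongrightarrow> P (frac (x + c k))"
      by (intro AE_finite_allI AE_unit_shift[OF r(2)]) simp
    then have "AE x in unit_lebesgue. (\<lambda>j. \<Sum>n<r j. UR_term u0 t n x)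
        \<longlonglongrightarrow> Re (w x * (\<Sum>k<q. d k * (2 * P (frac (x + c k)))))"
    proof eventually_elim
      case (elim x)
      then show ?case unfolding sum_eq by (intro tendsto_intros) auto
    qed
    moreover have UR: "L2_sums (UR_term u0 t) (\<lambda>x. UR u0 x t)"
      by (rule UR_L2_sums[OF u0])
    then have "(\<lambda>j. norm2 (\<lambda>x. (\<Sum>n<r j. UR_term u0 t n x) - UR u0 x t)) \<longlonglongrightarrow> 0"
      using LIMSEQ_subseq_LIMSEQ[OF _ r(1)] unfolding L2_sums_iff comp_def by blast
    ultimately have "AE x in unit_lebesgue. UR u0 x t = Re (w x * (\<Sum>k<q. d k * (2 * P (frac (x + c k)))))"
      using UR unfolding L2_sums_iff
      by (intro L2_limit_AE_eq[where S = "\<lambda>j x. \<Sum>n<r j. UR_term u0 t n x"] L2_sum) auto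
    moreover have "AE x in unit_lebesgue. \<forall>k\<in>{..<q}. G u0 (frac (x + c k)) + \<i> * hilbert_transform (G u0) (frac (x + c k))
        - fourier_coeff (G u0) 0 = 2 * P (frac (x + c k))"
      by (intro AE_finite_allI AE_unit_shift[OF hilbert_transform_analytic_part[OF G P]]) simp
    ultimately show "AE x in unit_lebesgue. UR u0 x (real p / (real q * pi\<^sup>2)) =
      Re (exp (- \<i> * of_real (pi / 27 * (9 * x + real p / real q)))
        * (L1_part d p q u0 x + \<i> * L2_part d p q u0 x - L3_part u0))"
    proof eventually_elim
      case (elim x)
      have L3: "L3_part u0 = (\<Sum>k<q. d k * fourier_coeff (G u0) 0)"
        by (simp add: sum_distrib_right[symmetric] d_sum L3_part_def fourier_coeff_def)
      have "(\<Sum>k<q. d k * (2 * P (frac (x + c k))))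
        = (\<Sum>k<q. d k * (G u0 (frac (x + c k)) + \<i> * hilbert_transform (G u0) (frac (x + c k))
        - fourier_coeff (G u0) 0))"
        using elim(2) by (intro sum.cong) auto
      also have "\<dots> = L1_part d p q u0 x + \<i> * L2_part d p q u0 x - L3_part u0"
        unfolding L1_part_def L2_part_def L3 periodic_ext_def c_def
        by (simp add: sum.distrib sum_subtractf sum_distrib_left algebra_simps)
      finally show ?case using elim(1) unfolding w_def t_def by simp
    qed
  qed
qed

section \<open>Eigenfunctions\<close>

lemma AC_deriv_integral:
  assumes "AC_deriv f g"
  shows "g integrable_on {0..1}" "x \<in> {0..1} \<Longrightarrow> f x = f 0 + integral {0..x} g"
proof -
  have int: "integrable unit_lebesgue g"
    using assms by (simp add: AC_deriv_def)
  then have "g integrable_on {0<..<1}"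
    by (intro integrable_on_lebesgue_on) auto
  then show "g integrable_on {0..1}"
    by (simp add: integrable_on_open_interval_real)
  assume x: "x \<in> {0..1}"
  have "integrable lebesgue (\<lambda>y. indicator {0<..<1} y *\<^sub>R g y)"
    by (intro iffD1[OF integrable_restrict_space int]) simp
  then have "integrable lebesgue (\<lambda>y. indicator {0<..<x} y *\<^sub>R indicator {0<..<1} y *\<^sub>R g y)"
    by (rule integrable_mult_indicator[rotated]) auto
  also have "(\<lambda>y. indicator {0<..<x} y *\<^sub>R indicator {0<..<1} y *\<^sub>R g y) = (\<lambda>y. indicator {0<..<x} y *\<^sub>R g y)"
    using x by (auto simp: indicator_def)
  finally have "integrable (lebesgue_on {0<..<x}) g"
    by (rule iffD2[OF integrable_restrict_space, rotated]) simp
  then have "(LINT y|lebesgue_on {0<..<x}. g y) = integral {0..x} g"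
    using lebesgue_integral_eq_integral[of "{0<..<x}" g] by (simp add: integral_open_interval_real)
  moreover have "f x = f 0 + (LINT y|lebesgue_on {0<..<x}. g y)"
    using assms x unfolding AC_deriv_def by blast
  ultimately show "f x = f 0 + integral {0..x} g"
    by simp
qed

lemma AC_deriv_continuous:
  assumes "AC_deriv f g"
  shows "continuous_on {0..1} f"
proof -
  have "continuous_on {0..1} (\<lambda>x. f 0 + integral {0..x} g)"
    by (intro continuous_intros indefinite_integral_continuous_1 AC_deriv_integral[OF assms])
  then show ?thesis
    by (rule continuous_on_eq) (rule AC_deriv_integral(2)[OF assms, symmetric])
qed

text \<open>A weak derivative with a continuous representative is a classical one, end points
  included, because both have the same indefinite integral.\<close>

lemma AC_deriv_has_vector_derivative:
  assumes "AC_deriv f g" "AE x in unit_lebesgue. g x = h x" "continuous_on {0..1} h" "x \<in> {0..1}"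
  shows "(f has_vector_derivative h x) (at x within {0..1})"
proof -
  have "AE y in lebesgue. y \<in> {0<..<1} \<longrightarrow> g y = h y"
    using assms(2) by (subst (asm) AE_restrict_space_iff) auto
  then obtain N where N: "N \<in> null_sets lebesgue" "\<And>y. y \<in> {0<..<1} \<Longrightarrow> g y \<noteq> h y \<Longrightarrow> y \<in> N"
    unfolding eventually_ae_filter by auto
  have "negligible (insert 0 (insert 1 N))"
    using N(1) by (simp add: negligible_iff_null_sets)
  then have "integral {0..y} g = integral {0..y} h" if "y \<in> {0..1}" for y
  proof (rule integral_spike)
    fix z assume "z \<in> {0..y} - insert 0 (insert 1 N)"
    then have "z \<in> {0<..<1}" "z \<notin> N" using that by auto
    then show "h z = g z" using N(2)[of z] by fastforce
  qed
  then have "f y = f 0 + integral {0..y} h" if "y \<in> {0..1}" for y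
    using AC_deriv_integral(2)[OF assms(1) that] that by simp
  moreover have "((\<lambda>y. f 0 + integral {0..y} h) has_vector_derivative h x) (at x within {0..1})"
    using integral_has_vector_derivative[OF assms(3,4)] by (auto intro!: derivative_eq_intros)
  ultimately show ?thesis
    using assms(4) by (metis (no_types, lifting) has_vector_derivative_transform)
qed

text \<open>Classical solutions, with one-sided derivatives at the end points. As the operator is
  \<open>\<i>\<close> times the third derivative, the eigenvalue equation reads f''' = -i mu
  f.\<close>

definition airy_eigenfunction ::
  "real \<Rightarrow> (real \<Rightarrow> complex) \<Rightarrow> (real \<Rightarrow> complex) \<Rightarrow> (real \<Rightarrow> complex) \<Rightarrow> bool" where
  "airy_eigenfunction \<mu> f f1 f2 \<longleftrightarrow>
     (\<forall>x\<in>{0..1}. (f has_vector_derivative f1 x) (at x within {0..1}) \<and>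
        (f1 has_vector_derivative f2 x) (at x within {0..1}) \<and>
        (f2 has_vector_derivative (- \<i> * of_real \<mu> * f x)) (at x within {0..1})) \<and>
     f 0 = 0 \<and> f 1 = 0 \<and> f1 1 = f1 0"

lemma airy_eigenfunction_continuous:
  assumes "airy_eigenfunction \<mu> f f1 f2"
  shows "continuous_on {0..1} f" "continuous_on {0..1} f1" "continuous_on {0..1} f2"
  using assms unfolding airy_eigenfunction_def
  by (auto intro!: continuous_on_vector_derivative)

text \<open>Bootstrapping: \<open>f3\<close> is almost everywhere a multiple of the continuous
  function \<open>f\<close>, so all three weak derivatives have continuous representatives.\<close>

lemma airy_operator_eigenfunction:
  assumes "airy_operator \<phi> (\<lambda>x. of_real \<mu> * \<phi> x)"
  obtains f f1 f2 where "airy_eigenfunction \<mu> f f1 f2" "AE x in unit_lebesgue. \<phi> x = f x"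
proof -
  obtain f f1 f2 f3 where f: "AC_deriv f f1" "AC_deriv f1 f2" "AC_deriv f2 f3"
    "f 0 = 0" "f 1 = 0" "f1 1 = f1 0"
    "AE x in unit_lebesgue. \<phi> x = f x" "AE x in unit_lebesgue. of_real \<mu> * \<phi> x = \<i> * f3 x"
    using assms unfolding airy_operator_def by blast
  have f3: "AE x in unit_lebesgue. f3 x = - \<i> * of_real \<mu> * f x"
    using f(7,8)
  proof eventually_elim
    case (elim x)
    have "- \<i> * (\<i> * f3 x) = - \<i> * of_real \<mu> * f x"
      unfolding elim(2)[symmetric] elim(1) by simp
    then show ?case by (simp flip: mult.assoc)
  qed
  have "continuous_on {0..1} (\<lambda>x. - \<i> * of_real \<mu> * f x)"
    by (intro continuous_intros AC_deriv_continuous[OF f(1)])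
  then have "airy_eigenfunction \<mu> f f1 f2"
    unfolding airy_eigenfunction_def
    using AC_deriv_has_vector_derivative[OF f(1) _ AC_deriv_continuous[OF f(2)]]
      AC_deriv_has_vector_derivative[OF f(2) _ AC_deriv_continuous[OF f(3)]]
      AC_deriv_has_vector_derivative[OF f(3) f3] f(4-6)
    by auto
  then show ?thesis using that f(7) by blast
qed

lemma airy_eigenfunction_symmetric:
  assumes f: "airy_eigenfunction \<mu> f f1 f2" and g: "airy_eigenfunction \<nu> g g1 g2"
  shows "of_real (\<mu> - \<nu>) * L2_inner f g = 0"
proof -
  \<comment> \<open>The boundary form of the third derivative. In its derivative all mixed products
    cancel; the boundary conditions annihilate the outer terms at both ends and give the middle term
    equal values there.\<close>
  define W where "W x = f2 x * cnj (g x) - f1 x * cnj (g1 x) + f x * cnj (g2 x)" for x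
  have "(W has_vector_derivative (- \<i> * of_real (\<mu> - \<nu>) * (f x * cnj (g x)))) (at x within {0..1})"
    if x: "x \<in> {0..1}" for x
  proof -
    note df = f[unfolded airy_eigenfunction_def, THEN conjunct1, rule_format, OF x]
      and dg = g[unfolded airy_eigenfunction_def, THEN conjunct1, rule_format, OF x]
    show ?thesis
      unfolding W_def
      by (rule has_vector_derivative_eq_rhs,
          (rule derivative_intros has_vector_derivative_mult has_vector_derivative_cnj df[THEN conjunct1] dg[THEN conjunct1]
            df[THEN conjunct2, THEN conjunct1] dg[THEN conjunct2, THEN conjunct1]
            df[THEN conjunct2, THEN conjunct2] dg[THEN conjunct2, THEN conjunct2])+)
         (simp add: algebra_simps)
  qed
  then have "(LINT x|unit_lebesgue. - \<i> * of_real (\<mu> - \<nu>) * (f x * cnj (g x))) = W 1 - W 0"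
    using airy_eigenfunction_continuous[OF f] airy_eigenfunction_continuous[OF g]
    by (intro integral_unit_lebesgue_FTC) (auto intro!: continuous_intros)
  moreover have "W 1 = W 0"
    using f g by (simp add: W_def airy_eigenfunction_def)
  ultimately have "- \<i> * of_real (\<mu> - \<nu>) * L2_inner f g = 0"
    unfolding L2_inner_def by (simp only: integral_mult_right_zero) simp
  then show ?thesis by simp
qed

section \<open>Eigenfunctions as combinations of three exponentials\<close>

text \<open>The primitive cube root of unity exp(2 pi i / 3). For z^3 = 1 the function exp(i kappa z
  x) satisfies i f''' = kappa^3 f, so the three cube roots supply the modes of one
  eigenvalue.\<close>

definition omega :: complex where
  "omega = Complex (- 1 / 2) (sqrt 3 / 2)"

lemma omega_mult [simp]: "omega * omega = cnj omega" "cnj omega * cnj omega = omega"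
    "omega * cnj omega = 1" "cnj omega * omega = 1"
  and omega_sum: "1 + omega + cnj omega = 0"
  by (auto simp: omega_def complex_eq_iff)

definition airy_mode :: "real \<Rightarrow> complex \<Rightarrow> real \<Rightarrow> complex" where
  "airy_mode \<kappa> z x = exp (\<i> * of_real \<kappa> * z * of_real x)"

lemma airy_mode_0 [simp]: "airy_mode \<kappa> z 0 = 1"
  by (simp add: airy_mode_def)

lemma has_vector_derivative_airy_mode:
  "(airy_mode \<kappa> z has_vector_derivative \<i> * of_real \<kappa> * z * airy_mode \<kappa> z x) (at x within A)"
  unfolding airy_mode_def by (auto intro!: derivative_eq_intros has_vector_derivative_real_field)

lemma continuous_on_airy_mode [continuous_intros]: "continuous_on A (airy_mode \<kappa> z)"
  unfolding airy_mode_def by (intro continuous_intros)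

text \<open>The coefficients are the cross product of \<open>(1, 1, 1)\<close> and the vector of boundary values of
  the three modes at 1, so that the function vanishes at 0 and 1.\<close>

definition airy_Psi :: "real \<Rightarrow> real \<Rightarrow> complex" where
  "airy_Psi \<kappa> x =
     (airy_mode \<kappa> (cnj omega) 1 - airy_mode \<kappa> omega 1) * airy_mode \<kappa> 1 x +
     (airy_mode \<kappa> 1 1 - airy_mode \<kappa> (cnj omega) 1) * airy_mode \<kappa> omega x +
     (airy_mode \<kappa> omega 1 - airy_mode \<kappa> 1 1) * airy_mode \<kappa> (cnj omega) x"

text \<open>The difference of the derivatives of the above function at 1 and 0, divided by \<open>\<i> \<kappa>\<close>.\<close>

definition airy_Delta :: "real \<Rightarrow> complex" where
  "airy_Delta \<kappa> =
     (airy_mode \<kappa> (cnj omega) 1 - airy_mode \<kappa> omega 1) * (airy_mode \<kappa> 1 1 - 1) +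
     (airy_mode \<kappa> 1 1 - airy_mode \<kappa> (cnj omega) 1) * (omega * (airy_mode \<kappa> omega 1 - 1)) +
     (airy_mode \<kappa> omega 1 - airy_mode \<kappa> 1 1) * (cnj omega * (airy_mode \<kappa> (cnj omega) 1 - 1))"

lemma continuous_on_airy_Psi [continuous_intros]: "continuous_on A (airy_Psi \<kappa>)"
  unfolding airy_Psi_def by (intro continuous_intros)

lemma L2_airy_Psi: "L2 (airy_Psi \<kappa>)"
  by (intro L2_continuous continuous_intros)

text \<open>For \<open>\<kappa> > 0\<close> the mode of 1 oscillates, that of \<open>omega\<close>
  decays from the left end, and that of \<open>cnj omega\<close> grows towards the right
  end.\<close>

lemma norm_airy_mode:
  "norm (airy_mode \<kappa> 1 x) = 1"
  "norm (airy_mode \<kappa> omega x) = exp (- (sqrt 3 / 2 * \<kappa> * x))"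
  "norm (airy_mode \<kappa> (cnj omega) x) = exp (sqrt 3 / 2 * \<kappa> * x)"
  by (simp_all add: airy_mode_def omega_def)

lemma airy_mode_neq:
  assumes "\<kappa> \<noteq> 0"
  shows "airy_mode \<kappa> 1 1 \<noteq> airy_mode \<kappa> (cnj omega) 1"
proof
  assume "airy_mode \<kappa> 1 1 = airy_mode \<kappa> (cnj omega) 1"
  then have "norm (airy_mode \<kappa> 1 1) = norm (airy_mode \<kappa> (cnj omega) 1)" by simp
  then show False using assms by (simp add: norm_airy_mode)
qed

lemma airy_Psi_eigenfunction:
  assumes "airy_Delta \<kappa> = 0"
  shows "\<exists>f1 f2. airy_eigenfunction (\<kappa> ^ 3) (airy_Psi \<kappa>) f1 f2"
proof -
  define c0 c1 c2 where "c0 = airy_mode \<kappa> (cnj omega) 1 - airy_mode \<kappa> omega 1"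
    and "c1 = airy_mode \<kappa> 1 1 - airy_mode \<kappa> (cnj omega) 1"
    and "c2 = airy_mode \<kappa> omega 1 - airy_mode \<kappa> 1 1"
  define r where "r = \<i> * of_real \<kappa>"
  define F where "F a b c x = a * airy_mode \<kappa> 1 x + b * airy_mode \<kappa> omega x + c * airy_mode \<kappa> (cnj omega) x" for a b c x
  have Psi: "airy_Psi \<kappa> = F c0 c1 c2"
    by (simp add: fun_eq_iff airy_Psi_def F_def c0_def c1_def c2_def)
  have dF: "(F a b c has_vector_derivative F (r * a) (r * omega * b) (r * cnj omega * c) x) (at x within A)" for a b c x A
    unfolding F_def r_def
    by (rule has_vector_derivative_eq_rhs,
        (rule has_vector_derivative_add has_vector_derivative_mult_right has_vector_derivative_airy_mode)+)
       (simp add: algebra_simps)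
  have r3: "r * (r * r) = - \<i> * of_real (\<kappa> ^ 3)"
  proof -
    have "r * (r * r) = \<i> * (\<i> * (\<i> * (of_real \<kappa> * of_real \<kappa> * of_real \<kappa>)))"
      unfolding r_def by (simp only: mult_ac)
    then show ?thesis by (simp add: power3_eq_cube)
  qed
  define f1 where "f1 = F (r * c0) (r * omega * c1) (r * cnj omega * c2)"
  define f2 where "f2 = F (r * (r * c0)) (r * omega * (r * omega * c1)) (r * cnj omega * (r * cnj omega * c2))"
  have "F (r * (r * (r * c0))) (r * omega * (r * omega * (r * omega * c1)))
      (r * cnj omega * (r * cnj omega * (r * cnj omega * c2))) x = - \<i> * of_real (\<kappa> ^ 3) * F c0 c1 c2 x" for x
  proof -
    have "r * omega * (r * omega * (r * omega * c1)) = (r * (r * r)) * ((omega * omega) * omega) * c1"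
      "r * cnj omega * (r * cnj omega * (r * cnj omega * c2)) = (r * (r * r)) * ((cnj omega * cnj omega) * cnj omega) * c2"
      "r * (r * (r * c0)) = (r * (r * r)) * c0"
      by (simp_all only: mult_ac)
    then show ?thesis
      unfolding r3 F_def by (simp add: algebra_simps)
  qed
  then have "(f2 has_vector_derivative (- \<i> * of_real (\<kappa> ^ 3) * F c0 c1 c2 x)) (at x within {0..1})" for x
    unfolding f2_def using dF by metis
  moreover have "(F c0 c1 c2 has_vector_derivative f1 x) (at x within {0..1})"
    "(f1 has_vector_derivative f2 x) (at x within {0..1})" for x
    unfolding f1_def f2_def by (rule dF)+
  moreover have "F c0 c1 c2 0 = 0" "F c0 c1 c2 1 = 0"
    by (simp_all add: F_def c0_def c1_def c2_def algebra_simps)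
  moreover have "f1 1 - f1 0 = r * airy_Delta \<kappa>"
    unfolding airy_Delta_def c0_def[symmetric] c1_def[symmetric] c2_def[symmetric]
    by (simp add: f1_def F_def algebra_simps)
  ultimately show ?thesis
    unfolding airy_eigenfunction_def Psi using assms by (intro exI[of _ f1] exI[of _ f2]) auto
qed

lemma ode_exp:
  fixes v :: "real \<Rightarrow> complex"
  assumes v: "\<And>x. x \<in> {0..1} \<Longrightarrow> (v has_vector_derivative r * v x) (at x within {0..1})"
    and x: "x \<in> {0..1}"
  shows "v x = v 0 * exp (r * of_real x)"
proof -
  define w where "w x = v x * exp (- r * of_real x)" for x
  have "(w has_vector_derivative 0) (at x within {0..1})" if "x \<in> {0..1}" for x
    unfolding w_def
    by (rule has_vector_derivative_eq_rhs,
        rule has_vector_derivative_mult[OF v[OF that] has_vector_derivative_real_field])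
       (auto intro!: derivative_eq_intros simp: algebra_simps)
  then obtain c where c: "\<And>y. y \<in> {0..1} \<Longrightarrow> w y = c"
    using has_vector_derivative_zero_constant[of "{0..1}" w] by (auto simp: convex_real_interval)
  have "w x = w 0" using c[OF x] c[of 0] by simp
  then show ?thesis
    by (simp add: w_def exp_minus field_simps)
qed

text \<open>At eigenvalue 0 the three exponentials coincide, so this case stands apart. Solutions
  are quadratic polynomials; the condition on the derivative removes the quadratic part, and the
  values at 1 and 0 remove the rest.\<close>

lemma airy_eigenfunction_zero:
  assumes "airy_eigenfunction 0 f f1 f2" "x \<in> {0..1}"
  shows "f x = 0"
proof -
  have f: "\<And>x. x \<in> {0..1} \<Longrightarrow> (f has_vector_derivative f1 x) (at x within {0..1})"
    "\<And>x. x \<in> {0..1} \<Longrightarrow> (f1 has_vector_derivative f2 x) (at x within {0..1})"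
    "\<And>x. x \<in> {0..1} \<Longrightarrow> (f2 has_vector_derivative 0 * f2 x) (at x within {0..1})"
    "f 0 = 0" "f 1 = 0" "f1 1 = f1 0"
    using assms(1) by (auto simp: airy_eigenfunction_def)
  have f2: "f2 x = f2 0" if "x \<in> {0..1}" for x
    using ode_exp[OF f(3) that] by simp
  have d1: "((\<lambda>x. f1 x - f2 0 * of_real x) has_vector_derivative 0 * (f1 x - f2 0 * of_real x)) (at x within {0..1})"
    if "x \<in> {0..1}" for x
    using f(2)[OF that] f2[OF that] by (auto intro!: derivative_eq_intros)
  have f1': "f1 x = f1 0 + f2 0 * of_real x" if "x \<in> {0..1}" for x
    using ode_exp[OF d1 that] by (simp add: diff_eq_eq)
  have "f2 0 = 0" using f1'[of 1] f(6) by simp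
  then have f1: "f1 x = f1 0" if "x \<in> {0..1}" for x using f1'[OF that] by simp
  have d: "((\<lambda>x. f x - f1 0 * of_real x) has_vector_derivative 0 * (f x - f1 0 * of_real x)) (at x within {0..1})"
    if "x \<in> {0..1}" for x
    using f(1)[OF that] f1[OF that] by (auto intro!: derivative_eq_intros)
  have f': "f x = f1 0 * of_real x" if "x \<in> {0..1}" for x
    using ode_exp[OF d that] f(4) by (simp add: diff_eq_eq)
  have "f1 0 = 0" using f'[of 1] f(5) by simp
  then show ?thesis using f'[OF assms(2)] by simp
qed

text \<open>Simplicity of the eigenvalues. Every eigenfunction is a combination of the three modes;
  vanishing at 0 and 1 makes its coefficient vector a multiple of the cross product in
  \<open>airy_Psi\<close>, and the third condition then becomes the factor
  \<open>airy_Delta\<close>.\<close>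

lemma airy_eigenfunction_eq_Psi:
  assumes eig: "airy_eigenfunction (\<kappa> ^ 3) f f1 f2" and \<kappa>: "\<kappa> \<noteq> 0"
  shows "\<exists>c. (\<forall>x\<in>{0..1}. f x = c * airy_Psi \<kappa> x) \<and> c * airy_Delta \<kappa> = 0"
proof -
  define r where "r = \<i> * of_real \<kappa>"
  have "r * r * r = \<i> * (\<i> * (\<i> * (of_real \<kappa> * of_real \<kappa> * of_real \<kappa>)))"
    unfolding r_def by (simp only: mult_ac)
  then have r: "r \<noteq> 0" "- \<i> * of_real (\<kappa> ^ 3) = r * r * r"
    using \<kappa> by (simp_all add: r_def power3_eq_cube)
  \<comment> \<open>With D the derivative and z^3 = 1, D^3 - r^3 = (D - r z)(D^2 + r z D + (r z)^2).
    \<open>v z\<close> is the second factor applied to \<open>f\<close>, so it solves a first-order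
    equation.\<close>
  define v where "v z x = f2 x + r * z * f1 x + r * z * (r * z) * f x" for z x
  have v: "v z x = v z 0 * airy_mode \<kappa> z x" if z: "z * z * z = 1" and x: "x \<in> {0..1}" for z x
  proof -
    have "(v z has_vector_derivative r * z * v z y) (at y within {0..1})" if y: "y \<in> {0..1}" for y
    proof -
      note d = eig[unfolded airy_eigenfunction_def, THEN conjunct1, rule_format, OF y]
      have "(v z has_vector_derivative (- \<i> * of_real (\<kappa> ^ 3) * f y) + r * z * f2 y + r * z * (r * z) * f1 y) (at y within {0..1})"
        unfolding v_def
        by (intro derivative_intros d[THEN conjunct1] d[THEN conjunct2, THEN conjunct1] d[THEN conjunct2, THEN conjunct2])
      moreover have "r * z * (r * z * (r * z)) = r * r * r * (z * z * z)"
        by (simp only: mult_ac)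
      then have "(- \<i> * of_real (\<kappa> ^ 3) * f y) + r * z * f2 y + r * z * (r * z) * f1 y = r * z * v z y"
        unfolding r(2) v_def using z by (simp add: algebra_simps)
      ultimately show ?thesis by simp
    qed
    from ode_exp[OF this x] show ?thesis
      by (simp add: airy_mode_def r_def)
  qed
  \<comment> \<open>Summing \<open>v z\<close> over the three roots with weight z isolates
    \<open>f\<close>, and with weight z^2 it isolates \<open>f1\<close>: the sums of the other
    powers vanish.\<close>
  define a0 a1 a2 where "a0 = v 1 0 / (3 * r * r)" and "a1 = omega * v omega 0 / (3 * r * r)"
    and "a2 = cnj omega * v (cnj omega) 0 / (3 * r * r)"
  let ?E = "airy_mode \<kappa>"
  have cube: "omega * omega * omega = 1" "cnj omega * cnj omega * cnj omega = 1" by simp_all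
  have f: "f x = a0 * ?E 1 x + a1 * ?E omega x + a2 * ?E (cnj omega) x" if x: "x \<in> {0..1}" for x
  proof -
    have "v 1 x + omega * v omega x + cnj omega * v (cnj omega) x =
      f2 x * (1 + omega + cnj omega) + r * f1 x * (1 + omega * omega + cnj omega * cnj omega)
      + r * r * f x * (1 + omega * omega * omega + cnj omega * cnj omega * cnj omega)"
      unfolding v_def by algebra
    also have "\<dots> = 3 * r * r * f x"
      using omega_sum unfolding cube by (simp add: add.commute add.left_commute)
    finally have "f x = (v 1 x + omega * v omega x + cnj omega * v (cnj omega) x) / (3 * r * r)"
      using r by simp
    then show ?thesis
      using v[OF _ x, of 1] v[OF cube(1) x] v[OF cube(2) x]
      by (simp add: a0_def a1_def a2_def add_divide_distrib mult.assoc)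
  qed
  have f1: "f1 x = r * (a0 * ?E 1 x + a1 * omega * ?E omega x + a2 * cnj omega * ?E (cnj omega) x)" if x: "x \<in> {0..1}" for x
  proof -
    have "v 1 x + omega * omega * v omega x + cnj omega * cnj omega * v (cnj omega) x =
      f2 x * (1 + omega * omega + cnj omega * cnj omega)
      + r * f1 x * (1 + omega * omega * omega + cnj omega * cnj omega * cnj omega)
      + r * r * f x * (1 + omega * omega * omega * omega + cnj omega * cnj omega * cnj omega * cnj omega)"
      unfolding v_def by algebra
    also have "\<dots> = 3 * r * f1 x"
      using omega_sum unfolding cube by (simp add: add.commute add.left_commute)
    finally have "f1 x = r * ((v 1 x + omega * omega * v omega x + cnj omega * cnj omega * v (cnj omega) x) / (3 * r * r))"
      using r by simp
    moreover have "a1 * omega = (omega * omega) * v omega 0 / (3 * r * r)"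
      "a2 * cnj omega = (cnj omega * cnj omega) * v (cnj omega) 0 / (3 * r * r)"
      unfolding a1_def a2_def by (simp_all del: omega_mult add: mult_ac)
    then have "a1 * omega = cnj omega * v omega 0 / (3 * r * r)"
      "a2 * cnj omega = omega * v (cnj omega) 0 / (3 * r * r)"
      by simp_all
    ultimately show ?thesis
      using v[OF _ x, of 1] v[OF cube(1) x] v[OF cube(2) x]
      by (simp add: a0_def add_divide_distrib mult.assoc)
  qed
  have s0: "a0 + a1 + a2 = 0" using f[of 0] eig by (simp add: airy_eigenfunction_def)
  have s1: "a0 * ?E 1 1 + a1 * ?E omega 1 + a2 * ?E (cnj omega) 1 = 0"
    using f[of 1] eig by (simp add: airy_eigenfunction_def)
  have s2: "a0 * (?E 1 1 - 1) + a1 * (omega * (?E omega 1 - 1)) + a2 * (cnj omega * (?E (cnj omega) 1 - 1)) = 0"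
  proof -
    have "f1 1 - f1 0 = r * (a0 * (?E 1 1 - 1) + a1 * (omega * (?E omega 1 - 1)) + a2 * (cnj omega * (?E (cnj omega) 1 - 1)))"
      using f1[of 0] f1[of 1] by (simp add: algebra_simps)
    then show ?thesis using r eig by (simp add: airy_eigenfunction_def)
  qed
  \<comment> \<open>The multiple is read off the second component, whose entry in the cross product
    is nonzero because two of the modes differ in modulus at 1.\<close>
  define s where "s = a1 / (?E 1 1 - ?E (cnj omega) 1)"
  have ne: "?E 1 1 - ?E (cnj omega) 1 \<noteq> 0" using airy_mode_neq[OF \<kappa>] by simp
  have a1: "a1 = s * (?E 1 1 - ?E (cnj omega) 1)" using ne by (simp add: s_def)
  have "a2 * (?E (cnj omega) 1 - ?E 1 1) = - a1 * (?E omega 1 - ?E 1 1)"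
    using s0 s1 by algebra
  also have "\<dots> = s * (?E omega 1 - ?E 1 1) * (?E (cnj omega) 1 - ?E 1 1)"
    unfolding a1 by (simp add: algebra_simps)
  finally have a2: "a2 = s * (?E omega 1 - ?E 1 1)" using ne by auto
  have a0: "a0 = s * (?E (cnj omega) 1 - ?E omega 1)"
    using s0 a1 a2 by (simp add: algebra_simps add_eq_0_iff2 eq_neg_iff_add_eq_0)
  have "f x = s * airy_Psi \<kappa> x" if "x \<in> {0..1}" for x
    using f[OF that] unfolding airy_Psi_def a0 a1 a2 by (simp add: algebra_simps)
  moreover have "s * airy_Delta \<kappa> = 0"
    using s2 unfolding airy_Delta_def a0 a1 a2 by (simp add: algebra_simps)
  ultimately show ?thesis by blast
qed

section \<open>Eigenfunction expansion\<close>

text \<open>The projection onto the line of \<open>airy_Psi \<kappa>\<close>, times the time factor.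
  Division by the squared norm makes it independent of scaling, hence comparable with a basis of
  unknown phases.\<close>

definition airy_term :: "(real \<Rightarrow> complex) \<Rightarrow> real \<Rightarrow> real \<Rightarrow> real \<Rightarrow> complex" where
  "airy_term f t \<kappa> x =
     exp (\<i> * of_real (\<kappa> ^ 3 * t)) * (L2_inner f (airy_Psi \<kappa>) / of_real (norm2 (airy_Psi \<kappa>))) * airy_Psi \<kappa> x"

lemma continuous_on_airy_term [continuous_intros]: "continuous_on A (airy_term f t \<kappa>)"
  unfolding airy_term_def by (intro continuous_intros)

lemma L2_airy_term: "L2 (airy_term f t \<kappa>)"
  by (intro L2_continuous continuous_intros)

text \<open>The unit norm excludes the zero function and with it the eigenvalue 0. It also fixes the
  modulus of the scaling factor, which is all that the projection depends on.\<close>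

lemma airy_eigenpair_normal_form:
  assumes A: "airy_operator \<phi> (\<lambda>x. of_real \<mu> * \<phi> x)" and "L2 \<phi>" "norm2 \<phi> = 1"
  obtains \<kappa> c where "\<kappa> \<noteq> 0" "\<mu> = \<kappa> ^ 3" "airy_Delta \<kappa> = 0"
    "AE x in unit_lebesgue. \<phi> x = c * airy_Psi \<kappa> x"
    "(norm c)\<^sup>2 * norm2 (airy_Psi \<kappa>) = 1"
proof -
  obtain f f1 f2 where f: "airy_eigenfunction \<mu> f f1 f2" "AE x in unit_lebesgue. \<phi> x = f x"
    by (rule airy_operator_eigenfunction[OF A])
  have n: "norm2 f = 1"
    using norm2_cong_AE[OF L2_measurable[OF \<open>L2 \<phi>\<close>] _ f(2)] \<open>norm2 \<phi> = 1\<close>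
      measurable_unit_lebesgue_continuous[OF airy_eigenfunction_continuous(1)[OF f(1)]] by simp
  define \<kappa> where "\<kappa> = root 3 \<mu>"
  have \<mu>: "\<mu> = \<kappa> ^ 3"
    unfolding \<kappa>_def by (rule odd_real_root_pow[symmetric]) simp
  have "\<kappa> \<noteq> 0"
  proof
    assume "\<kappa> = 0"
    then have "airy_eigenfunction 0 f f1 f2" using f(1) \<mu> by simp
    then have "f x = 0" if "x \<in> {0..1}" for x
      using airy_eigenfunction_zero that by blast
    then have "norm2 f = norm2 (\<lambda>_. 0 :: complex)"
      unfolding norm2_def by (intro Bochner_Integration.integral_cong) auto
    with n show False by (simp add: norm2_def)
  qed
  moreover obtain c where c: "\<And>x. x \<in> {0..1} \<Longrightarrow> f x = c * airy_Psi \<kappa> x" "c * airy_Delta \<kappa> = 0"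
    using airy_eigenfunction_eq_Psi[OF f(1)[unfolded \<mu>] \<open>\<kappa> \<noteq> 0\<close>] by blast
  moreover have c_norm: "(norm c)\<^sup>2 * norm2 (airy_Psi \<kappa>) = 1"
  proof -
    have "norm2 f = norm2 (\<lambda>x. c * airy_Psi \<kappa> x)"
      unfolding norm2_def using c(1) by (intro Bochner_Integration.integral_cong) auto
    then show ?thesis using n by (simp add: norm2_scale)
  qed
  moreover have "c \<noteq> 0" using c_norm by auto
  moreover have "AE x in unit_lebesgue. \<phi> x = c * airy_Psi \<kappa> x"
    using f(2) AE_space by eventually_elim (simp add: c(1))
  ultimately show ?thesis using that \<mu> by auto
qed

text \<open>\<open>K\<close> collects the wave numbers of the given basis. A root outside it would
  have an eigenfunction orthogonal to a complete system. Any exhausting family of finite sets may be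
  used for summation, since the squared error is \<open>norm2 g\<close> minus a sum of nonnegative
  terms.\<close>

lemma airy_expansion:
  assumes exp: "exp_itA airy_operator t f g" and f: "L2 f"
  shows "\<exists>K. (\<forall>\<kappa>\<in>K. \<kappa> \<noteq> 0 \<and> airy_Delta \<kappa> = 0) \<and>
    (\<forall>\<kappa>. \<kappa> \<noteq> 0 \<longrightarrow> airy_Delta \<kappa> = 0 \<longrightarrow> norm2 (airy_Psi \<kappa>) \<noteq> 0 \<longrightarrow> \<kappa> \<in> K) \<and>
    (\<forall>A. (\<forall>N. finite (A N) \<and> A N \<subseteq> K) \<longrightarrow> (\<forall>\<kappa>\<in>K. \<forall>\<^sub>F N in sequentially. \<kappa> \<in> A N) \<longrightarrow>
       (\<lambda>N. norm2 (\<lambda>x. (\<Sum>\<kappa>\<in>A N. airy_term f t \<kappa> x) - g x)) \<longlonglongrightarrow> 0) \<and> L2 g"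
proof -
  obtain \<phi> \<mu> where B: "orthonormal_eigenbasis airy_operator \<phi> \<mu>"
    and g: "L2_sums (\<lambda>n x. exp (\<i> * of_real (\<mu> n * t)) * L2_inner f (\<phi> n) * \<phi> n x) g"
    using exp unfolding exp_itA_def by blast
  have ortho: "orthonormal_L2 \<phi>"
    using B unfolding orthonormal_eigenbasis_def orthonormal_L2_def by blast
  have \<phi>L2: "L2 (\<phi> n)" for n
    using ortho by (simp add: orthonormal_L2_def)
  have gL2: "L2 g" using g by (simp add: L2_sums_iff)
  have n1: "norm2 (\<phi> n) = 1" for n
  proof -
    have "complex_of_real (norm2 (\<phi> n)) = 1"
      using ortho by (simp only: L2_inner_self[symmetric] orthonormal_L2_def) simp
    then show ?thesis by simp
  qed
  define Q where "Q n \<kappa> c \<longleftrightarrow> \<kappa> \<noteq> 0 \<and> \<mu> n = \<kappa> ^ 3 \<and> airy_Delta \<kappa> = 0 \<and>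
    (AE x in unit_lebesgue. \<phi> n x = c * airy_Psi \<kappa> x) \<and> (norm c)\<^sup>2 * norm2 (airy_Psi \<kappa>) = 1" for n \<kappa> c
  have "\<exists>\<kappa> c. Q n \<kappa> c" for n
  proof -
    have "airy_operator (\<phi> n) (\<lambda>x. of_real (\<mu> n) * \<phi> n x)"
      using B unfolding orthonormal_eigenbasis_def by blast
    then show ?thesis
      by (rule airy_eigenpair_normal_form[OF _ \<phi>L2 n1]) (auto simp: Q_def)
  qed
  then obtain k c where "Q n (k n) (c n)" for n
    by metis
  then have k: "\<And>n. k n \<noteq> 0" "\<And>n. \<mu> n = k n ^ 3" "\<And>n. airy_Delta (k n) = 0"
    and c: "\<And>n. AE x in unit_lebesgue. \<phi> n x = c n * airy_Psi (k n) x"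
    "\<And>n. (norm (c n))\<^sup>2 * norm2 (airy_Psi (k n)) = 1"
    unfolding Q_def by blast+
  have inner: "L2_inner h (\<phi> n) = cnj (c n) * L2_inner h (airy_Psi (k n))" if "L2 h" for h n
  proof -
    have "L2_inner h (\<phi> n) = L2_inner h (\<lambda>x. c n * airy_Psi (k n) x)"
      using c(1)[of n] by (intro L2_inner_cong_AE that \<phi>L2 L2_measurable[OF that]
          L2_measurable[OF L2_scale[OF L2_airy_Psi]]) auto
    then show ?thesis by (simp add: L2_inner_scale_right)
  qed
  define a where "a n = exp (\<i> * of_real (\<mu> n * t)) * L2_inner f (\<phi> n)" for n
  have a: "L2_inner g (\<phi> n) = a n" for n
    by (rule L2_sums_orthonormal_inner[OF ortho g[folded a_def]])
  have term_eq: "AE x in unit_lebesgue. a n * \<phi> n x = airy_term f t (k n) x" for n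
    using c(1)[of n]
  proof eventually_elim
    case (elim x)
    have "norm2 (airy_Psi (k n)) \<noteq> 0" using c(2)[of n] by auto
    then have "cnj (c n) * c n = 1 / of_real (norm2 (airy_Psi (k n)))"
      using c(2)[of n] by (simp add: complex_norm_square[symmetric] mult.commute[of "cnj _"] field_simps
          flip: of_real_mult of_real_power)
    then have cc: "cnj (c n) * (c n * y) = y / of_real (norm2 (airy_Psi (k n)))" for y
      by (simp flip: mult.assoc)
    have "X * (cnj (c n) * Y) * (c n * Z) = X * Y * (cnj (c n) * (c n * Z))" for X Y Z
      by (simp only: mult_ac)
    then show ?case
      unfolding airy_term_def a_def elim inner[OF f] k(2) cc by simp
  qed
  \<comment> \<open>Equal wave numbers would make two basis functions proportional, against
    orthogonality; so a sum over wave numbers counts each basis function once.\<close>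
  have inj: "inj k"
  proof (rule injI)
    fix m n assume "k m = k n"
    have "L2_inner (\<phi> m) (\<phi> n) = c m * cnj (c n) * of_real (norm2 (airy_Psi (k n)))"
    proof -
      have "L2_inner (\<phi> m) (\<phi> n) = cnj (c n) * cnj (L2_inner (airy_Psi (k n)) (\<phi> m))"
        by (simp add: inner \<phi>L2 flip: L2_inner_commute)
      also have "L2_inner (airy_Psi (k n)) (\<phi> m) = cnj (c m) * of_real (norm2 (airy_Psi (k n)))"
        using \<open>k m = k n\<close> by (simp add: inner L2_airy_Psi L2_inner_self)
      finally show ?thesis by simp
    qed
    moreover have "c m \<noteq> 0" "c n \<noteq> 0" "norm2 (airy_Psi (k n)) \<noteq> 0"
      using c(2)[of m] c(2)[of n] by auto
    ultimately have "L2_inner (\<phi> m) (\<phi> n) \<noteq> 0" by simp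
    then show "m = n"
      using ortho unfolding orthonormal_L2_def by metis
  qed
  show ?thesis
  proof (intro exI[of _ "range k"] conjI allI impI ballI)
    show "\<kappa> \<noteq> 0" "airy_Delta \<kappa> = 0" if "\<kappa> \<in> range k" for \<kappa>
      using k that by auto
    show "\<kappa> \<in> range k" if \<kappa>: "\<kappa> \<noteq> 0" "airy_Delta \<kappa> = 0" "norm2 (airy_Psi \<kappa>) \<noteq> 0" for \<kappa>
    proof (rule ccontr)
      assume nr: "\<kappa> \<notin> range k"
      have "L2_inner (airy_Psi \<kappa>) (\<phi> n) = 0" for n
      proof -
        obtain f1 f2 g1 g2 where "airy_eigenfunction (\<kappa> ^ 3) (airy_Psi \<kappa>) f1 f2"
          "airy_eigenfunction (k n ^ 3) (airy_Psi (k n)) g1 g2"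
          using airy_Psi_eigenfunction \<kappa>(2) k(3) by metis
        from airy_eigenfunction_symmetric[OF this]
        have "of_real (\<kappa> ^ 3 - k n ^ 3) * L2_inner (airy_Psi \<kappa>) (airy_Psi (k n)) = 0" .
        moreover have "\<kappa> ^ 3 \<noteq> k n ^ 3"
          using nr odd_real_root_power_cancel[of 3 \<kappa>] odd_real_root_power_cancel[of 3 "k n"]
          by (metis numeral_3_eq_3 odd_numeral rangeI)
        then have "complex_of_real (\<kappa> ^ 3 - k n ^ 3) \<noteq> 0"
          unfolding of_real_eq_0_iff by simp
        ultimately have "L2_inner (airy_Psi \<kappa>) (airy_Psi (k n)) = 0"
          using mult_eq_0_iff by blast
        then show ?thesis
          by (simp add: inner L2_airy_Psi)
      qed
      then have "AE x in unit_lebesgue. airy_Psi \<kappa> x = 0"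
        using B L2_airy_Psi unfolding orthonormal_eigenbasis_def by blast
      then have "norm2 (airy_Psi \<kappa>) = norm2 (\<lambda>_. 0 :: complex)"
        by (intro norm2_cong_AE L2_measurable[OF L2_airy_Psi]) auto
      with \<kappa>(3) show False by (simp add: norm2_def)
    qed
    show "L2 g" by (rule gL2)
    fix A :: "nat \<Rightarrow> real set"
    assume "\<forall>N. finite (A N) \<and> A N \<subseteq> range k"
      and "\<forall>\<kappa>\<in>range k. \<forall>\<^sub>F N in sequentially. \<kappa> \<in> A N"
    then have A: "finite (A N) \<and> A N \<subseteq> range k"
      and ev: "\<kappa> \<in> range k \<Longrightarrow> \<forall>\<^sub>F N in sequentially. \<kappa> \<in> A N" for N \<kappa>
      by blast+
    define I where "I N = k -` A N" for N
    have fin: "finite (I N)" for N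
      unfolding I_def using A inj by (intro finite_vimageI) auto
    have "A N = k ` I N" for N
      using A[of N] by (auto simp: I_def)
    then have sum_A: "(\<Sum>\<kappa>\<in>A N. airy_term f t \<kappa> x) = (\<Sum>n\<in>I N. airy_term f t (k n) x)" for N x
      using inj by (simp add: sum.reindex inj_on_subset)
    have eq: "norm2 (\<lambda>x. (\<Sum>\<kappa>\<in>A N. airy_term f t \<kappa> x) - g x) = norm2 g - (\<Sum>n\<in>I N. (norm (a n))\<^sup>2)" for N
    proof -
      have "AE x in unit_lebesgue. \<forall>n\<in>I N. a n * \<phi> n x = airy_term f t (k n) x"
        using term_eq by (intro AE_finite_allI fin)
      then have "AE x in unit_lebesgue. (\<Sum>\<kappa>\<in>A N. airy_term f t \<kappa> x) - g x = - (g x - (\<Sum>n\<in>I N. a n * \<phi> n x))"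
        by eventually_elim (simp add: sum_A)
      then have "norm2 (\<lambda>x. (\<Sum>\<kappa>\<in>A N. airy_term f t \<kappa> x) - g x) = norm2 (\<lambda>x. - (g x - (\<Sum>n\<in>I N. a n * \<phi> n x)))"
        by (intro norm2_cong_AE L2_measurable L2_minus L2_diff L2_sum L2_airy_term gL2 L2_scale \<phi>L2)
      then show ?thesis
        using Bessel_identity[OF ortho fin gL2] by (simp only: a norm2_minus)
    qed
    have eq': "norm2 (\<lambda>x. (\<Sum>n<N. a n * \<phi> n x) - g x) = norm2 g - (\<Sum>n<N. (norm (a n))\<^sup>2)" for N
    proof -
      have "norm2 (\<lambda>x. (\<Sum>n<N. a n * \<phi> n x) - g x) = norm2 (\<lambda>x. - (g x - (\<Sum>n<N. a n * \<phi> n x)))"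
        by simp
      then show ?thesis
        using Bessel_identity[OF ortho _ gL2, of "{..<N}"] by (simp only: a norm2_minus finite_lessThan)
    qed
    have lim: "(\<lambda>N. norm2 g - (\<Sum>n<N. (norm (a n))\<^sup>2)) \<longlonglongrightarrow> 0"
      using g unfolding L2_sums_iff a_def[symmetric] eq' by blast
    show "(\<lambda>N. norm2 (\<lambda>x. (\<Sum>\<kappa>\<in>A N. airy_term f t \<kappa> x) - g x)) \<longlonglongrightarrow> 0"
    proof (rule order_tendstoI)
      fix e :: real assume "e < 0"
      then show "\<forall>\<^sub>F N in sequentially. e < norm2 (\<lambda>x. (\<Sum>\<kappa>\<in>A N. airy_term f t \<kappa> x) - g x)"
        using norm2_nonneg less_le_trans by (intro always_eventually allI) blast
    next
      fix e :: real assume "0 < e"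
      then have "\<forall>\<^sub>F N in sequentially. norm2 g - (\<Sum>n<N. (norm (a n))\<^sup>2) < e"
        using order_tendstoD(2)[OF lim] by blast
      then obtain M where M: "norm2 g - (\<Sum>n<M. (norm (a n))\<^sup>2) < e"
        by (auto simp: eventually_sequentially)
      \<comment> \<open>Once \<open>A N\<close> contains the first \<open>M\<close> wave numbers the
        error is below \<open>e\<close>, whatever else it contains.\<close>
      have "\<forall>\<^sub>F N in sequentially. \<forall>n\<in>{..<M}. k n \<in> A N"
        using ev by (intro eventually_ball_finite) auto
      then show "\<forall>\<^sub>F N in sequentially. norm2 (\<lambda>x. (\<Sum>\<kappa>\<in>A N. airy_term f t \<kappa> x) - g x) < e"
      proof eventually_elim
        case (elim N)
        then have "(\<Sum>n<M. (norm (a n))\<^sup>2) \<le> (\<Sum>n\<in>I N. (norm (a n))\<^sup>2)"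
          by (intro sum_mono2 fin) (auto simp: I_def)
        with M show ?case unfolding eq by linarith
      qed
    qed
  qed
qed

section \<open>Eigenvalues\<close>

lemma airy_mode_cis:
  "airy_mode \<kappa> 1 1 = cis \<kappa>"
  "airy_mode \<kappa> omega 1 = exp (- (sqrt 3 / 2 * \<kappa>)) *\<^sub>R cis (- (\<kappa> / 2))"
  "airy_mode \<kappa> (cnj omega) 1 = exp (sqrt 3 / 2 * \<kappa>) *\<^sub>R cis (- (\<kappa> / 2))"
  by (simp_all add: airy_mode_def omega_def exp_eq_polar scaleR_conv_of_real)

text \<open>\<open>airy_Delta\<close> without its factor of constant argument and exponential size:
  a real function with leading term 2 cos(kappa/2 - pi/3) for large positive kappa. The zeros of
  this cosine are the numbers (2n - 1/3) pi, the origin of \<open>airy_freq\<close>.\<close>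

definition airy_char :: "real \<Rightarrow> real" where
  "airy_char \<kappa> = 2 * cos (\<kappa> / 2 - pi / 3)
     + 2 * exp (- (sqrt 3 * \<kappa>)) * cos (\<kappa> / 2 + pi / 3) - 2 * exp (- (sqrt 3 / 2 * \<kappa>)) * cos \<kappa>"

lemma airy_Delta_eq: "airy_Delta \<kappa> = \<i> * of_real (sqrt 3 * exp (sqrt 3 / 2 * \<kappa>) * airy_char \<kappa>)"
proof -
  define c d S T where "c = cos (\<kappa> / 2)" and "d = sin (\<kappa> / 2)"
    and "S = exp (sqrt 3 / 2 * \<kappa>)" and "T = exp (- (sqrt 3 / 2 * \<kappa>))"
  have ST: "S * T = 1"
    by (simp add: S_def T_def exp_minus)
  have cd: "c * c + d * d = 1"
    using sin_cos_squared_add3[of "\<kappa> / 2"] by (simp add: c_def d_def power2_eq_square)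
  have E0: "airy_mode \<kappa> 1 1 = Complex (c * c - d * d) (2 * c * d)"
    using cos_double[of "\<kappa> / 2"] sin_double[of "\<kappa> / 2"]
    by (simp add: airy_mode_cis complex_eq_iff c_def d_def power2_eq_square)
  have E1: "airy_mode \<kappa> omega 1 = Complex (T * c) (- (T * d))"
    and E2: "airy_mode \<kappa> (cnj omega) 1 = Complex (S * c) (- (S * d))"
    by (simp_all add: airy_mode_cis complex_eq_iff c_def d_def S_def T_def)
  have "exp (- (sqrt 3 * \<kappa>)) = T * T"
    by (simp add: T_def flip: exp_add)
  moreover have "2 * cos (\<kappa> / 2 - pi / 3) = c + sqrt 3 * d" "2 * cos (\<kappa> / 2 + pi / 3) = c - sqrt 3 * d"
    by (simp_all add: cos_diff cos_add c_def d_def cos_60 sin_60)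
  moreover have "cos \<kappa> = c * c - d * d"
    using cos_double[of "\<kappa> / 2"] by (simp add: c_def d_def power2_eq_square)
  moreover have "airy_char \<kappa> = 2 * cos (\<kappa> / 2 - pi / 3) + exp (- (sqrt 3 * \<kappa>)) * (2 * cos (\<kappa> / 2 + pi / 3)) - 2 * T * cos \<kappa>"
    by (simp add: airy_char_def T_def)
  ultimately have ch: "airy_char \<kappa> = (c + sqrt 3 * d) + T * T * (c - sqrt 3 * d) - 2 * T * (c * c - d * d)"
    by simp
  have "S * airy_char \<kappa> = S * (c + sqrt 3 * d) + (S * T) * T * (c - sqrt 3 * d) - 2 * (S * T) * (c * c - d * d)"
    unfolding ch by (simp add: algebra_simps)
  then have "S * airy_char \<kappa> = S * (c + sqrt 3 * d) + T * (c - sqrt 3 * d) - 2 * (c * c - d * d)"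
    unfolding ST by simp
  moreover define r where "r = sqrt 3"
  ultimately have h: "S * airy_char \<kappa> = S * (c + r * d) + T * (c - r * d) - 2 * (c * c - d * d)"
    by simp
  \<comment> \<open>\<open>u\<close> is exp(-i kappa/2). In terms of it the three boundary values
    are \<open>cnj u * cnj u\<close>, \<open>T * u\<close> and \<open>S * u\<close>, and the
    expansion collapses by \<open>u * cnj u = 1\<close> and \<open>S * T = 1\<close>.\<close>
  define u where "u = Complex c (- d)"
  have u: "u * cnj u = 1" "u * u = Complex (c * c - d * d) (- 2 * c * d)"
    using cd by (simp_all add: u_def complex_eq_iff)
  have E: "airy_mode \<kappa> 1 1 = cnj u * cnj u" "airy_mode \<kappa> omega 1 = of_real T * u"
    "airy_mode \<kappa> (cnj omega) 1 = of_real S * u"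
    unfolding E0 E1 E2 by (simp_all add: u_def complex_eq_iff)
  have "airy_Delta \<kappa> = (1 - cnj omega) * (of_real T * u + of_real S * (u * cnj u) * cnj u)
      + (omega - 1) * (of_real S * u + of_real T * (u * cnj u) * cnj u)
      + (cnj omega - omega) * (cnj u * cnj u + of_real (S * T) * (u * u))"
    unfolding airy_Delta_def E by (simp add: algebra_simps)
  also have "\<dots> = (1 - cnj omega) * (of_real T * u + of_real S * cnj u)
      + (omega - 1) * (of_real S * u + of_real T * cnj u)
      + (cnj omega - omega) * of_real (2 * (c * c - d * d))"
    unfolding u(1) ST using u(2) by (simp add: complex_eq_iff)
  also have "\<dots> = \<i> * of_real (r * (S * airy_char \<kappa>))"
    unfolding h by (simp add: complex_eq_iff u_def omega_def r_def field_simps)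
  finally show ?thesis
    by (simp add: r_def S_def mult.assoc)
qed

lemma airy_Delta_eq_0_iff: "airy_Delta \<kappa> = 0 \<longleftrightarrow> airy_char \<kappa> = 0"
  by (simp add: airy_Delta_eq)

lemma airy_mode_minus:
  "airy_mode (- \<kappa>) 1 x = cnj (airy_mode \<kappa> 1 x)"
  "airy_mode (- \<kappa>) omega x = cnj (airy_mode \<kappa> (cnj omega) x)"
  "airy_mode (- \<kappa>) (cnj omega) x = cnj (airy_mode \<kappa> omega x)"
  by (simp_all add: airy_mode_def exp_cnj)

lemma airy_Delta_minus: "airy_Delta (- \<kappa>) = - cnj (airy_Delta \<kappa>)"
  unfolding airy_Delta_def airy_mode_minus by (simp add: algebra_simps)

lemma airy_Psi_minus: "airy_Psi (- \<kappa>) x = - cnj (airy_Psi \<kappa> x)"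
  unfolding airy_Psi_def airy_mode_minus by (simp add: algebra_simps)

text \<open>A sign change of \<open>\<kappa>\<close> conjugates the modes and exchanges decay with
  growth. For real data the terms of \<open>\<kappa>\<close> and \<open>- \<kappa>\<close> thus add
  up to twice a real part, the shape of \<open>UR_term\<close>.\<close>

lemma airy_term_minus:
  assumes "\<And>x. cnj (f x) = f x"
  shows "airy_term f t (- \<kappa>) x = cnj (airy_term f t \<kappa> x)"
proof -
  have "L2_inner f (airy_Psi (- \<kappa>)) = - cnj (L2_inner f (airy_Psi \<kappa>))"
    unfolding L2_inner_def airy_Psi_minus
    by (subst Bochner_Integration.integral_cnj[symmetric]) (simp add: assms)
  moreover have "norm2 (airy_Psi (- \<kappa>)) = norm2 (airy_Psi \<kappa>)"
    by (simp add: norm2_def airy_Psi_minus)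
  ultimately show ?thesis
    unfolding airy_term_def airy_Psi_minus by (simp add: exp_cnj)
qed

section \<open>Location of the large roots\<close>

lemma airy_char_near:
  "airy_char (airy_freq n + \<eta>) = 2 * (- 1) ^ n * sin (\<eta> / 2)
     + 2 * exp (- (sqrt 3 * (airy_freq n + \<eta>))) * cos ((airy_freq n + \<eta>) / 2 + pi / 3)
     - 2 * exp (- (sqrt 3 / 2 * (airy_freq n + \<eta>))) * cos (airy_freq n + \<eta>)"
proof -
  have "(airy_freq n + \<eta>) / 2 - pi / 3 = (\<eta> / 2 - pi / 2) + real n * pi"
    by (simp add: airy_freq_def field_simps)
  then have "cos ((airy_freq n + \<eta>) / 2 - pi / 3) = cos (\<eta> / 2 - pi / 2) * (- 1) ^ n"
    by (simp only: cos_add[of "\<eta> / 2 - pi / 2"] cos_npi sin_npi mult_zero_right diff_zero)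
  also have "cos (\<eta> / 2 - pi / 2) = sin (\<eta> / 2)"
    by (simp add: cos_diff)
  finally show ?thesis
    by (simp add: airy_char_def)
qed

text \<open>The crude bounds pi > 3 and sqrt 3 >= 3/2 suffice. The hypothesis reaches half a gap to
  the left of the frequency, as neighbouring frequencies are 2 pi apart.\<close>

lemma airy_exponent_ge:
  assumes "1 \<le> n" "airy_freq n - pi \<le> \<kappa>"
  shows "2 * real n - 1 \<le> sqrt 3 / 2 * \<kappa>" "1 \<le> \<kappa>"
proof -
  have "3 * (2 * real n - 4 / 3) \<le> pi * (2 * real n - 4 / 3)"
    using assms pi_gt3 by (intro mult_right_mono) auto
  also have "\<dots> \<le> \<kappa>"
    using assms(2) by (simp add: airy_freq_def algebra_simps)
  finally have \<kappa>: "6 * real n - 4 \<le> \<kappa>" by simp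
  then show "1 \<le> \<kappa>" using assms(1) by linarith
  have "3 / 2 \<le> sqrt 3"
    by (rule real_le_rsqrt) (simp add: power2_eq_square)
  then have "3 / 4 * \<kappa> \<le> sqrt 3 / 2 * \<kappa>"
    using \<open>1 \<le> \<kappa>\<close> by (intro mult_right_mono) auto
  then show "2 * real n - 1 \<le> sqrt 3 / 2 * \<kappa>"
    using \<kappa> assms(1) by linarith
qed

lemma exp_minus_nat_le: "exp (- real n) \<le> (1 / 2) ^ n"
proof -
  have "exp (- 1 :: real) \<le> 1 / 2"
    using exp_ge_add_one_self[of "1::real"] by (simp add: exp_minus field_simps)
  then have "exp (- 1 :: real) ^ n \<le> (1 / 2) ^ n"
    by (intro power_mono) auto
  then show ?thesis
    using exp_of_nat_mult[of n "- 1 :: real"] by simp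
qed

text \<open>Converts a small sine into a small argument; for \<open>\<bar>x\<bar> \<le> 2\<close>
  the cubic Taylor remainder costs at most two thirds of \<open>\<bar>x\<bar>\<close>.\<close>

lemma abs_sin_ge:
  fixes x :: real
  assumes "\<bar>x\<bar> \<le> pi / 2"
  shows "\<bar>x\<bar> / 4 \<le> \<bar>sin x\<bar>"
proof -
  have "\<bar>sin x - x\<bar> \<le> \<bar>x\<bar> ^ 3 / 6"
    using Maclaurin_sin_bound[of x 3] by (simp add: sin_coeff_def numeral_3_eq_3 fact_numeral)
  moreover have "\<bar>x\<bar> ^ 3 / 6 \<le> \<bar>x\<bar> * (2 / 3)"
  proof -
    have "\<bar>x\<bar> \<le> 2" using assms pi_less_4 by linarith
    then have "\<bar>x\<bar> * (\<bar>x\<bar> * \<bar>x\<bar>) \<le> \<bar>x\<bar> * (2 * 2)"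
      by (intro mult_left_mono mult_mono) auto
    then show ?thesis by (simp add: power3_eq_cube)
  qed
  ultimately show ?thesis by linarith
qed

lemma airy_char_error:
  assumes "1 \<le> n" "airy_freq n - pi \<le> \<kappa>"
  shows "\<bar>2 * exp (- (sqrt 3 * \<kappa>)) * cos (\<kappa> / 2 + pi / 3) - 2 * exp (- (sqrt 3 / 2 * \<kappa>)) * cos \<kappa>\<bar>
    \<le> 4 * exp (1 - 2 * real n)"
proof -
  have \<kappa>: "2 * real n - 1 \<le> sqrt 3 / 2 * \<kappa>" "1 \<le> \<kappa>"
    using airy_exponent_ge[OF assms] by auto
  moreover have "sqrt 3 / 2 * \<kappa> \<le> sqrt 3 * \<kappa>"
    using \<kappa>(2) by simp
  ultimately have "exp (- (sqrt 3 * \<kappa>)) \<le> exp (1 - 2 * real n)" "exp (- (sqrt 3 / 2 * \<kappa>)) \<le> exp (1 - 2 * real n)"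
    unfolding exp_le_cancel_iff by linarith+
  moreover have "\<bar>2 * a * cos b - 2 * c * cos d\<bar> \<le> 4 * e" if "0 \<le> a" "a \<le> e" "0 \<le> c" "c \<le> e" for a b c d e :: real
  proof -
    have "\<bar>a * cos b\<bar> \<le> e * 1" "\<bar>c * cos d\<bar> \<le> e * 1"
      unfolding abs_mult using that by (intro mult_mono; simp)+
    then show ?thesis by simp
  qed
  ultimately show ?thesis by simp
qed

text \<open>At a root the main term, 2 sin(eta/2) in modulus, is balanced by an exponentially small
  remainder. The radius \<open>pi\<close> is half the spacing of the frequencies, so every large
  positive root is caught by one of them.\<close>

lemma airy_root_near:
  assumes n: "1 \<le> n" and root: "airy_char \<kappa> = 0" and \<kappa>: "\<bar>\<kappa> - airy_freq n\<bar> \<le> pi"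
  shows "\<bar>\<kappa> - airy_freq n\<bar> \<le> 16 * exp (1 - 2 * real n)"
proof -
  define \<eta> where "\<eta> = \<kappa> - airy_freq n"
  have \<kappa>_eq: "\<kappa> = airy_freq n + \<eta>" by (simp add: \<eta>_def)
  have "airy_freq n - pi \<le> \<kappa>" using \<kappa> by linarith
  from airy_char_error[OF n this]
  have "\<bar>2 * (- 1) ^ n * sin (\<eta> / 2)\<bar> \<le> 4 * exp (1 - 2 * real n)"
    using root airy_char_near[of n \<eta>] unfolding \<kappa>_eq[symmetric] by linarith
  then have "2 * \<bar>sin (\<eta> / 2)\<bar> \<le> 4 * exp (1 - 2 * real n)"
    by (simp add: abs_mult power_abs)
  moreover have "\<bar>\<eta> / 2\<bar> / 4 \<le> \<bar>sin (\<eta> / 2)\<bar>"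
    using \<kappa> by (intro abs_sin_ge) (simp add: \<eta>_def)
  ultimately show ?thesis unfolding \<eta>_def by simp
qed

lemma exp_odd_small:
  assumes "4 \<le> n"
  shows "exp (1 - 2 * real n) \<le> 1 / 128"
proof -
  have "exp (1 - 2 * real n) \<le> exp (- real 7)"
    using assms by simp
  also have "\<dots> \<le> (1 / 2) ^ 7"
    by (rule exp_minus_nat_le)
  finally show ?thesis by (simp add: power_divide)
qed

text \<open>Intermediate value theorem: at distance 1 on either side of the frequency the main term
  has modulus at least 1/4 and opposite signs, against a remainder of at most 1/32. Which sign
  occurs where depends on the parity of \<open>n\<close>.\<close>

lemma airy_root_exists:
  assumes n: "4 \<le> n"
  shows "\<exists>\<kappa>. \<bar>\<kappa> - airy_freq n\<bar> \<le> 1 \<and> airy_char \<kappa> = 0"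
proof -
  have cont: "continuous_on A (\<lambda>\<kappa>. airy_char \<kappa>)" for A
    unfolding airy_char_def by (intro continuous_intros) auto
  have err: "\<bar>airy_char (airy_freq n + \<eta>) - 2 * (- 1) ^ n * sin (\<eta> / 2)\<bar> \<le> 1 / 32" if "\<bar>\<eta>\<bar> \<le> 1" for \<eta>
  proof -
    have "airy_freq n - pi \<le> airy_freq n + \<eta>" using that pi_gt3 by linarith
    from airy_char_error[OF _ this] n exp_odd_small[OF n] show ?thesis
      unfolding airy_char_near by linarith
  qed
  have "1 / 8 \<le> \<bar>sin (1 / 2 :: real)\<bar>"
    using abs_sin_ge[of "1 / 2"] pi_gt3 by simp
  moreover have "0 < sin (1 / 2 :: real)"
    using pi_gt3 by (intro sin_gt_zero) auto
  ultimately have sin: "1 / 8 \<le> sin (1 / 2 :: real)" by simp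
  show ?thesis
  proof (cases "even n")
    case True
    then have "\<bar>airy_char (airy_freq n + 1) - 2 * sin (1 / 2)\<bar> \<le> 1 / 32"
      "\<bar>airy_char (airy_freq n - 1) + 2 * sin (1 / 2)\<bar> \<le> 1 / 32"
      using err[of 1] err[of "- 1"] by simp_all
    then have "airy_char (airy_freq n - 1) \<le> 0" "0 \<le> airy_char (airy_freq n + 1)"
      using sin by linarith+
    then obtain \<kappa> where "airy_freq n - 1 \<le> \<kappa>" "\<kappa> \<le> airy_freq n + 1" "airy_char \<kappa> = 0"
      using IVT'[of airy_char "airy_freq n - 1" 0 "airy_freq n + 1"] cont by auto
    then show ?thesis by (intro exI[of _ \<kappa>]) auto
  next
    case False
    then have "\<bar>airy_char (airy_freq n + 1) + 2 * sin (1 / 2)\<bar> \<le> 1 / 32"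
      "\<bar>airy_char (airy_freq n - 1) - 2 * sin (1 / 2)\<bar> \<le> 1 / 32"
      using err[of 1] err[of "- 1"] by simp_all
    then have "0 \<le> airy_char (airy_freq n - 1)" "airy_char (airy_freq n + 1) \<le> 0"
      using sin by linarith+
    then obtain \<kappa> where "airy_freq n - 1 \<le> \<kappa>" "\<kappa> \<le> airy_freq n + 1" "airy_char \<kappa> = 0"
      using IVT2'[of airy_char "airy_freq n + 1" 0 "airy_freq n - 1"] cont by auto
    then show ?thesis by (intro exI[of _ \<kappa>]) auto
  qed
qed

lemma airy_char_deriv:
  "(airy_char has_real_derivative
     (- sin (\<kappa> / 2 - pi / 3) - exp (- (sqrt 3 * \<kappa>)) * (2 * sqrt 3 * cos (\<kappa> / 2 + pi / 3) + sin (\<kappa> / 2 + pi / 3))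
       + exp (- (sqrt 3 / 2 * \<kappa>)) * (sqrt 3 * cos \<kappa> + 2 * sin \<kappa>))) (at \<kappa>)"
  unfolding airy_char_def by (auto intro!: derivative_eq_intros simp: algebra_simps)

text \<open>Rolle's theorem: between two roots the derivative would vanish, but its main term is
  \<open>cos (\<eta> / 2)\<close> in modulus, hence at least 1/2, while the rest is at most
  9/128.\<close>

lemma airy_root_unique:
  assumes n: "4 \<le> n" and a: "\<bar>a - airy_freq n\<bar> \<le> 1" "airy_char a = 0"
    and b: "\<bar>b - airy_freq n\<bar> \<le> 1" "airy_char b = 0"
  shows "a = b"
proof -
  have False if ab: "a < b" and a: "\<bar>a - airy_freq n\<bar> \<le> 1" "airy_char a = 0"
    and b: "\<bar>b - airy_freq n\<bar> \<le> 1" "airy_char b = 0" for a b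
  proof -
    obtain \<kappa> where \<kappa>: "a < \<kappa>" "\<kappa> < b" and
      d: "- sin (\<kappa> / 2 - pi / 3) - exp (- (sqrt 3 * \<kappa>)) * (2 * sqrt 3 * cos (\<kappa> / 2 + pi / 3) + sin (\<kappa> / 2 + pi / 3))
       + exp (- (sqrt 3 / 2 * \<kappa>)) * (sqrt 3 * cos \<kappa> + 2 * sin \<kappa>) = 0"
      using MVT2[OF ab airy_char_deriv] a(2) b(2) ab by auto
    define \<eta> where "\<eta> = \<kappa> - airy_freq n"
    have \<eta>: "\<bar>\<eta>\<bar> \<le> 1" using \<kappa> a b unfolding \<eta>_def by linarith
    have ge: "airy_freq n - pi \<le> \<kappa>" using \<eta> pi_gt3 unfolding \<eta>_def by linarith
    have \<kappa>1: "2 * real n - 1 \<le> sqrt 3 / 2 * \<kappa>" "1 \<le> \<kappa>"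
      using airy_exponent_ge[OF _ ge] n by auto
    have "sqrt 3 / 2 * \<kappa> \<le> sqrt 3 * \<kappa>" using \<kappa>1(2) by simp
    then have "exp (- (sqrt 3 * \<kappa>)) \<le> exp (1 - 2 * real n)" "exp (- (sqrt 3 / 2 * \<kappa>)) \<le> exp (1 - 2 * real n)"
      using \<kappa>1(1) unfolding exp_le_cancel_iff by linarith+
    then have e: "exp (- (sqrt 3 * \<kappa>)) \<le> 1 / 128" "exp (- (sqrt 3 / 2 * \<kappa>)) \<le> 1 / 128"
      using exp_odd_small[OF n] by linarith+
    have s3: "sqrt 3 \<le> 2" by (rule real_le_lsqrt) auto
    have tri: "\<bar>sqrt 3 * cos y\<bar> \<le> 2 * 1" "\<bar>sin y\<bar> \<le> 1" for y :: real
      unfolding abs_mult using s3 by (intro mult_mono; simp)+ (simp add: abs_sin_le_one)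
    have "\<bar>2 * sqrt 3 * cos (\<kappa> / 2 + pi / 3) + sin (\<kappa> / 2 + pi / 3)\<bar> \<le> 5"
      using tri(1)[of "\<kappa> / 2 + pi / 3"] tri(2)[of "\<kappa> / 2 + pi / 3"] unfolding mult.assoc by linarith
    then have t1: "\<bar>exp (- (sqrt 3 * \<kappa>)) * (2 * sqrt 3 * cos (\<kappa> / 2 + pi / 3) + sin (\<kappa> / 2 + pi / 3))\<bar> \<le> 1 / 128 * 5"
      unfolding abs_mult using e by (intro mult_mono) auto
    have "\<bar>sqrt 3 * cos \<kappa> + 2 * sin \<kappa>\<bar> \<le> 4"
      using tri(1)[of \<kappa>] tri(2)[of \<kappa>] by linarith
    then have t2: "\<bar>exp (- (sqrt 3 / 2 * \<kappa>)) * (sqrt 3 * cos \<kappa> + 2 * sin \<kappa>)\<bar> \<le> 1 / 128 * 4"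
      unfolding abs_mult using e by (intro mult_mono) auto
    have "\<kappa> / 2 - pi / 3 = (\<eta> / 2 - pi / 2) + real n * pi"
      by (simp add: airy_freq_def \<eta>_def field_simps)
    then have "sin (\<kappa> / 2 - pi / 3) = sin (\<eta> / 2 - pi / 2) * (- 1) ^ n"
      by (simp only: sin_add[of "\<eta> / 2 - pi / 2"] cos_npi sin_npi mult_zero_right add_0_right)
    also have "sin (\<eta> / 2 - pi / 2) = - cos (\<eta> / 2)"
      by (simp add: sin_diff)
    finally have "\<bar>sin (\<kappa> / 2 - pi / 3)\<bar> = \<bar>cos (\<eta> / 2)\<bar>"
      by (simp add: abs_mult power_abs)
    moreover have "cos (pi / 3) \<le> cos \<bar>\<eta> / 2\<bar>"
      using \<eta> pi_gt3 by (intro cos_monotone_0_pi_le) auto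
    then have "1 / 2 \<le> cos (\<eta> / 2)" by (simp only: cos_abs_real cos_60)
    ultimately show False
      using t1 t2 d by linarith
  qed
  from this[of a b] this[of b a] show ?thesis
    using a b by (cases a b rule: linorder_cases) auto
qed

text \<open>The function extends to an entire one, which has finitely many zeros in a disc unless it
  is constant; constancy would contradict uniqueness of the root near \<open>airy_freq 4\<close>.
  This keeps the set of roots outside the asymptotics finite.\<close>

lemma airy_roots_finite: "finite {\<kappa> \<in> {-R..R}. airy_char \<kappa> = 0}"
proof -
  define F where "F z = 2 * cos (z / 2 - of_real (pi / 3))
     + 2 * exp (- (of_real (sqrt 3) * z)) * cos (z / 2 + of_real (pi / 3))
     - 2 * exp (- (of_real (sqrt 3 / 2) * z)) * cos z" for z :: complex
  have F: "F (of_real x) = of_real (airy_char x)" for x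
    unfolding F_def airy_char_def
    by (simp only: of_real_add of_real_diff of_real_mult of_real_minus of_real_divide of_real_numeral
        cos_of_real[symmetric] exp_of_real[symmetric])
  have "finite {z \<in> cball 0 R. F z = 0}"
  proof (rule holomorphic_compact_finite_zeros[where S = UNIV])
    show "F holomorphic_on UNIV"
      unfolding F_def by (intro holomorphic_intros) auto
    show "\<not> F constant_on UNIV"
    proof
      assume "F constant_on UNIV"
      then obtain c where c: "\<And>z. F z = c" unfolding constant_on_def by auto
      obtain \<kappa> where "airy_char \<kappa> = 0" using airy_root_exists[of 4] by auto
      then have "airy_char x = 0" for x
        using c[of "of_real \<kappa>"] c[of "of_real x"] by (simp add: F)
      then have "a = b" if "\<bar>a - airy_freq 4\<bar> \<le> 1" "\<bar>b - airy_freq 4\<bar> \<le> 1" for a b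
        using airy_root_unique[of 4 a b] that by auto
      from this[of "airy_freq 4" "airy_freq 4 + 1"] show False by simp
    qed
  qed auto
  then have "finite (of_real -` {z \<in> cball 0 R. F z = 0} :: real set)"
    by (rule finite_vimageI) (simp add: inj_of_real)
  then show ?thesis
    by (rule finite_subset[rotated]) (auto simp: F)
qed

section \<open>Asymptotics of the eigenfunctions\<close>

text \<open>Scaled so that the decaying mode has coefficient -1. The coefficient of the oscillating
  mode then tends to 1 as \<open>\<kappa>\<close> grows.\<close>

definition airy_psi :: "real \<Rightarrow> real \<Rightarrow> complex" where
  "airy_psi \<kappa> x = airy_Psi \<kappa> x / (airy_mode \<kappa> (cnj omega) 1 - airy_mode \<kappa> 1 1)"

definition airy_a :: "real \<Rightarrow> complex" where
  "airy_a \<kappa> = (airy_mode \<kappa> omega 1 - airy_mode \<kappa> 1 1) / (airy_mode \<kappa> (cnj omega) 1 - airy_mode \<kappa> 1 1)"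

text \<open>The coefficient of the growing mode once that mode is normalized at the right end, where
  it is a layer decaying into the interval.\<close>

definition airy_b :: "real \<Rightarrow> complex" where
  "airy_b \<kappa> = airy_a \<kappa> * airy_mode \<kappa> (cnj omega) 1"

lemma airy_mode_diff: "airy_mode \<kappa> z (x - y) = airy_mode \<kappa> z x / airy_mode \<kappa> z y"
  by (simp add: airy_mode_def exp_diff[symmetric] algebra_simps)

lemma airy_mode_nonzero [simp]: "airy_mode \<kappa> z x \<noteq> 0"
  by (simp add: airy_mode_def)

lemma continuous_on_airy_psi [continuous_intros]: "continuous_on A (airy_psi \<kappa>)"
  using continuous_on_mult_left[OF continuous_on_airy_Psi, of A "1 / (airy_mode \<kappa> (cnj omega) 1 - airy_mode \<kappa> 1 1)" \<kappa>]
  by (simp add: airy_psi_def[abs_def])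

lemma airy_psi_eq:
  assumes "\<kappa> \<noteq> 0"
  shows "airy_psi \<kappa> x = (1 - airy_a \<kappa>) * airy_mode \<kappa> 1 x - airy_mode \<kappa> omega x
    + airy_b \<kappa> * airy_mode \<kappa> (cnj omega) (x - 1)"
proof -
  let ?E = "\<lambda>z. airy_mode \<kappa> z 1"
  define D where "D = ?E (cnj omega) - ?E 1"
  have D: "D \<noteq> 0" using airy_mode_neq[OF assms] by (auto simp: D_def)
  have b: "airy_b \<kappa> * airy_mode \<kappa> (cnj omega) (x - 1) = airy_a \<kappa> * airy_mode \<kappa> (cnj omega) x"
    by (simp add: airy_b_def airy_mode_diff)
  have 1: "1 - airy_a \<kappa> = (?E (cnj omega) - ?E omega) / D"
    using D unfolding airy_a_def D_def[symmetric] by (simp add: field_simps) (simp add: D_def)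
  have 2: "(?E 1 - ?E (cnj omega)) / D = - 1"
    using D unfolding D_def by (metis minus_diff_eq minus_divide_left divide_self)
  have "airy_psi \<kappa> x = (?E (cnj omega) - ?E omega) / D * airy_mode \<kappa> 1 x
      + (?E 1 - ?E (cnj omega)) / D * airy_mode \<kappa> omega x + airy_a \<kappa> * airy_mode \<kappa> (cnj omega) x"
    unfolding airy_psi_def airy_Psi_def airy_a_def D_def[symmetric] by (simp add: add_divide_distrib)
  then show ?thesis
    unfolding b 1[symmetric] 2 by simp
qed

lemma airy_term_psi:
  assumes "\<kappa> \<noteq> 0"
  shows "airy_term f t \<kappa> x =
    exp (\<i> * of_real (\<kappa> ^ 3 * t)) * (L2_inner f (airy_psi \<kappa>) / of_real (norm2 (airy_psi \<kappa>))) * airy_psi \<kappa> x"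
proof -
  define D where "D = airy_mode \<kappa> (cnj omega) 1 - airy_mode \<kappa> 1 1"
  have D: "D \<noteq> 0" using airy_mode_neq[OF assms] by (auto simp: D_def)
  define J where "J = inverse D"
  have J: "J \<noteq> 0" "cnj J \<noteq> 0" using D by (simp_all add: J_def)
  have psi: "airy_psi \<kappa> = (\<lambda>x. J * airy_Psi \<kappa> x)"
    by (simp add: fun_eq_iff airy_psi_def D_def J_def divide_inverse mult.commute)
  have "complex_of_real (norm2 (airy_psi \<kappa>)) = J * cnj J * of_real (norm2 (airy_Psi \<kappa>))"
    unfolding psi norm2_scale of_real_mult complex_norm_square ..
  moreover have "L2_inner f (airy_psi \<kappa>) = cnj J * L2_inner f (airy_Psi \<kappa>)"
    unfolding psi L2_inner_scale_right ..
  moreover have "E * (I / \<nu>) * P = E * (cnj J * I / (J * cnj J * \<nu>)) * (J * P)" for E I \<nu> P :: complex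
    using J by simp
  ultimately show ?thesis
    unfolding airy_term_def by (simp only: fun_cong[OF psi])
qed

section \<open>Integrals over boundary layers\<close>

lemma integral_exp_edge:
  assumes "w \<noteq> 0"
  shows "(LINT y|unit_lebesgue. exp (- w * of_real y)) = (1 - exp (- w)) / w"
    and "(LINT y|unit_lebesgue. exp (- w * of_real (1 - y))) = (1 - exp (- w)) / (w :: complex)"
proof -
  have "((\<lambda>y. - exp (- w * of_real y) / w) has_vector_derivative exp (- w * of_real y)) (at y within A)" for y A
    using assms by (auto intro!: derivative_eq_intros has_vector_derivative_real_field)
  from integral_unit_lebesgue_FTC[OF this] show "(LINT y|unit_lebesgue. exp (- w * of_real y)) = (1 - exp (- w)) / w"
    by (simp add: continuous_intros diff_divide_distrib)
  have "((\<lambda>y. exp (- w * of_real (1 - y)) / w) has_vector_derivative exp (- w * of_real (1 - y))) (at y within A)" for y A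
    using assms by (auto intro!: derivative_eq_intros has_vector_derivative_real_field)
  from integral_unit_lebesgue_FTC[OF this] show "(LINT y|unit_lebesgue. exp (- w * of_real (1 - y))) = (1 - exp (- w)) / w"
    by (simp add: continuous_intros diff_divide_distrib)
qed

text \<open>A layer of width 1/s has mass O(1/s) and first moment O(1/s^2); the moments bound the
  effect of a linear deviation of the data from their boundary value.\<close>

lemma integral_edge_weight:
  fixes s :: real
  assumes "0 < s"
  shows "(LINT y|unit_lebesgue. exp (- (s * y)) + exp (- (s * (1 - y)))) \<le> 2 / s"
    and "(LINT y|unit_lebesgue. y * exp (- (s * y))) \<le> 1 / s\<^sup>2"
    and "(LINT y|unit_lebesgue. (1 - y) * exp (- (s * (1 - y)))) \<le> 1 / s\<^sup>2"
proof -
  have "((\<lambda>y. (exp (- (s * (1 - y))) - exp (- (s * y))) / s) has_vector_derivative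
      exp (- (s * y)) + exp (- (s * (1 - y)))) (at y within A)" for y A
    unfolding has_real_derivative_iff_has_vector_derivative[symmetric]
    using assms by (auto intro!: derivative_eq_intros simp: field_simps)
  from integral_unit_lebesgue_FTC[OF this]
  have "(LINT y|unit_lebesgue. exp (- (s * y)) + exp (- (s * (1 - y)))) = (1 - exp (- s)) / s - (exp (- s) - 1) / s"
    by (simp add: continuous_intros)
  also have "\<dots> = 2 * (1 - exp (- s)) / s"
    by (simp add: diff_divide_distrib)
  also have "\<dots> \<le> 2 / s"
    using assms by (intro divide_right_mono) auto
  finally show "(LINT y|unit_lebesgue. exp (- (s * y)) + exp (- (s * (1 - y)))) \<le> 2 / s" .
  have le: "1 / s\<^sup>2 - (1 / s + 1 / s\<^sup>2) * exp (- s) \<le> 1 / s\<^sup>2"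
    using assms by simp
  have "((\<lambda>y. - ((y / s + 1 / s\<^sup>2) * exp (- (s * y)))) has_vector_derivative y * exp (- (s * y))) (at y within A)" for y A
    unfolding has_real_derivative_iff_has_vector_derivative[symmetric]
    using assms by (auto intro!: derivative_eq_intros simp: field_simps power2_eq_square)
  from integral_unit_lebesgue_FTC[OF this] le show "(LINT y|unit_lebesgue. y * exp (- (s * y))) \<le> 1 / s\<^sup>2"
    by (simp add: continuous_intros)
  have "((\<lambda>y. ((1 - y) / s + 1 / s\<^sup>2) * exp (- (s * (1 - y)))) has_vector_derivative (1 - y) * exp (- (s * (1 - y)))) (at y within A)" for y A
    unfolding has_real_derivative_iff_has_vector_derivative[symmetric]
    using assms by (auto intro!: derivative_eq_intros simp: field_simps power2_eq_square)
  from integral_unit_lebesgue_FTC[OF this] le show "(LINT y|unit_lebesgue. (1 - y) * exp (- (s * (1 - y)))) \<le> 1 / s\<^sup>2"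
    by (simp add: continuous_intros)
qed

text \<open>The boundary layers see only the boundary value of the data up to a quadratic error.\<close>

lemma edge_integral_estimate:
  fixes f :: "real \<Rightarrow> real"
  assumes f: "f \<in> borel_measurable unit_lebesgue" and w: "0 < Re w"
    and d: "d = (\<lambda>y. y) \<or> d = (\<lambda>y. 1 - y)"
    and C: "\<And>y. 0 < y \<Longrightarrow> y < 1 \<Longrightarrow> \<bar>f y - A\<bar> \<le> C * d y"
  shows "norm ((LINT y|unit_lebesgue. of_real (f y) * exp (- w * of_real (d y))) - of_real A / w)
    \<le> C / (Re w)\<^sup>2 + \<bar>A\<bar> * exp (- Re w) / Re w"
proof -
  note [measurable] = f
  have d01: "0 < d y" "d y < 1" if "0 < y" "y < 1" for y using d that by auto
  have cont: "continuous_on B d" for B using d by (auto intro: continuous_intros)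
  have "0 \<le> C * d (1 / 2)" using C[of "1 / 2"] by simp
  then have "0 \<le> C" using d by auto
  have w0: "w \<noteq> 0" using w by auto
  \<comment> \<open>After subtraction of the boundary value the deviation is at most a multiple of
    \<open>d\<close>, so its layer integral is bounded by a first moment; the constant part is
    integrated exactly.\<close>
  define g where "g y = complex_of_real (f y - A) * exp (- w * of_real (d y))" for y
  have exp_meas: "(\<lambda>y. exp (- w * of_real (d y))) \<in> borel_measurable unit_lebesgue"
    by (intro measurable_unit_lebesgue_continuous continuous_intros cont)
  have g_meas [measurable]: "g \<in> borel_measurable unit_lebesgue"
    unfolding g_def using exp_meas by measurable
  have g_le: "norm (g y) \<le> C * (d y * exp (- (Re w * d y)))" if "0 < y" "y < 1" for y
  proof -
    have "norm (g y) = \<bar>f y - A\<bar> * exp (- (Re w * d y))"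
      by (simp add: g_def norm_mult del: of_real_diff)
    also have "\<dots> \<le> C * d y * exp (- (Re w * d y))"
      using C[OF that] by (intro mult_right_mono) auto
    finally show ?thesis by (simp add: mult.assoc)
  qed
  have int_h: "integrable unit_lebesgue (\<lambda>y. C * (d y * exp (- (Re w * d y))))"
    by (intro integrable_unit_lebesgue_continuous continuous_intros cont)
  have int_g: "integrable unit_lebesgue g"
    by (rule Bochner_Integration.integrable_bound[OF int_h g_meas])
       (use g_le in \<open>auto intro!: AE_I2 intro: order_trans[OF _ abs_ge_self]\<close>)
  have "norm (LINT y|unit_lebesgue. g y) \<le> (LINT y|unit_lebesgue. C * (d y * exp (- (Re w * d y))))"
    by (rule Bochner_Integration.integral_norm_bound_integral[OF int_g int_h]) (use g_le in auto)
  also have "\<dots> = C * (LINT y|unit_lebesgue. d y * exp (- (Re w * d y)))"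
    by simp
  also have "\<dots> \<le> C * (1 / (Re w)\<^sup>2)"
    using d integral_edge_weight(2,3)[OF w] \<open>0 \<le> C\<close> by (intro mult_left_mono) auto
  finally have 1: "norm (LINT y|unit_lebesgue. g y) \<le> C / (Re w)\<^sup>2" by simp
  have "(LINT y|unit_lebesgue. of_real (f y) * exp (- w * of_real (d y)))
      = (LINT y|unit_lebesgue. g y + of_real A * exp (- w * of_real (d y)))"
    by (simp add: g_def algebra_simps)
  also have "\<dots> = (LINT y|unit_lebesgue. g y) + of_real A * (LINT y|unit_lebesgue. exp (- w * of_real (d y)))"
    by (subst Bochner_Integration.integral_add[OF int_g])
       (auto intro!: integrable_unit_lebesgue_continuous continuous_intros cont)
  also have "(LINT y|unit_lebesgue. exp (- w * of_real (d y))) = (1 - exp (- w)) / w"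
    using d integral_exp_edge[OF w0] by auto
  finally have "(LINT y|unit_lebesgue. of_real (f y) * exp (- w * of_real (d y))) - of_real A / w
      = (LINT y|unit_lebesgue. g y) - of_real A * exp (- w) / w"
    by (simp add: diff_divide_distrib algebra_simps)
  moreover have "norm (of_real A * exp (- w) / w) \<le> \<bar>A\<bar> * exp (- Re w) / Re w"
    using w w0 complex_Re_le_cmod[of w]
    by (simp add: norm_mult norm_divide) (intro divide_left_mono mult_pos_pos, auto)
  ultimately show ?thesis
    using 1 norm_triangle_ineq4[of "LINT y|unit_lebesgue. g y" "of_real A * exp (- w) / w"] by simp
qed

context
  fixes \<kappa> s :: real
  assumes s: "s = sqrt 3 / 2 * \<kappa>" and s1: "1 \<le> s"
begin

private lemma \<kappa>_pos: "\<kappa> > 0"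
  using s s1 by (simp add: zero_less_mult_iff) (smt (verit) real_sqrt_ge_0_iff zero_less_mult_iff)

private lemma norms:
  "norm (airy_mode \<kappa> 1 x) = 1" "norm (airy_mode \<kappa> omega x) = exp (- (s * x))"
  "norm (airy_mode \<kappa> (cnj omega) x) = exp (s * x)"
  unfolding norm_airy_mode s by simp_all

text \<open>At the right end the growing mode dominates: exp s - 1 is at least half of exp s because
  s >= 1. Here \<open>s\<close> is the decay rate of both layers.\<close>

private lemma denominator: "norm (z / (airy_mode \<kappa> (cnj omega) 1 - airy_mode \<kappa> 1 1)) \<le> 2 * exp (- s) * norm z"
proof -
  have "2 \<le> exp s" using exp_ge_add_one_self[of s] s1 by linarith
  then have "exp s / 2 \<le> exp s - 1" by simp
  also have "\<dots> \<le> norm (airy_mode \<kappa> (cnj omega) 1 - airy_mode \<kappa> 1 1)"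
    using norm_triangle_ineq2[of "airy_mode \<kappa> (cnj omega) 1" "airy_mode \<kappa> 1 1"] by (simp add: norms)
  finally have "norm z / norm (airy_mode \<kappa> (cnj omega) 1 - airy_mode \<kappa> 1 1) \<le> norm z / (exp s / 2)"
    by (intro divide_left_mono mult_pos_pos) (auto intro: less_le_trans[rotated])
  then show ?thesis
    by (simp add: norm_divide exp_minus field_simps)
qed

lemma norm_airy_a: "norm (airy_a \<kappa>) \<le> 4 * exp (- s)"
proof -
  have "norm (airy_mode \<kappa> omega 1 - airy_mode \<kappa> 1 1) \<le> exp (- s) + 1"
    using norm_triangle_ineq4[of "airy_mode \<kappa> omega 1" "airy_mode \<kappa> 1 1"] by (simp add: norms)
  also have "\<dots> \<le> 2" using s1 by simp
  finally have "2 * exp (- s) * norm (airy_mode \<kappa> omega 1 - airy_mode \<kappa> 1 1) \<le> 2 * exp (- s) * 2"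
    by (intro mult_left_mono) auto
  then show ?thesis
    using denominator[of "airy_mode \<kappa> omega 1 - airy_mode \<kappa> 1 1"] unfolding airy_a_def by linarith
qed

text \<open>The growth cancels in the numerator, since the boundary values of the growing and the
  decaying mode have a product of modulus 1; the denominator makes the whole exponentially
  small.\<close>

lemma norm_airy_b: "norm (airy_b \<kappa> + airy_mode \<kappa> 1 1) \<le> 4 * exp (- s)"
proof -
  let ?E = "\<lambda>z. airy_mode \<kappa> z 1"
  have D: "?E (cnj omega) - ?E 1 \<noteq> 0" using airy_mode_neq[of \<kappa>] \<kappa>_pos by auto
  have "airy_b \<kappa> + ?E 1 = (?E omega * ?E (cnj omega) - ?E 1 * ?E 1) / (?E (cnj omega) - ?E 1)"
    using D unfolding airy_b_def airy_a_def by (simp add: field_simps)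
  moreover have "norm (?E omega * ?E (cnj omega) - ?E 1 * ?E 1) \<le> 2"
    using norm_triangle_ineq4[of "?E omega * ?E (cnj omega)" "?E 1 * ?E 1"]
    by (simp add: norm_mult norms exp_minus)
  then have "2 * exp (- s) * norm (?E omega * ?E (cnj omega) - ?E 1 * ?E 1) \<le> 2 * exp (- s) * 2"
    by (intro mult_left_mono) auto
  ultimately show ?thesis
    using denominator[of "?E omega * ?E (cnj omega) - ?E 1 * ?E 1"] by (simp only:)
qed

lemma exp_minus_s_le: "exp (- s) \<le> 1 / 2"
proof -
  have "2 \<le> exp s" using exp_ge_add_one_self[of s] s1 by linarith
  then show ?thesis by (simp add: exp_minus field_simps)
qed

lemma norm_airy_b_le: "norm (airy_b \<kappa>) \<le> 3"
  using norm_airy_b exp_minus_s_le norm_triangle_ineq4[of "airy_b \<kappa> + airy_mode \<kappa> 1 1" "airy_mode \<kappa> 1 1"]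
  by (simp add: norms)

lemma airy_psi_near_mode:
  assumes "0 \<le> x" "x \<le> 1"
  shows "norm (airy_psi \<kappa> x - airy_mode \<kappa> 1 x) \<le> 8 * (exp (- (s * x)) + exp (- (s * (1 - x))))"
proof -
  have "airy_psi \<kappa> x - airy_mode \<kappa> 1 x = - (airy_a \<kappa> * airy_mode \<kappa> 1 x) - airy_mode \<kappa> omega x
      + airy_b \<kappa> * airy_mode \<kappa> (cnj omega) (x - 1)"
    using \<kappa>_pos by (simp add: airy_psi_eq algebra_simps)
  also have "norm \<dots> \<le> norm (airy_a \<kappa> * airy_mode \<kappa> 1 x) + norm (airy_mode \<kappa> omega x)
      + norm (airy_b \<kappa> * airy_mode \<kappa> (cnj omega) (x - 1))"
    by (intro norm_triangle_mono order_trans[OF norm_triangle_ineq4]) simp_all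
  also have "\<dots> = norm (airy_a \<kappa>) + exp (- (s * x)) + norm (airy_b \<kappa>) * exp (- (s * (1 - x)))"
    by (simp add: norm_mult norms algebra_simps)
  also have "\<dots> \<le> 4 * exp (- (s * x)) + exp (- (s * x)) + 3 * exp (- (s * (1 - x)))"
  proof (intro add_mono mult_right_mono norm_airy_b_le order_refl)
    have "exp (- s) \<le> exp (- (s * x))" using assms s1 by simp
    then show "norm (airy_a \<kappa>) \<le> 4 * exp (- (s * x))" using norm_airy_a by linarith
  qed auto
  also have "\<dots> \<le> 8 * (exp (- (s * x)) + exp (- (s * (1 - x))))"
    by (simp add: add_nonneg_nonneg)
  finally show ?thesis .
qed

lemma norm_airy_psi_le:
  assumes "0 \<le> x" "x \<le> 1"
  shows "norm (airy_psi \<kappa> x) \<le> 17"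
proof -
  have "exp (- (s * x)) \<le> 1" "exp (- (s * (1 - x))) \<le> 1"
    using assms s1 by simp_all
  from mult_left_mono[OF add_mono[OF this], of 8]
  have "8 * (exp (- (s * x)) + exp (- (s * (1 - x)))) \<le> 16" by simp
  then have "norm (airy_psi \<kappa> x - airy_mode \<kappa> 1 x) \<le> 16"
    by (rule order_trans[OF airy_psi_near_mode[OF assms]])
  then show ?thesis
    using norm_triangle_ineq2[of "airy_psi \<kappa> x" "airy_mode \<kappa> 1 x"] by (simp add: norms)
qed

text \<open>Only the layers, of total mass at most 2/s, move the squared norm away from 1. The
  constant is 2 * 8 * 18, with 8 from \<open>airy_psi_near_mode\<close> and 18 = 17 + 1 from the
  bound on the function.\<close>

lemma norm2_airy_psi: "\<bar>norm2 (airy_psi \<kappa>) - 1\<bar> \<le> 288 / s"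
proof -
  define w where "w x = exp (- (s * x)) + exp (- (s * (1 - x)))" for x
  have le: "norm ((norm (airy_psi \<kappa> x))\<^sup>2 - 1) \<le> 144 * w x" if x: "0 < x" "x < 1" for x
  proof -
    have "(norm (airy_psi \<kappa> x))\<^sup>2 - 1 = (norm (airy_psi \<kappa> x) - 1) * (norm (airy_psi \<kappa> x) + 1)"
      by (simp add: algebra_simps power2_eq_square)
    also have "norm \<dots> = \<bar>norm (airy_psi \<kappa> x) - norm (airy_mode \<kappa> 1 x)\<bar> * (norm (airy_psi \<kappa> x) + 1)"
      by (simp add: abs_mult norms)
    also have "\<dots> \<le> (8 * w x) * 18"
      using airy_psi_near_mode[of x] norm_airy_psi_le[of x] x
        norm_triangle_ineq3[of "airy_psi \<kappa> x" "airy_mode \<kappa> 1 x"]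
      by (intro mult_mono) (auto simp: w_def)
    finally show ?thesis by simp
  qed
  have int: "integrable unit_lebesgue (\<lambda>x. (norm (airy_psi \<kappa> x))\<^sup>2)" "integrable unit_lebesgue w"
    unfolding w_def by (intro integrable_unit_lebesgue_continuous continuous_intros)+
  have "norm2 (airy_psi \<kappa>) - 1 = (LINT x|unit_lebesgue. (norm (airy_psi \<kappa> x))\<^sup>2 - 1)"
    unfolding norm2_def using int by (subst Bochner_Integration.integral_diff) simp_all
  also have "norm \<dots> \<le> (LINT x|unit_lebesgue. 144 * w x)"
    by (rule Bochner_Integration.integral_norm_bound_integral) (use int le in auto)
  also have "\<dots> = 144 * (LINT x|unit_lebesgue. w x)"
    by simp
  also have "\<dots> \<le> 144 * (2 / s)"
    unfolding w_def using integral_edge_weight(1)[of s] s1 by (intro mult_left_mono) auto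
  finally show ?thesis by simp
qed

end

section \<open>Leading terms of the expansion coefficients\<close>

lemma norm_exp_i_diff_le: "norm (exp (\<i> * of_real a) - exp (\<i> * of_real b)) \<le> \<bar>a - b\<bar>"
proof -
  have "(norm (exp (\<i> * of_real a) - exp (\<i> * of_real b)))\<^sup>2 = (cos a - cos b)\<^sup>2 + (sin a - sin b)\<^sup>2"
    unfolding cis_conv_exp[symmetric] by (simp add: cmod_power2)
  also have "\<dots> = 2 * (1 - cos (a - b))"
    using sin_cos_squared_add[of a] sin_cos_squared_add[of b]
    by (simp add: cos_diff power2_diff algebra_simps)
  also have "\<dots> = (2 * sin ((a - b) / 2))\<^sup>2"
  proof -
    define h where "h = (a - b) / 2"
    then have "a - b = 2 * h" by simp
    then show ?thesis
      unfolding h_def[symmetric] using cos_double_sin[of h] by (simp add: power2_eq_square)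
  qed
  also have "\<dots> = \<bar>2 * sin ((a - b) / 2)\<bar>\<^sup>2"
    by simp
  finally have "norm (exp (\<i> * of_real a) - exp (\<i> * of_real b)) = \<bar>2 * sin ((a - b) / 2)\<bar>"
    by (rule power2_eq_imp_eq) auto
  then show ?thesis
    using abs_sin_x_le_abs_x[of "(a - b) / 2"] by simp
qed

lemma airy_mode_1: "airy_mode \<kappa> 1 x = exp (\<i> * of_real (\<kappa> * x))"
  by (simp add: airy_mode_def mult.assoc)

text \<open>The number exp(pi i / 6). After conjugation the layers have the complex rates
  \<open>\<kappa> * cnj zeta\<close> at 0 and \<open>\<kappa> * zeta\<close> at 1, with the common
  real part \<open>sqrt 3 / 2 * \<kappa>\<close>.\<close>

definition zeta :: complex where "zeta = Complex (sqrt 3 / 2) (1 / 2)"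

lemma zeta_simps [simp]: "zeta * cnj zeta = 1" "cnj zeta * zeta = 1" "Re zeta = sqrt 3 / 2" "norm zeta = 1" "zeta \<noteq> 0"
  by (auto simp: zeta_def complex_eq_iff cmod_def power_divide)

lemma cnj_airy_mode:
  "cnj (airy_mode \<kappa> omega x) = exp (- (of_real \<kappa> * cnj zeta) * of_real x)"
  "cnj (airy_mode \<kappa> (cnj omega) (x - 1)) = exp (- (of_real \<kappa> * zeta) * of_real (1 - x))"
proof -
  have z: "\<i> * cnj omega = cnj zeta" "\<i> * omega = - zeta"
    by (simp_all add: zeta_def omega_def complex_eq_iff)
  have "cnj (airy_mode \<kappa> omega x) = exp (- (of_real \<kappa> * (\<i> * cnj omega)) * of_real x)"
    "cnj (airy_mode \<kappa> (cnj omega) (x - 1)) = exp (- (of_real \<kappa> * (\<i> * omega)) * of_real (x - 1))"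
    unfolding airy_mode_def exp_cnj by (simp_all add: mult_ac)
  then show "cnj (airy_mode \<kappa> omega x) = exp (- (of_real \<kappa> * cnj zeta) * of_real x)"
    "cnj (airy_mode \<kappa> (cnj omega) (x - 1)) = exp (- (of_real \<kappa> * zeta) * of_real (1 - x))"
    unfolding z by (simp_all add: algebra_simps)
qed

lemma exp_airy_freq: "exp (\<i> * of_real (airy_freq n)) = cnj (zeta * zeta)"
proof -
  have "\<i> * of_real (airy_freq n) = \<i> * of_real (- (pi / 3)) + 2 * of_int (int n) * pi * \<i>"
    by (simp add: airy_freq_def algebra_simps)
  then have "exp (\<i> * of_real (airy_freq n)) = exp (\<i> * of_real (- (pi / 3)))"
    by (simp only: exp_add exp_integer_2pi Ints_of_int mult_1_right)
  also have "\<dots> = cis (- (pi / 3))"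
    by (simp only: cis_conv_exp)
  also have "\<dots> = cnj (zeta * zeta)"
    by (simp add: complex_eq_iff zeta_def cos_60 sin_60)
  finally show ?thesis .
qed

lemma airy_freq_gt:
  assumes "1 \<le> n"
  shows "real n \<le> airy_freq n" "airy_freq n \<le> 8 * real n - 1"
proof -
  have "3 * (2 * real n - 1 / 3) \<le> pi * (2 * real n - 1 / 3)"
    using assms pi_gt3 by (intro mult_right_mono) auto
  then have "6 * real n - 1 \<le> airy_freq n" by (simp add: airy_freq_def mult.commute)
  then show "real n \<le> airy_freq n" using assms by linarith
  have "pi * (2 * real n - 1 / 3) \<le> 4 * (2 * real n - 1 / 3)"
    using assms pi_less_4 by (intro mult_right_mono) auto
  then show "airy_freq n \<le> 8 * real n - 1" by (simp add: airy_freq_def mult.commute)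
qed

text \<open>With k the frequency, exp(-i k) = zeta^2 and 1 - zeta^2 = -i zeta, so the constant
  function 1 has the coefficient -zeta/k. This is the form in which the layers contribute.\<close>

lemma tilde_coeff_expand:
  assumes u0: "piecewise_lipschitz u0" and n: "1 \<le> n"
  shows "tilde_coeff u0 n = L2_inner (\<lambda>x. of_real (u0 x)) (airy_exp n)
    - of_real (u0 0 + u0 1) * zeta / of_real (airy_freq n)"
proof -
  define k where "k = airy_freq n"
  have k: "k > 0" using airy_freq_gt(1)[OF n] n by (simp add: k_def)
  have "cnj (airy_exp n y) = exp (- (\<i> * of_real k) * of_real y)" for y
    by (simp add: airy_exp_def exp_cnj k_def mult.assoc)
  then have "L2_inner (\<lambda>y. 1) (airy_exp n) = (LINT y|unit_lebesgue. exp (- (\<i> * of_real k) * of_real y))"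
    by (simp add: L2_inner_def)
  also have "\<dots> = (1 - exp (- (\<i> * of_real k))) / (\<i> * of_real k)"
    using k by (intro integral_exp_edge) auto
  also have "exp (- (\<i> * of_real k)) = cnj (exp (\<i> * of_real (airy_freq n)))"
    by (simp add: exp_cnj k_def)
  also have "\<dots> = zeta * zeta"
    by (simp add: exp_airy_freq)
  also have "1 - zeta * zeta = - zeta * \<i>"
    by (simp add: zeta_def complex_eq_iff)
  finally have one: "L2_inner (\<lambda>y. 1) (airy_exp n) = - zeta / of_real k"
    by simp
  have L: "L2 (\<lambda>x. complex_of_real (u0 x))"
    using piecewise_lipschitz_L2[OF u0, of 0] by simp
  have "tilde_coeff u0 n = L2_inner (\<lambda>x. of_real (u0 x) + of_real (u0 0 + u0 1) * 1) (airy_exp n)"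
    unfolding tilde_coeff_eq_inner by (simp add: algebra_simps)
  also have "\<dots> = L2_inner (\<lambda>x. of_real (u0 x)) (airy_exp n) + L2_inner (\<lambda>x. of_real (u0 0 + u0 1) * 1) (airy_exp n)"
    by (intro L2_inner_add_left L L2_scale L2_continuous continuous_intros)
  finally show ?thesis
    unfolding L2_inner_scale_left one k_def by simp
qed

text \<open>The cancellation behind the boundary values in the revival coefficients. The layer at 0
  has weight -1 and contributes -u0(0) zeta/kappa. The layer at 1 has weight close to -zeta^2 and
  meets u0(1) conj(zeta)/kappa, which gives -u0(1) zeta/kappa. The sum matches the extra term in
  \<open>tilde_coeff_expand\<close>, so no error of order 1/kappa survives.\<close>

lemma airy_inner_estimate:
  assumes u0: "piecewise_lipschitz u0" and n: "1 \<le> n"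
    and C: "\<And>y. 0 < y \<Longrightarrow> y < 1 \<Longrightarrow> \<bar>u0 y - u0 0\<bar> \<le> C * y"
      "\<And>y. 0 < y \<Longrightarrow> y < 1 \<Longrightarrow> \<bar>u0 y - u0 1\<bar> \<le> C * (1 - y)"
    and M: "M = \<bar>u0 0\<bar> + \<bar>u0 1\<bar> + C"
    and s: "s = sqrt 3 / 2 * \<kappa>" "1 \<le> s" and \<kappa>: "1 \<le> \<kappa>" and e: "\<bar>\<kappa> - airy_freq n\<bar> \<le> e"
  shows "norm (L2_inner (\<lambda>x. of_real (u0 x)) (airy_psi \<kappa>) - tilde_coeff u0 n)
    \<le> 4 * C / s\<^sup>2 + 12 * M * exp (- s) + 4 * M * e"
proof -
  define f where "f x = complex_of_real (u0 x)" for x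
  define k where "k = airy_freq n"
  have k1: "1 \<le> k" using airy_freq_gt(1)[OF n] n by (simp add: k_def)
  have "0 \<le> e" using e by linarith
  have f: "L2 f" using piecewise_lipschitz_L2[OF u0, of 0] by (simp add: f_def[abs_def])
  have "0 \<le> \<bar>u0 (1 / 2) - u0 0\<bar>" by simp
  then have C0: "0 \<le> C" using C(1)[of "1 / 2"] by linarith
  have M0: "0 \<le> M" "\<bar>u0 0\<bar> \<le> M" "\<bar>u0 1\<bar> \<le> M" "\<bar>u0 0\<bar> + \<bar>u0 1\<bar> \<le> M" using C0 by (simp_all add: M)
  have f_le: "norm (f x) \<le> M" if "0 < x" "x < 1" for x
  proof -
    have "C * x \<le> C * 1" using that C0 by (intro mult_left_mono) auto
    then show ?thesis using C(1)[OF that] unfolding f_def M norm_of_real by linarith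
  qed
  have int_le: "norm (L2_inner f h) \<le> M * B" if h: "continuous_on {0..1} h" and B: "\<And>x. 0 < x \<Longrightarrow> x < 1 \<Longrightarrow> norm (h x) \<le> B" for h B
  proof -
    have "norm (L2_inner f h) \<le> (LINT x|unit_lebesgue. M * B)"
      unfolding L2_inner_def
    proof (rule Bochner_Integration.integral_norm_bound_integral[OF L2_integrable_mult_cnj[OF f L2_continuous[OF h]]])
      fix x assume "x \<in> space unit_lebesgue"
      then show "norm (f x * cnj (h x)) \<le> M * B"
        using f_le[of x] B[of x] M0(1) by (simp add: norm_mult) (intro mult_mono, auto)
    qed simp
    then show ?thesis by simp
  qed
  define F I1 I2 where "F = L2_inner f (airy_mode \<kappa> 1)" and "I1 = L2_inner f (airy_mode \<kappa> omega)"
    and "I2 = L2_inner f (\<lambda>x. airy_mode \<kappa> (cnj omega) (x - 1))"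
  have cont3: "continuous_on {0..1} (\<lambda>x. airy_mode \<kappa> (cnj omega) (x - 1))"
    unfolding airy_mode_def by (intro continuous_intros)
  have eq_psi: "L2_inner f (airy_psi \<kappa>) = cnj (1 - airy_a \<kappa>) * F - I1 + cnj (airy_b \<kappa>) * I2"
  proof -
    have int: "integrable unit_lebesgue (\<lambda>x. f x * cnj (h x))" if "continuous_on {0..1} h" for h
      by (rule L2_integrable_mult_cnj[OF f L2_continuous[OF that]])
    have "f x * cnj (airy_psi \<kappa> x) = cnj (1 - airy_a \<kappa>) * (f x * cnj (airy_mode \<kappa> 1 x))
        - f x * cnj (airy_mode \<kappa> omega x)
        + cnj (airy_b \<kappa>) * (f x * cnj (airy_mode \<kappa> (cnj omega) (x - 1)))" for x
      using \<kappa> by (subst airy_psi_eq) (simp_all add: algebra_simps)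
    then show ?thesis
      unfolding L2_inner_def F_def I1_def I2_def
      by (simp only:) (simp add: int cont3 continuous_on_airy_mode)
  qed
  have eq_F: "F - L2_inner f (airy_exp n) = L2_inner f (\<lambda>x. airy_mode \<kappa> 1 x - airy_exp n x)"
  proof -
    have "L2_inner f (\<lambda>x. airy_mode \<kappa> 1 x - airy_exp n x) = cnj (L2_inner (\<lambda>x. airy_mode \<kappa> 1 x - airy_exp n x) f)"
      by (rule L2_inner_commute)
    also have "\<dots> = cnj (L2_inner (airy_mode \<kappa> 1) f) - cnj (L2_inner (airy_exp n) f)"
      by (subst L2_inner_diff_left) (auto intro!: f L2_continuous continuous_intros)
    finally show ?thesis
      unfolding F_def L2_inner_commute[of f] by simp
  qed
  have eq_tilde: "tilde_coeff u0 n = L2_inner f (airy_exp n) - of_real (u0 0 + u0 1) * zeta / of_real k"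
    using tilde_coeff_expand[OF u0 n] by (simp add: f_def[abs_def] k_def)
  \<comment> \<open>The errors \<open>r1\<close> and \<open>r2\<close> come from the variation of
    the data inside the layers, \<open>r3\<close> from replacing the root by the frequency, and
    \<open>r4\<close> from the weight of the right layer, whose leading part is - zeta^2.\<close>
  define r1 where "r1 = I1 - of_real (u0 0) / (of_real \<kappa> * cnj zeta)"
  define r2 where "r2 = I2 - of_real (u0 1) / (of_real \<kappa> * zeta)"
  define r3 where "r3 = L2_inner f (\<lambda>x. airy_mode \<kappa> 1 x - airy_exp n x)"
  define r4 where "r4 = cnj (airy_b \<kappa>) + zeta * zeta"
  have I12: "I1 = r1 + of_real (u0 0) / (of_real \<kappa> * cnj zeta)" "I2 = r2 + of_real (u0 1) / (of_real \<kappa> * zeta)"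
    by (simp_all add: r1_def r2_def)
  have F_r3: "F = L2_inner f (airy_exp n) + r3" using eq_F by (simp add: r3_def diff_eq_eq add.commute)
  have "L2_inner f (airy_psi \<kappa>) - tilde_coeff u0 n = F - L2_inner f (airy_exp n) - cnj (airy_a \<kappa>) * F - I1
      + cnj (airy_b \<kappa>) * I2 + of_real (u0 0 + u0 1) * zeta / of_real k"
    unfolding eq_psi eq_tilde by (simp add: left_diff_distrib)
  also have "\<dots> = - cnj (airy_a \<kappa>) * F + r3
      - (r1 + of_real (u0 0) / (of_real \<kappa> * cnj zeta))
      + cnj (airy_b \<kappa>) * (r2 + of_real (u0 1) / (of_real \<kappa> * zeta)) + of_real (u0 0 + u0 1) * zeta / of_real k"
    unfolding I12 using F_r3 by simp
  also have "of_real (u0 0) / (of_real \<kappa> * cnj zeta) = of_real (u0 0) * zeta / of_real \<kappa>"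
    by (simp add: divide_simps)
  also have "of_real (u0 1) / (of_real \<kappa> * zeta) = of_real (u0 1) * cnj zeta / of_real \<kappa>"
    by (simp add: divide_simps)
  also have "cnj (airy_b \<kappa>) = r4 - zeta * zeta"
    by (simp add: r4_def)
  also have "- cnj (airy_a \<kappa>) * F + r3 - (r1 + of_real (u0 0) * zeta / of_real \<kappa>)
      + (r4 - zeta * zeta) * (r2 + of_real (u0 1) * cnj zeta / of_real \<kappa>) + of_real (u0 0 + u0 1) * zeta / of_real k
    = - cnj (airy_a \<kappa>) * F + r3 - r1 + (r4 - zeta * zeta) * r2 + r4 * (of_real (u0 1) * cnj zeta / of_real \<kappa>)
      + of_real (u0 0 + u0 1) * zeta * of_real (1 / k - 1 / \<kappa>)"
  proof -
    have "zeta * zeta * (of_real (u0 1) * cnj zeta / of_real \<kappa>) = (zeta * cnj zeta) * zeta * of_real (u0 1) / of_real \<kappa>"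
      by (simp only: mult_ac times_divide_eq_right)
    then have "zeta * zeta * (of_real (u0 1) * cnj zeta / of_real \<kappa>) = of_real (u0 1) * zeta / of_real \<kappa>"
      by (simp add: mult_ac)
    then show ?thesis
      by (simp add: left_diff_distrib right_diff_distrib distrib_left distrib_right diff_divide_distrib add_divide_distrib)
  qed
  also have "r4 - zeta * zeta = cnj (airy_b \<kappa>)"
    by (simp add: r4_def)
  finally have eq: "L2_inner f (airy_psi \<kappa>) - tilde_coeff u0 n = - cnj (airy_a \<kappa>) * F + r3 - r1 + cnj (airy_b \<kappa>) * r2
      + r4 * (of_real (u0 1) * cnj zeta / of_real \<kappa>) + of_real (u0 0 + u0 1) * zeta * of_real (1 / k - 1 / \<kappa>)" .
  have b1: "norm (- cnj (airy_a \<kappa>) * F) \<le> 4 * exp (- s) * M"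
  proof -
    have "norm F \<le> M * 1" unfolding F_def by (intro int_le continuous_intros) (simp add: norm_airy_mode)
    then show ?thesis
      using norm_airy_a[OF s] M0 by (simp add: norm_mult) (intro mult_mono, auto)
  qed
  have b3: "norm r3 \<le> M * e" unfolding r3_def
  proof (rule int_le)
    fix x :: real assume x: "0 < x" "x < 1"
    have "norm (airy_mode \<kappa> 1 x - airy_exp n x) \<le> \<bar>\<kappa> * x - airy_freq n * x\<bar>"
      unfolding airy_mode_1 airy_exp_def by (rule norm_exp_i_diff_le)
    also have "\<dots> = \<bar>\<kappa> - airy_freq n\<bar> * x"
      using x by (simp add: abs_mult flip: left_diff_distrib)
    also have "\<dots> \<le> e * 1"
      using e x \<open>0 \<le> e\<close> by (intro mult_mono) auto
    finally show "norm (airy_mode \<kappa> 1 x - airy_exp n x) \<le> e" by simp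
  qed (intro continuous_intros)
  have Re_s: "Re (of_real \<kappa> * cnj zeta) = s" "Re (of_real \<kappa> * zeta) = s"
    using s by (simp_all add: mult.commute)
  have edge: "C / s\<^sup>2 + \<bar>u\<bar> * exp (- s) / s \<le> C / s\<^sup>2 + M * exp (- s)" if "\<bar>u\<bar> \<le> M" for u
  proof -
    have "\<bar>u\<bar> * exp (- s) / s \<le> \<bar>u\<bar> * exp (- s) / 1"
      using s(2) by (intro divide_left_mono) auto
    also have "\<dots> \<le> M * exp (- s)" using that by (simp add: mult_right_mono)
    finally show ?thesis by simp
  qed
  have b_r1: "norm r1 \<le> C / s\<^sup>2 + M * exp (- s)"
    using edge_integral_estimate[OF piecewise_lipschitz_measurable[OF u0], of "of_real \<kappa> * cnj zeta" "\<lambda>y. y" "u0 0" C]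
      C(1) s(2) edge[OF M0(2)]
    unfolding Re_s r1_def I1_def L2_inner_def f_def cnj_airy_mode by fastforce
  have b_r2: "norm r2 \<le> C / s\<^sup>2 + M * exp (- s)"
    using edge_integral_estimate[OF piecewise_lipschitz_measurable[OF u0], of "of_real \<kappa> * zeta" "\<lambda>y. 1 - y" "u0 1" C]
      C(2) s(2) edge[OF M0(3)]
    unfolding Re_s r2_def I2_def L2_inner_def f_def cnj_airy_mode by fastforce
  have b_r4: "norm r4 \<le> 4 * exp (- s) + e"
  proof -
    have "r4 = cnj ((airy_b \<kappa> + airy_mode \<kappa> 1 1) - (airy_mode \<kappa> 1 1 - exp (\<i> * of_real (airy_freq n))))"
      unfolding exp_airy_freq r4_def by simp
    then have "norm r4 \<le> norm (airy_b \<kappa> + airy_mode \<kappa> 1 1) + norm (airy_mode \<kappa> 1 1 - exp (\<i> * of_real (airy_freq n)))"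
      by (simp only: complex_mod_cnj norm_triangle_ineq4)
    moreover have "norm (airy_mode \<kappa> 1 1 - exp (\<i> * of_real (airy_freq n))) \<le> e"
      using norm_exp_i_diff_le[of \<kappa> "airy_freq n"] e by (simp add: airy_mode_1)
    ultimately show ?thesis using norm_airy_b[OF s] by linarith
  qed
  have b5: "norm (r4 * (of_real (u0 1) * cnj zeta / of_real \<kappa>)) \<le> (4 * exp (- s) + e) * M"
  proof -
    have "\<bar>u0 1\<bar> / \<kappa> \<le> \<bar>u0 1\<bar> / 1" using \<kappa> by (intro divide_left_mono) auto
    then have "\<bar>u0 1\<bar> / \<kappa> \<le> M" using M0 by simp
    from mult_mono[OF b_r4 this] show ?thesis
      using \<kappa> \<open>0 \<le> e\<close> by (simp add: norm_mult norm_divide)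
  qed
  have b6: "norm (of_real (u0 0 + u0 1) * zeta * of_real (1 / k - 1 / \<kappa>)) \<le> M * e"
  proof -
    have "1 / k - 1 / \<kappa> = (\<kappa> - k) / (k * \<kappa>)"
      using k1 \<kappa> by (simp add: field_simps)
    then have "\<bar>1 / k - 1 / \<kappa>\<bar> = \<bar>\<kappa> - k\<bar> / (k * \<kappa>)"
      using k1 \<kappa> by (simp add: abs_mult)
    also have "\<dots> \<le> \<bar>\<kappa> - k\<bar> / 1"
      using k1 \<kappa> mult_mono[of 1 k 1 \<kappa>] by (intro divide_left_mono) auto
    finally have "\<bar>1 / k - 1 / \<kappa>\<bar> \<le> e" using e by (simp add: k_def)
    moreover have "\<bar>u0 0 + u0 1\<bar> \<le> M" using M0(4) by linarith
    ultimately show ?thesis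
      unfolding norm_mult norm_of_real using M0 by simp (intro mult_mono, auto)
  qed
  have b4: "norm (cnj (airy_b \<kappa>) * r2) \<le> 3 * (C / s\<^sup>2 + M * exp (- s))"
    unfolding norm_mult using norm_airy_b_le[OF s] b_r2 by (intro mult_mono) auto
  have "norm (L2_inner f (airy_psi \<kappa>) - tilde_coeff u0 n)
    \<le> 4 * exp (- s) * M + M * e + (C / s\<^sup>2 + M * exp (- s)) + 3 * (C / s\<^sup>2 + M * exp (- s))
      + (4 * exp (- s) + e) * M + M * e"
    unfolding eq
    by (intro norm_triangle_mono order_trans[OF norm_triangle_ineq4 add_mono] b1 b3 b4 b5 b6 b_r1)
  also have "\<dots> \<le> 4 * C / s\<^sup>2 + 12 * M * exp (- s) + 4 * M * e"
    using M0(1) \<open>0 \<le> e\<close> by (simp add: algebra_simps)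
  finally show ?thesis by (simp add: f_def[abs_def])
qed

section \<open>The decomposition\<close>

lemma square_le_exp: "0 \<le> x \<Longrightarrow> x\<^sup>2 \<le> 2 * exp (x :: real)"
  using exp_lower_Taylor_quadratic[of x] by simp

lemma airy_root_data:
  assumes n: "4 \<le> n" and near: "\<bar>\<kappa> - airy_freq n\<bar> \<le> 1" and root: "airy_char \<kappa> = 0"
  shows "1 \<le> \<kappa>" "real n \<le> sqrt 3 / 2 * \<kappa>" "\<bar>\<kappa> - airy_freq n\<bar> \<le> 16 * exp (1 - 2 * real n)"
    "exp (- (sqrt 3 / 2 * \<kappa>)) \<le> exp (1 - 2 * real n)"
proof -
  have pi: "\<bar>\<kappa> - airy_freq n\<bar> \<le> pi" using near pi_gt3 by linarith
  then have "airy_freq n - pi \<le> \<kappa>" by linarith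
  from airy_exponent_ge[OF _ this] n have "2 * real n - 1 \<le> sqrt 3 / 2 * \<kappa>" "1 \<le> \<kappa>" by auto
  then show "1 \<le> \<kappa>" "real n \<le> sqrt 3 / 2 * \<kappa>" "exp (- (sqrt 3 / 2 * \<kappa>)) \<le> exp (1 - 2 * real n)"
    unfolding exp_le_cancel_iff using n by linarith+
  show "\<bar>\<kappa> - airy_freq n\<bar> \<le> 16 * exp (1 - 2 * real n)"
    using n by (intro airy_root_near root pi) auto
qed

text \<open>The threshold 576 makes the error \<open>288/n\<close> at most \<open>1/2\<close>.\<close>

lemma norm2_airy_psi_root:
  assumes n: "576 \<le> n" and near: "\<bar>\<kappa> - airy_freq n\<bar> \<le> 1" and root: "airy_char \<kappa> = 0"
  shows "\<bar>norm2 (airy_psi \<kappa>) - 1\<bar> \<le> 288 / real n" "1 / 2 \<le> norm2 (airy_psi \<kappa>)"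
proof -
  have s: "real n \<le> sqrt 3 / 2 * \<kappa>" using airy_root_data(2)[OF _ near root] n by simp
  then have "\<bar>norm2 (airy_psi \<kappa>) - 1\<bar> \<le> 288 / (sqrt 3 / 2 * \<kappa>)"
    using n by (intro norm2_airy_psi[OF refl]) linarith
  also have "\<dots> \<le> 288 / real n"
    using s n by (intro frac_le) linarith+
  finally show le: "\<bar>norm2 (airy_psi \<kappa>) - 1\<bar> \<le> 288 / real n" .
  have "288 / real n \<le> 1 / 2"
    using n by (simp add: field_simps)
  with le show "1 / 2 \<le> norm2 (airy_psi \<kappa>)" by linarith
qed

lemma norm2_airy_Psi_root:
  assumes n: "576 \<le> n" and near: "\<bar>\<kappa> - airy_freq n\<bar> \<le> 1" and root: "airy_char \<kappa> = 0"
  shows "norm2 (airy_Psi \<kappa>) \<noteq> 0"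
proof
  assume "norm2 (airy_Psi \<kappa>) = 0"
  moreover have "airy_psi \<kappa> = (\<lambda>x. inverse (airy_mode \<kappa> (cnj omega) 1 - airy_mode \<kappa> 1 1) * airy_Psi \<kappa> x)"
    by (simp add: fun_eq_iff airy_psi_def divide_inverse mult.commute)
  ultimately have "norm2 (airy_psi \<kappa>) = 0"
    by (simp only: norm2_scale mult_zero_right)
  with norm2_airy_psi_root(2)[OF assms] show False by simp
qed

text \<open>The error has a part summable in \<open>n\<close> uniformly in \<open>x\<close>, and a
  part from the layers of the eigenfunction that is summable only at a positive distance from the
  end points.\<close>

lemma airy_term_approx:
  assumes u0: "piecewise_lipschitz u0"
  obtains A B where "summable A" "0 \<le> B"
    "\<And>n \<kappa> x. 576 \<le> n \<Longrightarrow> \<bar>\<kappa> - airy_freq n\<bar> \<le> 1 \<Longrightarrow> airy_char \<kappa> = 0 \<Longrightarrow> 0 \<le> x \<Longrightarrow> x \<le> 1 \<Longrightarrow>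
      norm (airy_term (\<lambda>x. of_real (u0 x)) t \<kappa> x
        - tilde_coeff u0 n * exp (\<i> * of_real (airy_freq n ^ 3 * t)) * airy_exp n x)
      \<le> A n + B * (exp (- (real n * x)) + exp (- (real n * (1 - x))))"
proof -
  obtain C where C: "\<And>y. 0 < y \<Longrightarrow> y < 1 \<Longrightarrow> \<bar>u0 y - u0 0\<bar> \<le> C * y"
    "\<And>y. 0 < y \<Longrightarrow> y < 1 \<Longrightarrow> \<bar>u0 y - u0 1\<bar> \<le> C * (1 - y)"
    by (rule piecewise_lipschitz_edge[OF u0]) (rule that)
  have "0 \<le> \<bar>u0 (1 / 2) - u0 0\<bar>" by simp
  then have C0: "0 \<le> C" using C(1)[of "1 / 2"] by linarith
  define M where "M = \<bar>u0 0\<bar> + \<bar>u0 1\<bar> + C"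
  have M0: "0 \<le> M" using C0 by (simp add: M_def)
  define h where "h y = complex_of_real (u0 y + (u0 1 + u0 0))" for y
  have h: "L2 h" unfolding h_def by (rule piecewise_lipschitz_L2[OF u0])
  define B where "B = sqrt (norm2 h)"
  have T_le: "norm (tilde_coeff u0 n) \<le> B" for n
  proof -
    have "(norm (tilde_coeff u0 n))\<^sup>2 \<le> norm2 h"
      using Bessel_inequality[OF orthonormal_airy_exp _ h, of "{n}"]
      by (simp add: tilde_coeff_eq_inner h_def[abs_def])
    then show ?thesis unfolding B_def by (rule real_le_rsqrt)
  qed
  have B0: "0 \<le> B" by (simp add: B_def)
  \<comment> \<open>The roots are accurate to order \<open>exp (1 - 2 * real n)\<close>. Half of
    this decay pays for the factor n^2 from the cubic phase; \<open>Q\<close> is the geometric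
    sequence that remains.\<close>
  define Q where "Q n = exp (1 - real n)" for n :: nat
  define A where "A n = 17 * (2 * (4 * C * (1 / real n ^ 2) + 76 * M * Q n)
      + 288 * ((norm (tilde_coeff u0 n))\<^sup>2 + 1 / real n ^ 2)) + B * (6144 * \<bar>t\<bar> * Q n + 16 * Q n)" for n
  have "summable (\<lambda>n. exp 1 * exp (- 1 :: real) ^ n)"
    by (intro summable_mult summable_geometric) simp
  also have "(\<lambda>n. exp 1 * exp (- 1 :: real) ^ n) = Q"
    by (simp add: fun_eq_iff Q_def exp_of_nat_mult[symmetric] exp_add[symmetric])
  finally have "summable Q" .
  moreover have "summable (\<lambda>n. 1 / real n ^ 2)"
    using inverse_power_summable[of 2, where 'a = real] by (simp add: inverse_eq_divide)
  moreover have "summable (\<lambda>n. (norm (tilde_coeff u0 n))\<^sup>2)"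
    using tilde_coeff_summable[OF u0] by (subst (asm) summable_Suc_iff)
  ultimately have "summable A"
    unfolding A_def by (intro summable_add summable_mult)
  moreover have "0 \<le> 8 * B" using B0 by simp
  moreover have "norm (airy_term (\<lambda>x. of_real (u0 x)) t \<kappa> x
        - tilde_coeff u0 n * exp (\<i> * of_real (airy_freq n ^ 3 * t)) * airy_exp n x)
      \<le> A n + 8 * B * (exp (- (real n * x)) + exp (- (real n * (1 - x))))"
    if n: "576 \<le> n" and near: "\<bar>\<kappa> - airy_freq n\<bar> \<le> 1" and root: "airy_char \<kappa> = 0" and x: "0 \<le> x" "x \<le> 1" for n \<kappa> x
  proof -
    define s where "s = sqrt 3 / 2 * \<kappa>"
    define E where "E = exp (1 - 2 * real n)"
    define e where "e = 16 * E"
    define k where "k = airy_freq n"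
    define T where "T = tilde_coeff u0 n"
    define J where "J = L2_inner (\<lambda>x. of_real (u0 x)) (airy_psi \<kappa>)"
    define \<nu> where "\<nu> = norm2 (airy_psi \<kappa>)"
    have data: "1 \<le> \<kappa>" "real n \<le> s" "\<bar>\<kappa> - k\<bar> \<le> e" "exp (- s) \<le> E"
      using airy_root_data[OF _ near root] n by (simp_all add: s_def e_def k_def E_def)
    have n1: "1 \<le> real n" using n by simp
    have s1: "1 \<le> s" using data(2) n1 by linarith
    have E_Q: "E \<le> Q n" "real n ^ 2 * E \<le> 2 * Q n" "0 \<le> E" "0 \<le> Q n"
    proof -
      show "E \<le> Q n" using n1 by (simp add: E_def Q_def)
      have "real n ^ 2 * E \<le> (2 * exp (real n)) * E"
        using square_le_exp[of "real n"] by (intro mult_right_mono) (auto simp: E_def)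
      also have "\<dots> = 2 * Q n"
        by (simp add: E_def Q_def exp_add[symmetric])
      finally show "real n ^ 2 * E \<le> 2 * Q n" .
    qed (simp_all add: E_def Q_def)
    have \<nu>: "\<bar>\<nu> - 1\<bar> \<le> 288 / real n" "1 / 2 \<le> \<nu>"
      using norm2_airy_psi_root[OF n near root] by (simp_all add: \<nu>_def)
    have JT: "norm (J - T) \<le> 4 * C * (1 / real n ^ 2) + 76 * M * Q n"
    proof -
      have "norm (J - T) \<le> 4 * C / s\<^sup>2 + 12 * M * exp (- s) + 4 * M * e"
        unfolding J_def T_def
        using n by (intro airy_inner_estimate[OF u0 _ C M_def s_def s1 data(1)] data(3)[unfolded k_def]) auto
      also have "4 * C / s\<^sup>2 \<le> 4 * C / (real n)\<^sup>2"
        using C0 data(2) n1 by (intro divide_left_mono power_mono mult_pos_pos) auto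
      also have "12 * M * exp (- s) \<le> 12 * M * Q n"
        using data(4) E_Q(1) M0 by (intro mult_left_mono) auto
      also have "4 * M * e \<le> 64 * M * Q n"
        using mult_left_mono[OF E_Q(1), of "64 * M"] M0 by (simp add: e_def)
      finally show ?thesis by (simp add: algebra_simps)
    qed
    have q: "norm (J / of_real \<nu> - T) \<le> 2 * (4 * C * (1 / real n ^ 2) + 76 * M * Q n)
      + 288 * ((norm (tilde_coeff u0 n))\<^sup>2 + 1 / real n ^ 2)"
    proof -
      have \<nu>0: "\<nu> \<noteq> 0" using \<nu>(2) by auto
      have "J / of_real \<nu> - T = (J - T) / of_real \<nu> - T * of_real (\<nu> - 1) / of_real \<nu>"
        using \<nu>0 by (simp add: field_simps)
      then have "norm (J / of_real \<nu> - T) \<le> norm ((J - T) / of_real \<nu>) + norm (T * of_real (\<nu> - 1) / of_real \<nu>)"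
        by (simp only: norm_triangle_ineq4)
      also have "norm ((J - T) / of_real \<nu>) \<le> norm (J - T) / (1 / 2)"
        unfolding norm_divide norm_of_real using \<nu>(2) by (intro divide_left_mono) auto
      also have "norm (T * of_real (\<nu> - 1) / of_real \<nu>) \<le> (norm T * (288 / real n)) / (1 / 2)"
        unfolding norm_divide norm_mult norm_of_real using \<nu> n1
        by (intro frac_le mult_left_mono mult_nonneg_nonneg) auto
      also have "(norm T * (288 / real n)) / (1 / 2) = 288 * (2 * norm T * (1 / real n))"
        by simp
      \<comment> \<open>The coefficient is only square summable in \<open>n\<close> and the norm
        error only O(1/n); this inequality makes their product summable.\<close>
      also have "\<dots> \<le> 288 * ((norm T)\<^sup>2 + (1 / real n)\<^sup>2)"
        by (intro mult_left_mono sum_squares_bound) simp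
      finally show ?thesis
        using JT by (simp add: T_def power_divide)
    qed
    have phase: "\<bar>(\<kappa> ^ 3 * t + \<kappa> * x) - (k ^ 3 * t + k * x)\<bar> \<le> 6144 * \<bar>t\<bar> * Q n + 16 * Q n"
    proof -
      have k: "0 \<le> k" "k \<le> 8 * real n" "0 \<le> \<kappa>" "\<kappa> \<le> 8 * real n"
        using airy_freq_gt[of n] n near data(1) by (auto simp: k_def)
      have "\<kappa> ^ 3 - k ^ 3 = (\<kappa> - k) * (\<kappa> * \<kappa> + \<kappa> * k + k * k)"
        by (simp add: power3_eq_cube algebra_simps)
      then have "\<bar>\<kappa> ^ 3 - k ^ 3\<bar> = \<bar>\<kappa> - k\<bar> * (\<kappa> * \<kappa> + \<kappa> * k + k * k)"
        using k by (simp add: abs_mult)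
      also have "\<dots> \<le> e * (8 * real n * (8 * real n) + 8 * real n * (8 * real n) + 8 * real n * (8 * real n))"
        using data(3) k E_Q(3) by (intro mult_mono add_mono) (auto simp: e_def)
      \<comment> \<open>The constant is 16 * 3 * 64: accuracy 16 of the root, three products, and
        two factors of at most 8n in each. Trading \<open>real n ^ 2 * E\<close> for
        \<open>2 * Q n\<close> doubles it.\<close>
      also have "\<dots> = 3072 * (real n ^ 2 * E)"
        by (simp add: e_def power2_eq_square)
      finally have c: "\<bar>\<kappa> ^ 3 - k ^ 3\<bar> \<le> 6144 * Q n" using E_Q(2) by linarith
      have "(\<kappa> ^ 3 * t + \<kappa> * x) - (k ^ 3 * t + k * x) = (\<kappa> ^ 3 - k ^ 3) * t + (\<kappa> - k) * x"
        by (simp add: algebra_simps)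
      also have "\<bar>\<dots>\<bar> \<le> \<bar>\<kappa> ^ 3 - k ^ 3\<bar> * \<bar>t\<bar> + \<bar>\<kappa> - k\<bar> * \<bar>x\<bar>"
        by (metis abs_mult abs_triangle_ineq)
      also have "\<dots> \<le> 6144 * Q n * \<bar>t\<bar> + e * 1"
        using c data(3) x E_Q(3) by (intro add_mono mult_mono) (auto simp: e_def)
      finally show ?thesis using E_Q(1) by (simp add: e_def mult_ac)
    qed
    define P where "P = exp (\<i> * of_real (\<kappa> ^ 3 * t))"
    have P: "norm P = 1" by (simp add: P_def)
    have PE: "P * airy_mode \<kappa> 1 x = exp (\<i> * of_real (\<kappa> ^ 3 * t + \<kappa> * x))"
      unfolding P_def airy_mode_1 exp_add[symmetric] by (simp add: algebra_simps)
    have kE: "exp (\<i> * of_real (airy_freq n ^ 3 * t)) * airy_exp n x = exp (\<i> * of_real (k ^ 3 * t + k * x))"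
      unfolding airy_exp_def exp_add[symmetric] k_def by (simp add: algebra_simps)
    have "airy_term (\<lambda>x. of_real (u0 x)) t \<kappa> x = P * (J / of_real \<nu>) * airy_psi \<kappa> x"
      using data(1) by (simp add: airy_term_psi P_def J_def \<nu>_def)
    \<comment> \<open>Three errors are separated: that of the coefficient, that of the layers, and
      that of the phase. Only the second depends on the distance to the end points.\<close>
    then have "airy_term (\<lambda>x. of_real (u0 x)) t \<kappa> x
        - tilde_coeff u0 n * exp (\<i> * of_real (airy_freq n ^ 3 * t)) * airy_exp n x
      = P * (J / of_real \<nu> - T) * airy_psi \<kappa> x + T * (P * (airy_psi \<kappa> x - airy_mode \<kappa> 1 x)
        + (exp (\<i> * of_real (\<kappa> ^ 3 * t + \<kappa> * x)) - exp (\<i> * of_real (k ^ 3 * t + k * x))))"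
      unfolding PE[symmetric] kE[symmetric] T_def by (simp add: algebra_simps)
    also have "norm \<dots> \<le> norm (P * (J / of_real \<nu> - T) * airy_psi \<kappa> x) + norm (T * (P * (airy_psi \<kappa> x - airy_mode \<kappa> 1 x)
        + (exp (\<i> * of_real (\<kappa> ^ 3 * t + \<kappa> * x)) - exp (\<i> * of_real (k ^ 3 * t + k * x)))))"
      by (rule norm_triangle_ineq)
    also have "norm (P * (J / of_real \<nu> - T) * airy_psi \<kappa> x) \<le> 17 * (2 * (4 * C * (1 / real n ^ 2) + 76 * M * Q n)
      + 288 * ((norm (tilde_coeff u0 n))\<^sup>2 + 1 / real n ^ 2))"
    proof -
      have "norm (P * (J / of_real \<nu> - T) * airy_psi \<kappa> x) = norm (airy_psi \<kappa> x) * norm (J / of_real \<nu> - T)"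
        unfolding norm_mult P by simp
      also have "\<dots> \<le> 17 * (2 * (4 * C * (1 / real n ^ 2) + 76 * M * Q n)
      + 288 * ((norm (tilde_coeff u0 n))\<^sup>2 + 1 / real n ^ 2))"
        by (intro mult_mono norm_airy_psi_le[OF s_def s1 x] q) auto
      finally show ?thesis .
    qed
    also have "norm (T * (P * (airy_psi \<kappa> x - airy_mode \<kappa> 1 x)
        + (exp (\<i> * of_real (\<kappa> ^ 3 * t + \<kappa> * x)) - exp (\<i> * of_real (k ^ 3 * t + k * x)))))
      \<le> B * (8 * (exp (- (real n * x)) + exp (- (real n * (1 - x)))) + (6144 * \<bar>t\<bar> * Q n + 16 * Q n))"
    proof -
      have "norm (P * (airy_psi \<kappa> x - airy_mode \<kappa> 1 x)) \<le> 8 * (exp (- (s * x)) + exp (- (s * (1 - x))))"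
        unfolding norm_mult P using airy_psi_near_mode[OF s_def s1 x] by simp
      also have "\<dots> \<le> 8 * (exp (- (real n * x)) + exp (- (real n * (1 - x))))"
        using data(2) x by (intro mult_left_mono add_mono) (auto intro: mult_right_mono)
      finally have "norm (P * (airy_psi \<kappa> x - airy_mode \<kappa> 1 x)) \<le> 8 * (exp (- (real n * x)) + exp (- (real n * (1 - x))))" .
      then show ?thesis
        unfolding norm_mult[of T] using T_le[of n] B0 order_trans[OF norm_exp_i_diff_le phase]
        unfolding T_def[symmetric]
        by (intro mult_mono order_trans[OF norm_triangle_ineq add_mono]) auto
    qed
    finally show ?thesis
      unfolding A_def by (simp add: algebra_simps)
  qed
  ultimately show ?thesis by (rule that)
qed

lemma L2_of_real:
  fixes f :: "real \<Rightarrow> real"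
  assumes "L2 f"
  shows "L2 (\<lambda>x. complex_of_real (f x))"
  using assms unfolding L2_def by auto

lemma norm2_of_real: "norm2 (\<lambda>x. complex_of_real (f x)) = norm2 f"
  by (simp add: norm2_def)

theorem airy_decomposition:
  assumes u0: "piecewise_lipschitz u0"
    and g: "exp_itA airy_operator t (\<lambda>x. of_real (u0 x)) g"
  shows "\<exists>UC. continuous_on {0<..<1} UC \<and> (AE x in unit_lebesgue. g x = of_real (UR u0 x t) + UC x)"
proof -
  define f where "f x = complex_of_real (u0 x)" for x
  have f: "L2 f" using piecewise_lipschitz_L2[OF u0, of 0] by (simp add: f_def[abs_def])
  obtain K where K: "\<And>\<kappa>. \<kappa> \<in> K \<Longrightarrow> \<kappa> \<noteq> 0 \<and> airy_Delta \<kappa> = 0"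
    "\<And>\<kappa>. \<kappa> \<noteq> 0 \<Longrightarrow> airy_Delta \<kappa> = 0 \<Longrightarrow> norm2 (airy_Psi \<kappa>) \<noteq> 0 \<Longrightarrow> \<kappa> \<in> K"
    "\<And>A. \<forall>N. finite (A N) \<and> A N \<subseteq> K \<Longrightarrow> \<forall>\<kappa>\<in>K. \<forall>\<^sub>F N in sequentially. \<kappa> \<in> A N \<Longrightarrow>
       (\<lambda>N. norm2 (\<lambda>x. (\<Sum>\<kappa>\<in>A N. airy_term f t \<kappa> x) - g x)) \<longlonglongrightarrow> 0"
    and gL2: "L2 g"
    using airy_expansion[OF g[folded f_def] f] by (elim exE conjE) blast
  have "\<exists>\<kappa>. 576 \<le> n \<longrightarrow> \<bar>\<kappa> - airy_freq n\<bar> \<le> 1 \<and> airy_char \<kappa> = 0" for n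
    using airy_root_exists[of n] by auto
  then obtain l where l: "\<And>n. 576 \<le> n \<Longrightarrow> \<bar>l n - airy_freq n\<bar> \<le> 1" "\<And>n. 576 \<le> n \<Longrightarrow> airy_char (l n) = 0"
    by metis
  have l1: "1 \<le> l n" if "576 \<le> n" for n
    using airy_root_data(1)[OF _ l[OF that]] that by simp
  have inj: "inj_on l {576..}"
  proof (rule inj_onI)
    fix m n assume mn: "m \<in> {576..}" "n \<in> {576..}" "l m = l n"
    \<comment> \<open>A common root lies within 1 of both frequencies, whereas distinct frequencies
      are at least 2 pi apart.\<close>
    have "\<bar>airy_freq m - airy_freq n\<bar> \<le> 2"
      using l(1)[of m] l(1)[of n] mn by auto
    moreover have "airy_freq m - airy_freq n = 2 * pi * (real m - real n)"
      by (simp add: airy_freq_def algebra_simps)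
    moreover define d where "d = \<bar>real m - real n\<bar>"
    ultimately have "2 * pi * d \<le> 2"
      by (simp add: abs_mult)
    moreover have "0 \<le> d" by (simp add: d_def)
    then have "6 * d \<le> 2 * pi * d"
      using pi_gt3 by (intro mult_right_mono) auto
    ultimately have "6 * d \<le> 2" by (rule order_trans[rotated])
    then have "d < 1" by simp
    moreover have "d = real_of_int \<bar>int m - int n\<bar>"
      unfolding d_def of_int_abs of_int_diff of_int_of_nat_eq ..
    ultimately have "\<bar>int m - int n\<bar> < 1"
      by linarith
    then show "m = n" by simp
  qed
  have l_K: "l n \<in> K" "- l n \<in> K" if n: "576 \<le> n" for n
  proof -
    have "airy_Delta (l n) = 0" using l(2)[OF n] by (simp add: airy_Delta_eq_0_iff)
    moreover have "airy_Delta (- l n) = 0" unfolding airy_Delta_minus using calculation by simp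
    moreover have "l n \<noteq> 0" using l1[OF n] by auto
    moreover have "norm2 (airy_Psi (l n)) \<noteq> 0"
      using n l by (intro norm2_airy_Psi_root) auto
    moreover have "norm2 (airy_Psi (- l n)) = norm2 (airy_Psi (l n))"
      by (simp add: norm2_def airy_Psi_minus)
    ultimately show "l n \<in> K" "- l n \<in> K" using K(2) by auto
  qed
  \<comment> \<open>The wave numbers not matched to a frequency; being finitely many, they
    contribute a continuous function.\<close>
  define R where "R = K - (l ` {576..} \<union> uminus ` l ` {576..})"
  have "R \<subseteq> {\<kappa> \<in> {- airy_freq 576..airy_freq 576}. airy_char \<kappa> = 0}"
  proof
    fix \<kappa> assume \<kappa>: "\<kappa> \<in> R"
    then have Delta: "airy_Delta \<kappa> = 0" using K(1) by (auto simp: R_def)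
    then have "airy_Delta (- \<kappa>) = 0" unfolding airy_Delta_minus by simp
    with Delta have char: "airy_char \<kappa> = 0" "airy_char \<bar>\<kappa>\<bar> = 0"
      by (auto simp: airy_Delta_eq_0_iff abs_if)
    have "\<bar>\<kappa>\<bar> \<le> airy_freq 576"
    proof (rule ccontr)
      assume big: "\<not> \<bar>\<kappa>\<bar> \<le> airy_freq 576"
      \<comment> \<open>The integer part of \<open>y\<close> is the index, counted from 576, of the
        frequency nearest to \<open>\<bar>\<kappa>\<bar>\<close>: adding \<open>pi\<close> before
        division by the spacing \<open>2 * pi\<close> turns truncation into rounding.\<close>
      define y where "y = (\<bar>\<kappa>\<bar> - airy_freq 576 + pi) / (2 * pi)"
      define m where "m = nat \<lfloor>y\<rfloor>"
      have "0 \<le> y" using big pi_gt3 by (simp add: y_def)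
      then have m: "real m \<le> y" "y < real m + 1" by (auto simp: m_def)
      define w where "w = \<bar>\<kappa>\<bar>"
      have "2 * pi * real m \<le> 2 * pi * y" "2 * pi * y \<le> 2 * pi * (real m + 1)"
        using m by (intro mult_left_mono; simp)+
      then have "2 * pi * real m \<le> 2 * pi * y" "2 * pi * y \<le> 2 * pi * real m + 2 * pi"
        by (simp_all add: distrib_left)
      moreover have "2 * pi * y = w - airy_freq 576 + pi"
        by (simp add: y_def w_def)
      moreover have "airy_freq (576 + m) = airy_freq 576 + 2 * pi * real m"
        by (simp add: airy_freq_def algebra_simps)
      ultimately have "w - airy_freq (576 + m) \<le> pi" "- (w - airy_freq (576 + m)) \<le> pi"
        by linarith+
      then have "\<bar>\<bar>\<kappa>\<bar> - airy_freq (576 + m)\<bar> \<le> pi"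
        unfolding w_def by (rule abs_leI)
      then have "\<bar>\<bar>\<kappa>\<bar> - airy_freq (576 + m)\<bar> \<le> 16 * exp (1 - 2 * real (576 + m))"
        by (intro airy_root_near char(2)) auto
      also have "\<dots> \<le> 1"
        using exp_odd_small[of "576 + m"] by simp
      finally have "\<bar>\<kappa>\<bar> = l (576 + m)"
        using airy_root_unique[of "576 + m" "\<bar>\<kappa>\<bar>" "l (576 + m)"] char(2) l[of "576 + m"] by simp
      then have "\<kappa> = l (576 + m) \<or> \<kappa> = - l (576 + m)" by linarith
      then have "\<kappa> \<in> l ` {576..} \<union> uminus ` l ` {576..}"
        by (elim disjE ssubst) simp_all
      with \<kappa> show False by (simp add: R_def)
    qed
    then show "\<kappa> \<in> {\<kappa> \<in> {- airy_freq 576..airy_freq 576}. airy_char \<kappa> = 0}"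
      using char by auto
  qed
  then have finR: "finite R"
    using airy_roots_finite finite_subset by blast
  define P where "P N = l ` {576..<576 + N}" for N :: nat
  \<comment> \<open>Opposite wave numbers enter together, so every partial sum is the fixed sum over
    \<open>R\<close> plus a real function.\<close>
  define A where "A N = R \<union> (P N \<union> uminus ` P N)" for N
  have P1: "1 \<le> \<kappa>" if "\<kappa> \<in> P N" for \<kappa> N
    using that l1 by (auto simp: P_def)
  have lim_A: "(\<lambda>N. norm2 (\<lambda>x. (\<Sum>\<kappa>\<in>A N. airy_term f t \<kappa> x) - g x)) \<longlonglongrightarrow> 0"
  proof (rule K(3))
    show "\<forall>N. finite (A N) \<and> A N \<subseteq> K"
      using finR l_K by (auto simp: A_def P_def R_def)
    show "\<forall>\<kappa>\<in>K. \<forall>\<^sub>F N in sequentially. \<kappa> \<in> A N"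
    proof
      fix \<kappa> assume "\<kappa> \<in> K"
      show "\<forall>\<^sub>F N in sequentially. \<kappa> \<in> A N"
      proof (cases "\<kappa> \<in> R")
        case False
        then obtain n where n: "576 \<le> n" "\<kappa> = l n \<or> \<kappa> = - l n"
          using \<open>\<kappa> \<in> K\<close> by (auto simp: R_def)
        show ?thesis
        proof (rule eventually_sequentiallyI[of "Suc n"])
          fix N assume "Suc n \<le> N"
          then have "l n \<in> P N" using n(1) by (auto simp: P_def)
          then show "\<kappa> \<in> A N" using n(2) by (auto simp: A_def)
        qed
      qed (simp add: A_def)
    qed
  qed
  define D where "D n x = 2 * Re (airy_term f t (l (576 + n)) x
    - tilde_coeff u0 (576 + n) * exp (\<i> * of_real (airy_freq (576 + n) ^ 3 * t)) * airy_exp (576 + n) x)" for n x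
  define fin_part where "fin_part x = (\<Sum>\<kappa>\<in>R. airy_term f t \<kappa> x) - of_real (\<Sum>i<575. UR_term u0 t i x)" for x
  \<comment> \<open>\<open>UR_term u0 t i\<close> has the frequency with index \<open>Suc i\<close>, hence 575 against 576 in \<open>P\<close>.\<close>
  define S where "S N x = (\<Sum>\<kappa>\<in>A N. airy_term f t \<kappa> x) - of_real (\<Sum>i<N + 575. UR_term u0 t i x)" for N x
  \<comment> \<open>Two views of one sequence: as a difference of partial sums it tends to
    \<open>g\<close> minus the revival part in mean square, and as a fixed part plus a series of
    differences it converges pointwise.\<close>
  have S_eq: "S N x = fin_part x + of_real (\<Sum>n<N. D n x)" for N x
  proof -
    have finP: "finite (P N)" by (simp add: P_def)
    have "R \<inter> (P N \<union> uminus ` P N) = {}"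
      by (auto simp: R_def P_def)
    moreover have "P N \<inter> uminus ` P N = {}"
    proof (rule ccontr)
      assume "P N \<inter> uminus ` P N \<noteq> {}"
      then obtain \<kappa> where "\<kappa> \<in> P N" "- \<kappa> \<in> P N" by auto
      from P1[OF this(1)] P1[OF this(2)] show False by simp
    qed
    ultimately have "(\<Sum>\<kappa>\<in>A N. airy_term f t \<kappa> x) = (\<Sum>\<kappa>\<in>R. airy_term f t \<kappa> x)
        + ((\<Sum>\<kappa>\<in>P N. airy_term f t \<kappa> x) + (\<Sum>\<kappa>\<in>uminus ` P N. airy_term f t \<kappa> x))"
      unfolding A_def using finR finP by (simp add: sum.union_disjoint)
    also have "(\<Sum>\<kappa>\<in>uminus ` P N. airy_term f t \<kappa> x) = (\<Sum>\<kappa>\<in>P N. cnj (airy_term f t \<kappa> x))"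
      by (subst sum.reindex) (simp_all add: airy_term_minus f_def)
    also have "(\<Sum>\<kappa>\<in>P N. airy_term f t \<kappa> x) + \<dots> = (\<Sum>\<kappa>\<in>P N. of_real (2 * Re (airy_term f t \<kappa> x)))"
      by (simp only: sum.distrib[symmetric] complex_add_cnj)
    also have "\<dots> = (\<Sum>n<N. of_real (2 * Re (airy_term f t (l (576 + n)) x)))"
    proof -
      have "inj_on l {576..<576 + N}" using inj by (rule inj_on_subset) auto
      then have "(\<Sum>\<kappa>\<in>P N. of_real (2 * Re (airy_term f t \<kappa> x))) = (\<Sum>n=0+576..<N+576. of_real (2 * Re (airy_term f t (l n) x)) :: complex)"
        unfolding P_def by (subst sum.reindex) (simp_all add: add.commute)
      also have "\<dots> = (\<Sum>n<N. of_real (2 * Re (airy_term f t (l (576 + n)) x)))"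
        by (subst sum.shift_bounds_nat_ivl) (simp add: lessThan_atLeast0 add.commute)
      finally show ?thesis .
    qed
    finally have 1: "(\<Sum>\<kappa>\<in>A N. airy_term f t \<kappa> x) = (\<Sum>\<kappa>\<in>R. airy_term f t \<kappa> x)
        + (\<Sum>n<N. of_real (2 * Re (airy_term f t (l (576 + n)) x)))" .
    have "(\<Sum>i<N + 575. UR_term u0 t i x) = (\<Sum>i<575. UR_term u0 t i x) + (\<Sum>n<N. UR_term u0 t (n + 575) x)"
      using sum.atLeastLessThan_concat[of 0 575 "N + 575" "\<lambda>i. UR_term u0 t i x"]
        sum.shift_bounds_nat_ivl[of "\<lambda>i. UR_term u0 t i x" 0 575 N]
      by (simp add: lessThan_atLeast0)
    moreover have "UR_term u0 t (n + 575) x = 2 * Re (tilde_coeff u0 (576 + n)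
        * exp (\<i> * of_real (airy_freq (576 + n) ^ 3 * t)) * airy_exp (576 + n) x)" for n
    proof -
      have "Suc (n + 575) = 576 + n" by simp
      then show ?thesis unfolding UR_term_def airy_exp_def by (simp only:)
    qed
    ultimately show ?thesis
      unfolding S_def fin_part_def D_def 1 by (simp add: sum_subtractf right_diff_distrib)
  qed
  obtain a b where ab: "summable a" "0 \<le> b"
    "\<And>n \<kappa> x. 576 \<le> n \<Longrightarrow> \<bar>\<kappa> - airy_freq n\<bar> \<le> 1 \<Longrightarrow> airy_char \<kappa> = 0 \<Longrightarrow> 0 \<le> x \<Longrightarrow> x \<le> 1 \<Longrightarrow>
      norm (airy_term f t \<kappa> x
        - tilde_coeff u0 n * exp (\<i> * of_real (airy_freq n ^ 3 * t)) * airy_exp n x)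
      \<le> a n + b * (exp (- (real n * x)) + exp (- (real n * (1 - x))))"
    by (rule airy_term_approx[OF u0, where t = t, folded f_def]) (rule that)
  have D_cont: "continuous_on X (\<lambda>x. D n x)" for X n
    unfolding D_def by (intro continuous_intros)
  have unif: "uniform_limit {\<delta>..1 - \<delta>} (\<lambda>N x. \<Sum>n<N. D n x) (\<lambda>x. \<Sum>n. D n x) sequentially" if \<delta>: "0 < \<delta>" for \<delta>
  proof (rule Weierstrass_m_test)
    \<comment> \<open>At distance at least \<open>\<delta>\<close> from both end points the two
      layers are dominated by powers of \<open>exp (- \<delta>)\<close>, which makes the majorant
      summable.\<close>
    define m where "m n = 2 * (a n + b * (2 * exp (- \<delta>) ^ n))" for n :: nat
    have "summable m"
      unfolding m_def using \<delta> by (intro summable_mult summable_add ab(1) summable_geometric) auto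
    then show "summable (\<lambda>n. m (n + 576))"
      by (subst summable_iff_shift)
    fix n :: nat and x assume x: "x \<in> {\<delta>..1 - \<delta>}"
    define N where "N = 576 + n"
    have "exp (- (real N * x)) \<le> exp (- \<delta>) ^ N" "exp (- (real N * (1 - x))) \<le> exp (- \<delta>) ^ N"
      unfolding exp_of_nat_mult[symmetric] using x by (simp_all add: mult_left_mono)
    then have "a N + b * (exp (- (real N * x)) + exp (- (real N * (1 - x)))) \<le> a N + b * (2 * exp (- \<delta>) ^ N)"
      using ab(2) by (intro add_left_mono mult_left_mono) auto
    moreover have "norm (D n x) \<le> 2 * (a N + b * (exp (- (real N * x)) + exp (- (real N * (1 - x)))))"
    proof -
      have "norm (D n x) \<le> 2 * norm (airy_term f t (l N) x
          - tilde_coeff u0 N * exp (\<i> * of_real (airy_freq N ^ 3 * t)) * airy_exp N x)"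
        unfolding D_def N_def[symmetric] abs_mult real_norm_def abs_numeral
        by (intro mult_left_mono abs_Re_le_cmod) simp
      also have "\<dots> \<le> 2 * (a N + b * (exp (- (real N * x)) + exp (- (real N * (1 - x)))))"
        using x \<delta> l[of N] by (intro mult_left_mono ab(3)) (auto simp: N_def)
      finally show ?thesis .
    qed
    ultimately show "norm (D n x) \<le> m (n + 576)"
      unfolding m_def by (simp add: N_def add.commute)
  qed
  define UC where "UC x = fin_part x + of_real (\<Sum>n. D n x)" for x
  have "continuous_on {0<..<1} (\<lambda>x. \<Sum>n. D n x)"
  proof -
    \<comment> \<open>Uniform convergence is available on closed subintervals only; passing to their
      interiors gives an open cover on which continuity can be glued.\<close>
    have "continuous_on {\<delta><..<1 - \<delta>} (\<lambda>x. \<Sum>n. D n x)" if "\<delta> \<in> {0<..}" for \<delta> :: real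
    proof -
      have "continuous_on {\<delta>..1 - \<delta>} (\<lambda>x. \<Sum>n. D n x)"
        using that
        by (intro uniform_limit_theorem[OF _ unif] always_eventually allI continuous_on_sum D_cont) auto
      then show ?thesis by (rule continuous_on_subset) auto
    qed
    then have "continuous_on (\<Union>\<delta>\<in>{0<..}. {\<delta><..<1 - \<delta>}) (\<lambda>x. \<Sum>n. D n x)"
      by (intro continuous_on_open_UN) auto
    moreover have "{0<..<1} \<subseteq> (\<Union>\<delta>\<in>{0<..}. {\<delta><..<1 - \<delta>::real})"
    proof
      fix x :: real assume "x \<in> {0<..<1}"
      then show "x \<in> (\<Union>\<delta>\<in>{0<..}. {\<delta><..<1 - \<delta>})"
        by (intro UN_I[of "min x (1 - x) / 2"]) (auto simp: min_def field_simps)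
    qed
    ultimately show ?thesis by (rule continuous_on_subset)
  qed
  then have "continuous_on {0<..<1} UC"
    unfolding UC_def fin_part_def UR_term_def by (intro continuous_intros)
  moreover have "AE x in unit_lebesgue. g x - of_real (UR u0 x t) = UC x"
  proof (rule L2_limit_AE_eq)
    have UR: "L2_sums (UR_term u0 t) (\<lambda>x. UR u0 x t)" by (rule UR_L2_sums[OF u0])
    then have URL2: "L2 (UR_term u0 t i)" "L2 (\<lambda>x. UR u0 x t)" for i by (auto simp: L2_sums_iff)
    have AL2: "L2 (\<lambda>x. \<Sum>\<kappa>\<in>A N. airy_term f t \<kappa> x)" for N
      by (intro L2_sum L2_airy_term)
    have UL2: "L2 (\<lambda>x. \<Sum>i<N + 575. UR_term u0 t i x)" for N
      by (intro L2_sum URL2)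
    show "L2 (S N)" for N
      unfolding S_def by (intro L2_diff AL2 L2_of_real[OF UL2])
    show "L2 (\<lambda>x. g x - of_real (UR u0 x t))"
      by (intro L2_diff gL2 L2_of_real[OF URL2(2)])
    have "norm (norm2 (\<lambda>x. S N x - (g x - of_real (UR u0 x t))))
      \<le> 2 * norm2 (\<lambda>x. (\<Sum>\<kappa>\<in>A N. airy_term f t \<kappa> x) - g x)
        + 2 * norm2 (\<lambda>x. (\<Sum>i<N + 575. UR_term u0 t i x) - UR u0 x t)" for N
    proof -
      have "(\<lambda>x. S N x - (g x - of_real (UR u0 x t))) = (\<lambda>x. ((\<Sum>\<kappa>\<in>A N. airy_term f t \<kappa> x) - g x)
          - of_real ((\<Sum>i<N + 575. UR_term u0 t i x) - UR u0 x t))"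
        by (simp add: fun_eq_iff S_def)
      then show ?thesis
        using norm2_diff_le[OF L2_diff[OF AL2[of N] gL2] L2_of_real[OF L2_diff[OF UL2[of N] URL2(2)]]]
        by (simp only: norm2_of_real real_norm_def abs_of_nonneg[OF norm2_nonneg])
    qed
    note le = LIMSEQ_norm_le_0[OF this]
    have "(\<lambda>N. norm2 (\<lambda>x. (\<Sum>i<N + 575. UR_term u0 t i x) - UR u0 x t)) \<longlonglongrightarrow> 0"
      using UR LIMSEQ_ignore_initial_segment[of "\<lambda>N. norm2 (\<lambda>x. (\<Sum>i<N. UR_term u0 t i x) - UR u0 x t)" 0 575]
      unfolding L2_sums_iff by blast
    from tendsto_add[OF tendsto_mult_left[OF lim_A, of 2] tendsto_mult_left[OF this, of 2]]
    show "(\<lambda>N. norm2 (\<lambda>x. S N x - (g x - of_real (UR u0 x t)))) \<longlonglongrightarrow> 0"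
      by (intro le) simp
    show "AE x in unit_lebesgue. (\<lambda>N. S N x) \<longlonglongrightarrow> UC x"
    proof (rule AE_I2)
      fix x assume "x \<in> space unit_lebesgue"
      then have x: "0 < min x (1 - x)" "x \<in> {min x (1 - x)..1 - min x (1 - x)}" by auto
      have "(\<lambda>N. \<Sum>n<N. D n x) \<longlonglongrightarrow> (\<Sum>n. D n x)"
        by (rule tendsto_uniform_limitI[OF unif[OF x(1)] x(2)])
      then show "(\<lambda>N. S N x) \<longlonglongrightarrow> UC x"
        unfolding S_eq UC_def by (intro tendsto_intros)
    qed
  qed
  then have "AE x in unit_lebesgue. g x = of_real (UR u0 x t) + UC x"
    by eventually_elim (simp add: algebra_simps)
  ultimately show ?thesis by blast
qed

text \<open>\<open>UR\<close> is a chosen representative of a sum in L2, so convergence of its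
  series is asserted along with the identities. The quantifier for \<open>d\<close> precedes the one
  for the data, which expresses independence of \<open>u0\<close>.\<close>

theorem theorem2p1:
  shows
    "(\<forall>u0. piecewise_lipschitz u0 \<longrightarrow>
        (\<forall>t. L2_sums (UR_term u0 t) (\<lambda>x. UR u0 x t)) \<and>
        (\<forall>u. airy_solution u0 u \<longrightarrow>
           (\<exists>UC :: real \<Rightarrow> real \<Rightarrow> complex. \<forall>t.
              continuous_on {0<..<1} (\<lambda>x. UC x t) \<and>
              (AE x in unit_lebesgue. u x t = of_real (UR u0 x t) + UC x t)))) \<and>
     (\<forall>p q :: nat. 1 \<le> p \<longrightarrow> 1 \<le> q \<longrightarrow> coprime p q \<longrightarrow>
        (\<exists>d :: nat \<Rightarrow> complex. \<forall>u0. piecewise_lipschitz u0 \<longrightarrow>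
           (AE x in unit_lebesgue.
              UR u0 x (real p / (real q * pi\<^sup>2)) =
              Re (exp (- \<i> * of_real (pi / 27 * (9 * x + real p / real q)))
                  * (L1_part d p q u0 x + \<i> * L2_part d p q u0 x - L3_part u0)))))"
proof (intro conjI allI impI)
  fix u0 :: "real \<Rightarrow> real" and t :: real
  assume "piecewise_lipschitz u0"
  then show "L2_sums (UR_term u0 t) (\<lambda>x. UR u0 x t)"
    by (rule UR_L2_sums)
next
  fix u0 :: "real \<Rightarrow> real" and u
  assume u0: "piecewise_lipschitz u0" and u: "airy_solution u0 u"
  have "\<exists>UC. continuous_on {0<..<1} UC \<and> (AE x in unit_lebesgue. u x t = of_real (UR u0 x t) + UC x)" for t
    using u unfolding airy_solution_def by (intro airy_decomposition u0) blast
  \<comment> \<open>The choice is made for each \<open>t\<close> separately, in accordance with a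
    claim of continuity in \<open>x\<close> alone.\<close>
  then obtain UC where "\<And>t. continuous_on {0<..<1} (UC t) \<and>
      (AE x in unit_lebesgue. u x t = of_real (UR u0 x t) + UC t x)"
    by metis
  then show "\<exists>UC :: real \<Rightarrow> real \<Rightarrow> complex. \<forall>t. continuous_on {0<..<1} (\<lambda>x. UC x t) \<and>
      (AE x in unit_lebesgue. u x t = of_real (UR u0 x t) + UC x t)"
    by (intro exI[of _ "\<lambda>x t. UC t x"]) simp
next
  fix p q :: nat
  assume "1 \<le> q"
  then show "\<exists>d. \<forall>u0. piecewise_lipschitz u0 \<longrightarrow>
      (AE x in unit_lebesgue. UR u0 x (real p / (real q * pi\<^sup>2)) =
        Re (exp (- \<i> * of_real (pi / 27 * (9 * x + real p / real q)))
          * (L1_part d p q u0 x + \<i> * L2_part d p q u0 x - L3_part u0)))"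
    by (rule UR_rational_time)
qed

end
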